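(* Let $\mathbb{K}\subset\mathbb{C}$ be any field, $\mathbf{f}=(f_1,\dots,f_N)\in\mathbb{K}[x_1,\dots,x_n]^N$, and let $\xi\in\mathbb{C}^n$ be an isolated solution of $\mathbf{f}$. Let $Q\subset\mathbb{C}[\mathbf{x}]$ be the primary component at $\xi$ of the ideal generated by $f_1,\dots,f_N$, and let $B=\{(\mathbf{x}-\xi)^{\alpha_0},\dots,(\mathbf{x}-\xi)^{\alpha_{\delta-1}}\}$ be a basis of $\mathbb{C}[\mathbf{x}]/Q$ which is part of an orthogonal primal-dual basis pair. Let $E=\{\alpha_0,\dots,\alpha_{\delta-1}\}\subset\mathbb{N}^n$, let $\mathtt{M}_i(\mu)$, $i=1,\dots,n$, be the parametric multiplication matrices corresponding to $E$, and let $\mathcal{N}_{\xi,\mu}$ be the parametric normal form at $\mathbf{z}=\xi$. Then the ideal $L_\xi$ of $\mathbb{C}[\mu]$ generated by the (entries of the) polynomial system $$\begin{cases}\mathcal{N}_{\xi,\mu}(f_k)&\text{for }k=1,\dots,N,\\ \mathtt{M}_i(\mu)\cdot\mathtt{M}_j(\mu)-\mathtt{M}_j(\mu)\cdot\mathtt{M}_i(\mu)&\text{for }i,j=1,\dots,n\end{cases}$$ is the maximal ideal $$\mathfrak{m}_\nu=\left(\mu_{\alpha,\beta}-\nu_{\alpha,\beta}\;:\;(\alpha,\beta)\in E\times\partial(E)\right),$$ where the $\nu_{\alpha,\beta}$ are the coefficients of the dual basis of $B$.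
   Context: Functionals. For $\beta\in\mathbb{N}^n$, $\partial_\xi^\beta(p)=\frac{\partial^{|\beta|}p}{\partial x_1^{\beta_1}\cdots\partial x_n^{\beta_n}}(\xi)$; $\mathbb{C}[\partial_\xi]$ is the space of finite linear combinations of the $\partial_\xi^\beta$, and the order $\operatorname{ord}(\Lambda)$ of $\Lambda$ is the maximal $|\beta|$ such that $\partial_\xi^\beta$ occurs in $\Lambda$ with non-zero coefficient. Let $\mathscr{D}=Q^\perp\subset\mathbb{C}[\partial_\xi]$ be the space of functionals vanishing on $Q$, $\mathscr{D}_t$ its elements of order $\le t$, $\delta=\dim\mathscr{D}=\dim\mathbb{C}[\mathbf{x}]/Q$ the multiplicity, and $o$ the maximal order of elements of $\mathscr{D}$. Orthogonal primal-dual basis pair. $B$ (primal basis) is a basis of $\mathbb{C}[\mathbf{x}]/Q$ with $\alpha_0=0$ and $B$ connected to $1$ (for each $\alpha_k\ne0$ in $E$ there are $\alpha_j\in E$ and $i\in\{1,\dots,n\}$ with $\alpha_k=\alpha_j+\mathbf{e}_i$), such that the unique basis $\Lambda_0,\dots,\Lambda_{\delta-1}$ of $\mathscr{D}$ dual to $B$ (i.e. $\Lambda_i((\mathbf{x}-\xi)^{\alpha_j})=\delta_{ij}$, Kronecker delta) has the form $\Lambda_0=1_\xi$ (evaluation at $\xi$) and $$\Lambda_i=\frac{1}{\alpha_i!}\partial_\xi^{\alpha_i}+\sum_{|\beta|\le|\alpha_i|,\ \beta\notin E}\nu_{\alpha_i,\beta}\frac{1}{\beta!}\partial_\xi^\beta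 ,$$ with $0=\operatorname{ord}(\Lambda_0)\le\dots\le\operatorname{ord}(\Lambda_{\delta-1})$ and $\mathscr{D}_t=\operatorname{span}\{\Lambda_j:\operatorname{ord}(\Lambda_j)\le t\}$ for $0\le t\le o$. (One sets $\nu_{\alpha_i,\beta}=0$ for $\beta\notin E$, $|\beta|>|\alpha_i|$.) Border. $E^+=\bigcup_{i=1}^n(E+\mathbf{e}_i)$ and $\partial(E)=E^+\setminus E$, with $\mathbf{e}_i$ the $i$-th standard unit vector. Parametric multiplication matrices. For $i=1,\dots,n$, $\mathtt{M}_i(\mu)$ is the $\delta\times\delta$ matrix whose transpose $\mathtt{M}_i^t(\mu)$, with rows and columns indexed by $0,\dots,\delta-1$, has entry in row $k$, column $l$ equal to $0$ if $k\ge l$, and for $k<l$ equal to $$\mu_{\alpha_l,\alpha_k+\mathbf{e}_i}=\begin{cases}1&\text{if }\alpha_l=\alpha_k+\mathbf{e}_i,\\ 0&\text{if }\alpha_k+\mathbf{e}_i\in E,\ \alpha_l\ne\alpha_k+\mathbf{e}_i,\\ \text{the variable }\mu_{\alpha_l,\alpha_k+\mathbf{e}_i}&\text{if }\alpha_k+\mathbf{e}_i\notin E.\end{cases}$$ $\mu$ denotes the collection of all variables occurring in these matrices, $\mathbb{C}[\mu]$ the polynomial ring in these variables, and $\mathfrak{m}_\nu$ is generated by $\mu_{\alpha,\beta}-\nu_{\alpha,\beta}$ over these variables. Put $\mathtt{M}(\mu)^\gamma=\mathtt{M}_1(\mu)^{\gamma_1}\cdots\mathtt{M}_n(\mu)^{\gamma_n}$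 (in this order). Parametric normal form. $\mathcal{N}_{\mathbf{z},\mu}(p)=\sum_{\gamma\in\mathbb{N}^n}\frac{1}{\gamma!}\,\partial_{\mathbf{z}}^\gamma(p)\,\mathtt{M}(\mu)^\gamma[1]$, a vector of length $\delta$, where $\partial_{\mathbf{z}}^\gamma(p)$ is the $\gamma$-th partial derivative of $p$ evaluated at $\mathbf{z}$ and $[1]=(1,0,\dots,0)^t$; $\mathcal{N}_{\xi,\mu}$ is its specialization at $\mathbf{z}=\xi$. *)

theory Defs
  imports
    "HOL-Analysis.Analysis"
    "HOL-Library.Poly_Mapping"
    "HOL-Algebra.Algebraic_Closure_Type"
    "Jordan_Normal_Form.Matrix"
begin

section \<open>Multivariate polynomials\<close>

text \<open>
  Polynomials with variables from \<open>'v\<close> are finitely supported coefficient families on the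
  exponents \<open>'v \<Rightarrow>\<^sub>0 nat\<close>. The variables \<open>x\<^sub>1, \<dots>, x\<^sub>n\<close> are indexed by a type \<open>'n\<close> that is finite
  and linearly ordered; the order fixes the order of the factors in products over \<open>i = 1, \<dots>, n\<close>.
\<close>

type_synonym 'v expo = "'v \<Rightarrow>\<^sub>0 nat"
type_synonym 'v cpoly = "'v expo \<Rightarrow>\<^sub>0 complex"

definition const_poly :: "complex \<Rightarrow> 'v cpoly" where
  "const_poly c = Poly_Mapping.single 0 c"

definition unit_expo :: "'v \<Rightarrow> 'v expo" where
  "unit_expo i = Poly_Mapping.single i 1"

definition var_poly :: "'v \<Rightarrow> 'v cpoly" where
  "var_poly v = Poly_Mapping.single (unit_expo v) 1"

definition cscale :: "complex \<Rightarrow> 'v cpoly \<Rightarrow> 'v cpoly" where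
  "cscale c p = const_poly c * p"

definition expo_deg :: "'n::finite expo \<Rightarrow> nat" where
  "expo_deg \<beta> = (\<Sum>i\<in>UNIV. Poly_Mapping.lookup \<beta> i)"

definition expo_fact :: "'n::finite expo \<Rightarrow> complex" where
  "expo_fact \<beta> = (\<Prod>i\<in>UNIV. fact (Poly_Mapping.lookup \<beta> i))"

definition eval_poly :: "'n::finite cpoly \<Rightarrow> complex^'n \<Rightarrow> complex" where
  "eval_poly p z = (\<Sum>\<gamma>\<in>Poly_Mapping.keys p.
     Poly_Mapping.lookup p \<gamma> * (\<Prod>i\<in>UNIV. vec_nth z i ^ Poly_Mapping.lookup \<gamma> i))"

definition shifted_monom :: "complex^'n \<Rightarrow> 'n::finite expo \<Rightarrow> 'n cpoly" where
  "shifted_monom \<xi> \<beta> =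
     (\<Prod>i\<in>UNIV. (var_poly i - const_poly (vec_nth \<xi> i)) ^ Poly_Mapping.lookup \<beta> i)"

definition partial_deriv :: "'n \<Rightarrow> 'n cpoly \<Rightarrow> 'n cpoly" where
  "partial_deriv i p = (\<Sum>\<gamma>\<in>Poly_Mapping.keys p.
     Poly_Mapping.single (\<gamma> - unit_expo i)
       (of_nat (Poly_Mapping.lookup \<gamma> i) * Poly_Mapping.lookup p \<gamma>))"

definition partial_derivs :: "'n::{finite,linorder} expo \<Rightarrow> 'n cpoly \<Rightarrow> 'n cpoly" where
  "partial_derivs \<beta> p =
     foldr (\<lambda>i. partial_deriv i ^^ Poly_Mapping.lookup \<beta> i) (sorted_list_of_set UNIV) p"


section \<open>Primary components\<close>

definition ideal_radical :: "'a::comm_ring_1 set \<Rightarrow> 'a set" where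
  "ideal_radical I = {p. \<exists>m::nat. p ^ m \<in> I}"

definition primary_ideal :: "'a::comm_ring_1 set \<Rightarrow> bool" where
  "primary_ideal Q \<longleftrightarrow> ideal Q ring_of_type_algebra \<and> Q \<noteq> UNIV \<and>
     (\<forall>a b. a * b \<in> Q \<longrightarrow> a \<in> Q \<or> b \<in> ideal_radical Q)"

definition minimal_primary_decomposition :: "'a::comm_ring_1 set \<Rightarrow> 'a set set \<Rightarrow> bool" where
  "minimal_primary_decomposition I \<Q> \<longleftrightarrow>
     finite \<Q> \<and> (\<forall>Q\<in>\<Q>. primary_ideal Q) \<and> \<Inter>\<Q> = I \<and>
     inj_on ideal_radical \<Q> \<and> (\<forall>Q\<in>\<Q>. \<not> \<Inter>(\<Q> - {Q}) \<subseteq> Q)"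

definition point_ideal :: "complex^'n \<Rightarrow> 'n::finite cpoly set" where
  "point_ideal \<xi> = {p. eval_poly p \<xi> = 0}"

text \<open>
  The component with radical \<open>point_ideal \<xi>\<close> does not depend on the decomposition if \<open>\<xi>\<close> is an
  isolated solution, since \<open>point_ideal \<xi>\<close> is then a minimal prime over the ideal.
\<close>

definition primary_component_at :: "complex^'n \<Rightarrow> 'n::finite cpoly set \<Rightarrow> 'n cpoly set \<Rightarrow> bool" where
  "primary_component_at \<xi> I Q \<longleftrightarrow>
     (\<exists>\<Q>. minimal_primary_decomposition I \<Q> \<and> Q \<in> \<Q> \<and> ideal_radical Q = point_ideal \<xi>)"


section \<open>Differential functionals\<close>

text \<open>
  An element \<open>\<Sum>\<^sub>\<beta> c\<^sub>\<beta> \<partial>\<^sub>\<xi>\<^sup>\<beta>\<close> of \<open>\<complex>[\<partial>\<^sub>\<xi>]\<close> is represented by its finitely supported coefficient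
  family \<open>c\<close>, so \<open>Poly_Mapping.single \<beta> 1\<close> stands for \<open>\<partial>\<^sub>\<xi>\<^sup>\<beta>\<close> and \<open>1\<close> for the evaluation at \<open>\<xi>\<close>.
\<close>

type_synonym 'n dfunc = "'n expo \<Rightarrow>\<^sub>0 complex"

definition apply_dfunc :: "complex^('n::{finite,linorder}) \<Rightarrow> 'n dfunc \<Rightarrow> 'n cpoly \<Rightarrow> complex" where
  "apply_dfunc \<xi> \<Lambda> p = (\<Sum>\<beta>\<in>Poly_Mapping.keys \<Lambda>.
     Poly_Mapping.lookup \<Lambda> \<beta> * eval_poly (partial_derivs \<beta> p) \<xi>)"

definition dfunc_ord :: "'n::finite dfunc \<Rightarrow> nat" where
  "dfunc_ord \<Lambda> = Max (expo_deg ` Poly_Mapping.keys \<Lambda>)"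

definition dual_space :: "complex^('n::{finite,linorder}) \<Rightarrow> 'n cpoly set \<Rightarrow> 'n dfunc set" where
  "dual_space \<xi> Q = {\<Lambda>. \<forall>p\<in>Q. apply_dfunc \<xi> \<Lambda> p = 0}"

text \<open>The zero functional has no order; it belongs to every \<open>dual_space_le \<xi> Q t\<close>.\<close>

definition dual_space_le ::
    "complex^('n::{finite,linorder}) \<Rightarrow> 'n cpoly set \<Rightarrow> nat \<Rightarrow> 'n dfunc set" where
  "dual_space_le \<xi> Q t = {\<Lambda> \<in> dual_space \<xi> Q. \<Lambda> = 0 \<or> dfunc_ord \<Lambda> \<le> t}"

definition max_ord :: "complex^('n::{finite,linorder}) \<Rightarrow> 'n cpoly set \<Rightarrow> nat" where
  "max_ord \<xi> Q = Max (dfunc_ord ` (dual_space \<xi> Q - {0}))"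


section \<open>Orthogonal primal-dual basis pairs\<close>

text \<open>The classes of \<open>b 0, \<dots>, b (\<delta> - 1)\<close> form a basis of the vector space \<open>\<complex>[x] / Q\<close>.\<close>

definition quotient_basis :: "'n cpoly set \<Rightarrow> nat \<Rightarrow> (nat \<Rightarrow> 'n cpoly) \<Rightarrow> bool" where
  "quotient_basis Q \<delta> b \<longleftrightarrow>
     (\<forall>c. (\<Sum>j<\<delta>. cscale (c j) (b j)) \<in> Q \<longrightarrow> (\<forall>j<\<delta>. c j = 0)) \<and>
     (\<forall>p. \<exists>c. p - (\<Sum>j<\<delta>. cscale (c j) (b j)) \<in> Q)"

definition connected_to_one :: "nat \<Rightarrow> (nat \<Rightarrow> 'n expo) \<Rightarrow> bool" where
  "connected_to_one \<delta> \<alpha> \<longleftrightarrow>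
     (\<forall>k<\<delta>. \<alpha> k \<noteq> 0 \<longrightarrow> (\<exists>j<\<delta>. \<exists>i. \<alpha> k = \<alpha> j + unit_expo i))"

definition orthogonal_pair ::
    "complex^('n::{finite,linorder}) \<Rightarrow> 'n cpoly set \<Rightarrow> nat \<Rightarrow> (nat \<Rightarrow> 'n expo) \<Rightarrow>
     (nat \<Rightarrow> 'n dfunc) \<Rightarrow> ('n expo \<Rightarrow> 'n expo \<Rightarrow> complex) \<Rightarrow> bool" where
  "orthogonal_pair \<xi> Q \<delta> \<alpha> \<Lambda> \<nu> \<longleftrightarrow>
     quotient_basis Q \<delta> (\<lambda>j. shifted_monom \<xi> (\<alpha> j)) \<and>
     0 < \<delta> \<and> \<alpha> 0 = 0 \<and> connected_to_one \<delta> \<alpha> \<and>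
     inj_on \<Lambda> {..<\<delta>} \<and> \<not> module.dependent cscale (\<Lambda> ` {..<\<delta>}) \<and>
     module.span cscale (\<Lambda> ` {..<\<delta>}) = dual_space \<xi> Q \<and>
     (\<forall>i<\<delta>. \<forall>j<\<delta>. apply_dfunc \<xi> (\<Lambda> i) (shifted_monom \<xi> (\<alpha> j)) = (if i = j then 1 else 0)) \<and>
     \<Lambda> 0 = 1 \<and>
     (\<forall>i<\<delta>. \<Lambda> i = Poly_Mapping.single (\<alpha> i) (1 / expo_fact (\<alpha> i)) +
        (\<Sum>\<beta> | expo_deg \<beta> \<le> expo_deg (\<alpha> i) \<and> \<beta> \<notin> \<alpha> ` {..<\<delta>}.
           Poly_Mapping.single \<beta> (\<nu> (\<alpha> i) \<beta> / expo_fact \<beta>))) \<and>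
     (\<forall>i<\<delta>. \<forall>\<beta>. \<beta> \<notin> \<alpha> ` {..<\<delta>} \<and> expo_deg (\<alpha> i) < expo_deg \<beta> \<longrightarrow> \<nu> (\<alpha> i) \<beta> = 0) \<and>
     dfunc_ord (\<Lambda> 0) = 0 \<and>
     (\<forall>i j. i \<le> j \<and> j < \<delta> \<longrightarrow> dfunc_ord (\<Lambda> i) \<le> dfunc_ord (\<Lambda> j)) \<and>
     (\<forall>t\<le>max_ord \<xi> Q. dual_space_le \<xi> Q t =
        module.span cscale (\<Lambda> ` {j. j < \<delta> \<and> dfunc_ord (\<Lambda> j) \<le> t}))"


section \<open>Parametric multiplication matrices and normal form\<close>

definition border :: "'n expo set \<Rightarrow> 'n expo set" where
  "border E = (\<Union>i. (\<lambda>\<beta>. \<beta> + unit_expo i) ` E) - E"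

text \<open>The variable \<open>\<mu>\<^sub>\<alpha>\<^sub>,\<^sub>\<beta>\<close> is the variable indexed by the pair \<open>(\<alpha>, \<beta>)\<close>.\<close>

type_synonym 'n mu_poly = "('n expo \<times> 'n expo) cpoly"

definition mu_entry :: "'n expo set \<Rightarrow> 'n expo \<Rightarrow> 'n expo \<Rightarrow> 'n mu_poly" where
  "mu_entry E a b = (if b \<in> E then (if a = b then 1 else 0) else var_poly (a, b))"

definition par_mult_mat :: "nat \<Rightarrow> (nat \<Rightarrow> 'n expo) \<Rightarrow> 'n \<Rightarrow> 'n mu_poly mat" where
  "par_mult_mat \<delta> \<alpha> i = transpose_mat (mat \<delta> \<delta> (\<lambda>(k, l).
     if k \<ge> l then 0 else mu_entry (\<alpha> ` {..<\<delta>}) (\<alpha> l) (\<alpha> k + unit_expo i)))"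

text \<open>
  Because of the triangular shape of the matrices, not every pair in \<open>E \<times> border E\<close> indexes a
  variable that occurs.
\<close>

definition mu_vars :: "nat \<Rightarrow> (nat \<Rightarrow> 'n expo) \<Rightarrow> ('n expo \<times> 'n expo) set" where
  "mu_vars \<delta> \<alpha> = {(\<alpha> l, \<alpha> k + unit_expo i) | k l i.
     k < l \<and> l < \<delta> \<and> \<alpha> k + unit_expo i \<notin> \<alpha> ` {..<\<delta>}}"

definition mu_ring :: "nat \<Rightarrow> (nat \<Rightarrow> 'n expo) \<Rightarrow> 'n mu_poly ring" where
  "mu_ring \<delta> \<alpha> = ring_of_type_algebra
     \<lparr>carrier := {p. \<forall>m\<in>Poly_Mapping.keys p. Poly_Mapping.keys m \<subseteq> mu_vars \<delta> \<alpha>}\<rparr>"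

definition par_mult_mat_power ::
    "nat \<Rightarrow> (nat \<Rightarrow> 'n::{finite,linorder} expo) \<Rightarrow> 'n expo \<Rightarrow> 'n mu_poly mat" where
  "par_mult_mat_power \<delta> \<alpha> \<gamma> =
     foldr (\<lambda>i A. (par_mult_mat \<delta> \<alpha> i ^\<^sub>m Poly_Mapping.lookup \<gamma> i) * A)
       (sorted_list_of_set UNIV) (1\<^sub>m \<delta>)"

text \<open>
  The sum over \<open>\<gamma>\<close> is \<^const>\<open>Sum_any\<close>, the sum over the (finite) support of its summand.
\<close>

definition par_normal_form ::
    "nat \<Rightarrow> (nat \<Rightarrow> 'n expo) \<Rightarrow> complex^('n::{finite,linorder}) \<Rightarrow> 'n cpoly \<Rightarrow>
     'n mu_poly Matrix.vec" where
  "par_normal_form \<delta> \<alpha> z p = Matrix.vec \<delta> (\<lambda>r. Sum_any (\<lambda>\<gamma>.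
     cscale (1 / expo_fact \<gamma> * eval_poly (partial_derivs \<gamma> p) z)
       (vec_index (par_mult_mat_power \<delta> \<alpha> \<gamma> *\<^sub>v unit_vec \<delta> 0) r)))"

definition system_ideal ::
    "nat \<Rightarrow> (nat \<Rightarrow> 'n expo) \<Rightarrow> complex^('n::{finite,linorder}) \<Rightarrow> nat \<Rightarrow> (nat \<Rightarrow> 'n cpoly) \<Rightarrow>
     'n mu_poly set" where
  "system_ideal \<delta> \<alpha> \<xi> N f = genideal (mu_ring \<delta> \<alpha>)
     ((\<Union>k<N. vec_set (par_normal_form \<delta> \<alpha> \<xi> (f k))) \<union>
      (\<Union>i. \<Union>j. elements_mat (par_mult_mat \<delta> \<alpha> i * par_mult_mat \<delta> \<alpha> j -
                             par_mult_mat \<delta> \<alpha> j * par_mult_mat \<delta> \<alpha> i)))"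

definition nu_ideal ::
    "nat \<Rightarrow> (nat \<Rightarrow> 'n expo) \<Rightarrow> ('n expo \<Rightarrow> 'n expo \<Rightarrow> complex) \<Rightarrow> 'n mu_poly set" where
  "nu_ideal \<delta> \<alpha> \<nu> = genideal (mu_ring \<delta> \<alpha>)
     {var_poly (a, b) - const_poly (\<nu> a b) | a b.
        (a, b) \<in> (\<alpha> ` {..<\<delta>}) \<times> border (\<alpha> ` {..<\<delta>}) \<and> (a, b) \<in> mu_vars \<delta> \<alpha>}"

end

theory Submission
  imports Defs "Jordan_Normal_Form.Char_Poly"
begin

text \<open>
  Let \<open>A\<close> be the parameter ring modulo the ideal \<open>L\<close> of the system. Over \<open>A\<close> the matrices \<open>M\<^sub>i\<close>
  commute, so \<open>x\<^sub>i \<mapsto> \<xi>\<^sub>i + M\<^sub>i\<close> lets polynomials act on vectors, and the normal form of \<open>p\<close> is the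
  result of \<open>p\<close> acting on the first basis vector. The system says that every \<open>f\<^sub>k\<close>, and hence every
  element of the ideal \<open>I\<close> that they generate, has normal form zero. Each \<open>q \<in> Q\<close> satisfies
  \<open>g q \<in> I\<close> for some \<open>g\<close> with \<open>g(\<xi>) \<noteq> 0\<close>; since \<open>g\<close> acts as the constant \<open>g(\<xi>)\<close> plus a strictly
  triangular matrix, it can be cancelled (\<open>nf_cancel\<close>), so \<open>q\<close> has normal form zero as well.
  Normal forms can therefore be computed modulo \<open>Q\<close>, where the coordinates of \<open>(x - \<xi>)\<^sup>\<beta>\<close> are the
  numbers \<open>\<Lambda>\<^sub>l((x - \<xi>)\<^sup>\<beta>)\<close>. Comparison with the entries of \<open>M\<^sub>i\<close> forces every parameter to equal
  the corresponding coefficient of the dual basis (\<open>variable_determined\<close>). Conversely, at these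
  values the \<open>M\<^sub>i\<close> are the matrices of multiplication by \<open>x\<^sub>i - \<xi>\<^sub>i\<close> in \<open>\<complex>[x]/Q\<close>, so all equations
  hold there (\<open>ev_nu_M\<close>, \<open>ev_nu_nf\<close>). Thus \<open>L\<close> is the kernel of an evaluation, which is maximal
  (\<open>nu_ideal_eq_kernel\<close>).

  The multiplier \<open>g\<close> exists because no other primary component lies in the ideal of \<open>\<xi>\<close>
  (\<open>primary_component_local\<close>). This is where isolatedness, a condition in the Euclidean topology,
  has to be turned into algebra: a prime ideal \<open>P\<close> strictly below the ideal of \<open>\<xi>\<close> has zeros other
  than \<open>\<xi>\<close> arbitrarily close to \<open>\<xi>\<close> (\<open>zeros_near_point_of_prime_ideal\<close>). The proof is the one that
  shows that nonempty Zariski open subsets of an irreducible variety are dense for the Euclidean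
  topology. By Noether normalization \<open>\<complex>[x]/P\<close> is finite over a polynomial ring in parameters \<open>y\<close>
  that vanish at \<open>\<xi>\<close>. Take a polynomial \<open>z\<close> that vanishes at \<open>\<xi>\<close> but not at the other points over
  \<open>y = 0\<close>. Polynomial rings are normal (\<open>polynomial_ring_normal\<close>), so the minimal polynomial \<open>F\<close>
  of \<open>z\<close> is monic. Its constant coefficient vanishes at \<open>y = 0\<close>, so for small \<open>y \<noteq> 0\<close> it has a small
  root \<open>t\<close>, and lying over (\<open>lift_point\<close>) gives a zero of \<open>P\<close> with parameters \<open>y\<close> and \<open>z = t\<close>. These
  zeros stay bounded as \<open>y\<close> tends to \<open>0\<close>, and they can accumulate only at \<open>\<xi>\<close>.
\<close>

(* Unqualified names denote univariate polynomials, determinants of matrices of variable size,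
   and the evaluation of multivariate polynomials. *)
hide_const (open) Ring_Hom_Poly.eval_poly Polynomials.degree Polynomials.lead_coeff
  up_ring.coeff up_ring.monom module.smult Determinants.det
hide_fact (open) Ring_Hom_Poly.eval_poly_def

section \<open>Evaluation homomorphisms\<close>

type_synonym 'v cvec = "(complex, 'v) Finite_Cartesian_Product.vec"

lemmas vector_eq_iff = Finite_Cartesian_Product.vec_eq_iff

lemma unit_expo_lookup: "Poly_Mapping.lookup (unit_expo i) j = (if i = j then 1 else 0)"
  by (simp add: unit_expo_def lookup_single)

lemma expo_split:
  fixes \<gamma> :: "'v expo"
  assumes "i \<in> Poly_Mapping.keys \<gamma>"
  shows "\<gamma> = (\<gamma> - unit_expo i) + unit_expo i"
  using assms
  by (intro poly_mapping_eqI) (auto simp: lookup_add lookup_minus unit_expo_lookup in_keys_iff)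

text \<open>
  The induction runs on the total degree, summed over the support: for the parameters \<open>\<mu>\<close> the set
  of variables is infinite.
\<close>

lemma expo_induct [case_names zero step]:
  fixes \<gamma> :: "'v expo"
  assumes z: "P 0" and s: "\<And>\<gamma> i. P \<gamma> \<Longrightarrow> P (\<gamma> + unit_expo i)"
  shows "P \<gamma>"
proof (induction "\<Sum>i\<in>Poly_Mapping.keys \<gamma>. Poly_Mapping.lookup \<gamma> i" arbitrary: \<gamma> rule: less_induct)
  case less
  show ?case
  proof (cases "\<gamma> = 0")
    case False
    then obtain i where i: "i \<in> Poly_Mapping.keys \<gamma>" by fastforce
    let ?\<gamma> = "\<gamma> - unit_expo i"
    have sub: "Poly_Mapping.keys ?\<gamma> \<subseteq> Poly_Mapping.keys \<gamma>"
      by (auto simp: in_keys_iff lookup_minus)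
    have "(\<Sum>j\<in>Poly_Mapping.keys ?\<gamma>. Poly_Mapping.lookup ?\<gamma> j)
        = (\<Sum>j\<in>Poly_Mapping.keys \<gamma>. Poly_Mapping.lookup ?\<gamma> j)"
      by (intro sum.mono_neutral_left sub) (auto simp: in_keys_iff)
    also have "\<dots> < (\<Sum>j\<in>Poly_Mapping.keys \<gamma>. Poly_Mapping.lookup \<gamma> j)"
      using i by (intro sum_strict_mono2[of _ _ i] sum_strict_mono_ex1)
        (auto simp: lookup_minus unit_expo_lookup in_keys_iff intro!: bexI[of _ i])
    finally have "P ?\<gamma>" by (rule less)
    then show ?thesis using s[of ?\<gamma> i] expo_split[OF i] by simp
  qed (simp add: z)
qed

lemma expo_deg_add_unit: "expo_deg (\<gamma> + unit_expo i) = Suc (expo_deg \<gamma>)"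
  by (simp add: expo_deg_def lookup_add unit_expo_lookup sum.distrib)

lemma cpoly_as_sum:
  fixes p :: "'v cpoly"
  shows "p = (\<Sum>\<gamma>\<in>Poly_Mapping.keys p. Poly_Mapping.single \<gamma> (Poly_Mapping.lookup p \<gamma>))"
  by (intro poly_mapping_eqI) (auto simp: lookup_sum lookup_single when_def in_keys_iff)

lemma cpoly_induct_single [case_names single add]:
  fixes p :: "'v cpoly"
  assumes "\<And>\<gamma> c. P (Poly_Mapping.single \<gamma> c)" and "\<And>p q. P p \<Longrightarrow> P q \<Longrightarrow> P (p + q)"
  shows "P p"
proof -
  have "finite F \<Longrightarrow> P (\<Sum>\<gamma>\<in>F. Poly_Mapping.single \<gamma> (Poly_Mapping.lookup p \<gamma>))" for F
  proof (induction F rule: finite_induct)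
    case empty
    show ?case using assms(1)[of 0 0] by simp
  next
    case (insert x F)
    then show ?case using assms by simp
  qed
  then show ?thesis using cpoly_as_sum[of p] finite_keys by metis
qed

lemma single_add_unit:
  "Poly_Mapping.single (\<gamma> + unit_expo i) c = var_poly i * Poly_Mapping.single \<gamma> (c::complex)"
  by (simp add: var_poly_def mult_single add.commute)

lemma cpoly_induct [case_names const add var]:
  fixes p :: "'v cpoly"
  assumes "\<And>c. P (const_poly c)" and "\<And>p q. P p \<Longrightarrow> P q \<Longrightarrow> P (p + q)"
    and "\<And>i p. P p \<Longrightarrow> P (var_poly i * p)"
  shows "P p"
proof (induction p rule: cpoly_induct_single)
  case (single \<gamma> c)
  show ?case
    by (induction \<gamma> rule: expo_induct)
      (use assms in \<open>auto simp: single_add_unit const_poly_def\<close>)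
qed (use assms in auto)

definition mono_ev :: "('v \<Rightarrow> 'r::comm_ring_1) \<Rightarrow> 'v expo \<Rightarrow> 'r" where
  "mono_ev h \<gamma> = (\<Prod>i\<in>Poly_Mapping.keys \<gamma>. h i ^ Poly_Mapping.lookup \<gamma> i)"

text \<open>
  Evaluation at a point, substitution, restriction to a line and specialization of the parameters
  are all of this form; \<open>\<phi>\<close> embeds the coefficients into the target ring.
\<close>

definition poly_ev :: "(complex \<Rightarrow> 'r) \<Rightarrow> ('v \<Rightarrow> 'r) \<Rightarrow> 'v cpoly \<Rightarrow> 'r::comm_ring_1" where
  "poly_ev \<phi> h p = (\<Sum>\<gamma>\<in>Poly_Mapping.keys p. \<phi> (Poly_Mapping.lookup p \<gamma>) * mono_ev h \<gamma>)"

lemma mono_ev_0 [simp]: "mono_ev h 0 = 1"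
  by (simp add: mono_ev_def)

lemma mono_ev_unit [simp]: "mono_ev h (unit_expo i) = h i"
  by (simp add: mono_ev_def unit_expo_def)

lemma mono_ev_superset:
  assumes "finite A" "Poly_Mapping.keys \<gamma> \<subseteq> A"
  shows "mono_ev h \<gamma> = (\<Prod>i\<in>A. h i ^ Poly_Mapping.lookup \<gamma> i)"
  unfolding mono_ev_def using assms
  by (intro prod.mono_neutral_left) (auto simp: in_keys_iff)

lemma mono_ev_add: "mono_ev h (\<beta> + \<gamma>) = mono_ev h \<beta> * mono_ev h \<gamma>"
proof -
  let ?A = "Poly_Mapping.keys \<beta> \<union> Poly_Mapping.keys \<gamma>"
  have "Poly_Mapping.keys (\<beta> + \<gamma>) \<subseteq> ?A" by (rule keys_add)
  then show ?thesis
    by (simp add: mono_ev_superset[of ?A] lookup_add power_add prod.distrib)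
qed

lemma const_poly_hom: "comm_ring_hom (const_poly :: complex \<Rightarrow> 'v cpoly)"
  by unfold_locales (simp_all add: const_poly_def single_add mult_single)

interpretation cp: comm_ring_hom const_poly
  by (rule const_poly_hom)

lemma poly_ev_single:
  assumes "comm_ring_hom \<phi>"
  shows "poly_ev \<phi> h (Poly_Mapping.single \<gamma> c) = \<phi> c * mono_ev h \<gamma>"
proof -
  interpret comm_ring_hom \<phi> by fact
  show ?thesis by (cases "c = 0") (simp_all add: poly_ev_def)
qed

lemma poly_ev_add:
  assumes "comm_ring_hom \<phi>"
  shows "poly_ev \<phi> h (p + q) = poly_ev \<phi> h p + poly_ev \<phi> h q"
proof -
  interpret comm_ring_hom \<phi> by fact
  show ?thesis unfolding poly_ev_def
    by (rule setsum_keys_plus_distrib[of "\<lambda>\<gamma> c. \<phi> c * mono_ev h \<gamma>"])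
      (simp_all add: hom_add algebra_simps)
qed

lemma poly_ev_hom:
  assumes "comm_ring_hom \<phi>"
  shows "comm_ring_hom (poly_ev \<phi> h)"
proof -
  interpret comm_ring_hom \<phi> by fact
  have mult1: "poly_ev \<phi> h (Poly_Mapping.single \<beta> c * q) = \<phi> c * mono_ev h \<beta> * poly_ev \<phi> h q" for \<beta> c q
  proof (induction q rule: cpoly_induct_single)
    case (single \<gamma> d)
    then show ?case by (simp add: mult_single poly_ev_single[OF assms] mono_ev_add hom_mult)
  next
    case (add p q)
    then show ?case by (simp add: distrib_left poly_ev_add[OF assms])
  qed
  have mult: "poly_ev \<phi> h (p * q) = poly_ev \<phi> h p * poly_ev \<phi> h q" for p q
    by (induction p rule: cpoly_induct_single)
      (simp_all add: mult1 poly_ev_single[OF assms] poly_ev_add[OF assms] distrib_right)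
  show ?thesis
    by unfold_locales
      (simp_all add: mult poly_ev_add[OF assms],
       simp_all add: poly_ev_def)
qed

lemma poly_ev_const [simp]:
  assumes "comm_ring_hom \<phi>" shows "poly_ev \<phi> h (const_poly c) = \<phi> c"
  by (simp add: const_poly_def poly_ev_single[OF assms])

lemma poly_ev_var [simp]:
  assumes "comm_ring_hom \<phi>" shows "poly_ev \<phi> h (var_poly i) = h i"
proof -
  interpret comm_ring_hom \<phi> by fact
  show ?thesis by (simp add: var_poly_def poly_ev_single[OF assms])
qed

text \<open>
  Identities between compositions of evaluations are thus checked on constants and variables.
\<close>

lemma cpoly_hom_unique:
  assumes "comm_ring_hom f" "comm_ring_hom g"
    and "\<And>c. f (const_poly c) = g (const_poly c)" "\<And>i. f (var_poly i) = g (var_poly i)"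
  shows "f p = g (p :: 'v cpoly)"
proof -
  interpret f: comm_ring_hom f by fact
  interpret g: comm_ring_hom g by fact
  show ?thesis
    by (induction p rule: cpoly_induct) (simp_all add: assms f.hom_add g.hom_add f.hom_mult g.hom_mult)
qed

lemma comm_ring_hom_comp:
  assumes "comm_ring_hom f" "comm_ring_hom g"
  shows "comm_ring_hom (\<lambda>x. f (g x))"
proof -
  interpret f: comm_ring_hom f by fact
  interpret g: comm_ring_hom g by fact
  show ?thesis by unfold_locales (simp_all add: f.hom_add g.hom_add f.hom_mult g.hom_mult)
qed

lemma id_hom: "comm_ring_hom (\<lambda>x. x)"
  by unfold_locales simp_all

subsection \<open>Evaluation at a point\<close>

lemma eval_poly_eq_poly_ev: "eval_poly p z = poly_ev (\<lambda>c. c) (vec_nth z) p"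
  by (simp add: eval_poly_def poly_ev_def mono_ev_superset[of UNIV])

lemma eval_poly_hom: "comm_ring_hom (\<lambda>p. eval_poly p z)"
  unfolding eval_poly_eq_poly_ev by (rule poly_ev_hom) (rule id_hom)

interpretation evp: comm_ring_hom "\<lambda>p. eval_poly p z"
  by (rule eval_poly_hom)

lemma eval_poly_const [simp]: "eval_poly (const_poly c) z = c"
  by (simp add: eval_poly_eq_poly_ev id_hom)

lemma eval_poly_var [simp]: "eval_poly (var_poly i) z = vec_nth z i"
  by (simp add: eval_poly_eq_poly_ev id_hom)

lemma continuous_eval_poly: "continuous_on UNIV (\<lambda>z. eval_poly p z)"
  unfolding eval_poly_def by (intro continuous_intros)

subsection \<open>Substitution\<close>

abbreviation subst :: "('v \<Rightarrow> 'w cpoly) \<Rightarrow> 'v cpoly \<Rightarrow> 'w cpoly" where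
  "subst \<equiv> poly_ev const_poly"

lemma subst_hom: "comm_ring_hom (subst h)"
  by (rule poly_ev_hom) (rule const_poly_hom)

interpretation sub: comm_ring_hom "subst h" for h
  by (rule subst_hom)

lemma subst_const [simp]: "subst h (const_poly c) = const_poly c"
  by (simp add: const_poly_hom)

lemma subst_var [simp]: "subst h (var_poly i) = h i"
  by (simp add: const_poly_hom)

lemma subst_id: "subst var_poly p = p"
  by (rule cpoly_hom_unique[OF subst_hom id_hom]) simp_all

lemma subst_subst: "subst g (subst h p) = subst (\<lambda>i. subst g (h i)) p"
  by (rule cpoly_hom_unique[OF comm_ring_hom_comp[OF subst_hom subst_hom] subst_hom]) simp_all

lemma eval_subst: "eval_poly (subst h p) z = eval_poly p (\<chi> i. eval_poly (h i) z)"
  by (rule cpoly_hom_unique[OF comm_ring_hom_comp[OF eval_poly_hom subst_hom] eval_poly_hom]) simp_all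

section \<open>Polynomials are determined by their values\<close>

definition vars_in :: "'v set \<Rightarrow> 'v cpoly \<Rightarrow> bool" where
  "vars_in Y p \<longleftrightarrow> (\<forall>\<gamma>\<in>Poly_Mapping.keys p. Poly_Mapping.keys \<gamma> \<subseteq> Y)"

lemma vars_in_add: "vars_in V p \<Longrightarrow> vars_in V q \<Longrightarrow> vars_in V (p + q)"
  using keys_add[of p q] by (fastforce simp: vars_in_def)

lemma vars_in_mult:
  assumes "vars_in V p" "vars_in V q"
  shows "vars_in V (p * q)"
  unfolding vars_in_def
proof
  fix \<gamma> assume "\<gamma> \<in> Poly_Mapping.keys (p * q)"
  then obtain a b where "\<gamma> = a + b" "a \<in> Poly_Mapping.keys p" "b \<in> Poly_Mapping.keys q"
    using keys_mult[of p q] by blast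
  then show "Poly_Mapping.keys \<gamma> \<subseteq> V"
    using assms keys_add[of a b] by (fastforce simp: vars_in_def)
qed

lemma vars_in_const: "vars_in V (const_poly c)"
  by (auto simp: vars_in_def const_poly_def)

lemma vars_in_zero: "vars_in V 0"
  by (simp add: vars_in_def)

lemma vars_in_one: "vars_in V 1"
  by (simp add: vars_in_def)

lemma vars_in_var: "v \<in> V \<Longrightarrow> vars_in V (var_poly v)"
  by (simp add: vars_in_def var_poly_def unit_expo_def)

lemma vars_in_uminus: "vars_in V p \<Longrightarrow> vars_in V (- p)"
  by (simp add: vars_in_def in_keys_iff)

lemma vars_in_minus: "vars_in V p \<Longrightarrow> vars_in V q \<Longrightarrow> vars_in V (p - q)"
  using vars_in_add[of V p "- q"] vars_in_uminus[of V q] by simp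

lemma vars_in_sum: "(\<And>i. i \<in> A \<Longrightarrow> vars_in V (F i)) \<Longrightarrow> vars_in V (sum F A)"
  by (induction A rule: infinite_finite_induct) (auto simp: vars_in_zero intro: vars_in_add)

text \<open>
  The coefficient of \<open>x\<^sub>i\<^sup>k\<close> in \<open>p\<close>, viewed as a polynomial in \<open>x\<^sub>i\<close> over the other variables.
\<close>

definition coeff_at :: "'v \<Rightarrow> nat \<Rightarrow> 'v cpoly \<Rightarrow> 'v cpoly" where
  "coeff_at i k p = (\<Sum>\<gamma>\<in>{\<gamma>\<in>Poly_Mapping.keys p. Poly_Mapping.lookup \<gamma> i = k}.
     Poly_Mapping.single (\<gamma> - Poly_Mapping.single i k) (Poly_Mapping.lookup p \<gamma>))"

lemma expo_remove_var:
  fixes \<gamma> :: "'v expo"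
  shows "\<gamma> = (\<gamma> - Poly_Mapping.single i (Poly_Mapping.lookup \<gamma> i)) + Poly_Mapping.single i (Poly_Mapping.lookup \<gamma> i)"
  by (intro poly_mapping_eqI) (auto simp: lookup_add lookup_minus lookup_single when_def)

lemma coeff_at_nonzero:
  assumes "\<gamma> \<in> Poly_Mapping.keys p"
  shows "coeff_at i (Poly_Mapping.lookup \<gamma> i) p \<noteq> 0"
proof -
  let ?k = "Poly_Mapping.lookup \<gamma> i" and ?s = "Poly_Mapping.single i (Poly_Mapping.lookup \<gamma> i)"
  have inj: "\<beta> - ?s = \<gamma> - ?s \<longleftrightarrow> \<beta> = \<gamma>" if "Poly_Mapping.lookup \<beta> i = ?k" for \<beta>
    using expo_remove_var[of \<beta> i] expo_remove_var[of \<gamma> i] that by metis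
  have "Poly_Mapping.lookup (coeff_at i ?k p) (\<gamma> - ?s) =
      (\<Sum>\<beta>\<in>{\<beta>\<in>Poly_Mapping.keys p. Poly_Mapping.lookup \<beta> i = ?k}.
        if \<beta> = \<gamma> then Poly_Mapping.lookup p \<beta> else 0)"
    unfolding coeff_at_def lookup_sum
    by (intro sum.cong) (auto simp: lookup_single when_def inj)
  also have "\<dots> = Poly_Mapping.lookup p \<gamma>"
    using assms by simp
  finally show ?thesis using assms by (auto simp: in_keys_iff)
qed

lemma vars_in_coeff_at:
  assumes "vars_in (insert i Y) p"
  shows "vars_in Y (coeff_at i k p)"
  unfolding vars_in_def
proof safe
  fix \<gamma> j
  assume \<gamma>: "\<gamma> \<in> Poly_Mapping.keys (coeff_at i k p)" and j: "j \<in> Poly_Mapping.keys \<gamma>"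
  from \<gamma> obtain \<beta> where "\<beta> \<in> Poly_Mapping.keys p" "Poly_Mapping.lookup \<beta> i = k"
      "\<gamma> = \<beta> - Poly_Mapping.single i k"
    unfolding coeff_at_def using keys_sum by (fastforce split: if_splits)
  moreover from this j have "j \<noteq> i" "j \<in> Poly_Mapping.keys \<beta>"
    by (auto simp: in_keys_iff lookup_minus lookup_single when_def split: if_splits)
  ultimately show "j \<in> Y" using assms by (auto simp: vars_in_def)
qed

text \<open>
  Induction on the variables: some coefficient of \<open>p\<close> with respect to the last variable is nonzero
  and so does not vanish at a point \<open>z\<close>. Over \<open>z\<close>, \<open>p\<close> is a nonzero polynomial in the last variable,
  which has only finitely many roots.
\<close>

lemma nonvanishing_point:
  fixes p :: "'n::finite cpoly"
  assumes "vars_in Y p" "p \<noteq> 0"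
  shows "\<exists>z. (\<forall>i. i \<notin> Y \<longrightarrow> vec_nth z i = 0) \<and> eval_poly p z \<noteq> 0"
  using finite[of Y] assms
proof (induction Y arbitrary: p rule: finite_induct)
  case empty
  then have "Poly_Mapping.keys p \<subseteq> {0}" by (auto simp: vars_in_def)
  moreover from empty have "Poly_Mapping.keys p \<noteq> {}" by simp
  ultimately have "Poly_Mapping.keys p = {0}" by blast
  then have "eval_poly p 0 \<noteq> 0"
    by (simp add: eval_poly_def) (metis insertI1 in_keys_iff)
  then show ?case by (intro exI[of _ 0]) simp
next
  case (insert i Y)
  from insert.prems obtain \<gamma>0 where \<gamma>0: "\<gamma>0 \<in> Poly_Mapping.keys p" by fastforce
  define k where "k = Poly_Mapping.lookup \<gamma>0 i"
  from insert.IH[OF vars_in_coeff_at[OF insert.prems(1)] coeff_at_nonzero[OF \<gamma>0]]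
  obtain z where z: "\<And>j. j \<notin> Y \<Longrightarrow> vec_nth z j = 0" "eval_poly (coeff_at i k p) z \<noteq> 0"
    by (auto simp: k_def)
  define w where "w t = (\<chi> j. if j = i then t else vec_nth z j)" for t
  define rest where "rest \<gamma> = \<gamma> - Poly_Mapping.single i (Poly_Mapping.lookup \<gamma> i)" for \<gamma> :: "'n expo"
  define q where "q = (\<Sum>\<gamma>\<in>Poly_Mapping.keys p.
    monom (Poly_Mapping.lookup p \<gamma> * mono_ev (vec_nth z) (rest \<gamma>)) (Poly_Mapping.lookup \<gamma> i))"
  have rest: "mono_ev (vec_nth (w t)) (rest \<gamma>) = mono_ev (vec_nth z) (rest \<gamma>)" for t \<gamma>
    unfolding mono_ev_def
    by (intro prod.cong) (auto simp: rest_def w_def in_keys_iff lookup_minus)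
  have "eval_poly p (w t) = poly q t" for t
  proof -
    have "mono_ev (vec_nth (w t)) \<gamma> = mono_ev (vec_nth z) (rest \<gamma>) * t ^ Poly_Mapping.lookup \<gamma> i" for \<gamma>
    proof -
      have "mono_ev (vec_nth (w t)) (Poly_Mapping.single i m) = t ^ m" for m
        by (cases "m = 0") (simp_all add: mono_ev_def w_def)
      then show ?thesis
        using mono_ev_add[of "vec_nth (w t)" "rest \<gamma>" "Poly_Mapping.single i (Poly_Mapping.lookup \<gamma> i)"]
          expo_remove_var[of \<gamma> i] rest[of t \<gamma>]
        by (simp add: rest_def)
    qed
    then show ?thesis
      by (simp add: eval_poly_eq_poly_ev poly_ev_def q_def poly_sum poly_monom mult.assoc)
  qed
  moreover have "q \<noteq> 0"
  proof -
    have "coeff q k = (\<Sum>\<gamma>\<in>Poly_Mapping.keys p. if Poly_Mapping.lookup \<gamma> i = k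
        then Poly_Mapping.lookup p \<gamma> * mono_ev (vec_nth z) (rest \<gamma>) else 0)"
      unfolding q_def coeff_sum by (intro sum.cong) auto
    also have "\<dots> = (\<Sum>\<gamma>\<in>{\<gamma>\<in>Poly_Mapping.keys p. Poly_Mapping.lookup \<gamma> i = k}.
        Poly_Mapping.lookup p \<gamma> * mono_ev (vec_nth z) (rest \<gamma>))"
      by (intro sum.mono_neutral_cong_right) auto
    also have "\<dots> = eval_poly (coeff_at i k p) z"
      unfolding coeff_at_def evp.hom_sum
      by (intro sum.cong) (auto simp: eval_poly_eq_poly_ev poly_ev_single id_hom rest_def)
    finally show ?thesis using z(2) by auto
  qed
  then obtain t where "poly q t \<noteq> 0" using poly_all_0_iff_0 by blast
  ultimately have "eval_poly p (w t) \<noteq> 0" by simp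
  then show ?case using z(1) by (intro exI[of _ "w t"]) (auto simp: w_def)
qed

lemma eval_poly_ext:
  fixes p q :: "'n::finite cpoly"
  assumes "\<And>z. eval_poly p z = eval_poly q z"
  shows "p = q"
proof (rule ccontr)
  assume "p \<noteq> q"
  then have "p - q \<noteq> 0" by simp
  moreover have "vars_in UNIV (p - q)" by (simp add: vars_in_def)
  ultimately obtain z where "eval_poly (p - q) z \<noteq> 0" using nonvanishing_point by blast
  then show False by (simp add: evp.hom_minus assms)
qed

section \<open>Restriction to lines\<close>

text \<open>
  The univariate polynomial \<open>p(b + T v)\<close> in \<open>T\<close>.
\<close>

definition line :: "complex^'n \<Rightarrow> complex^'n \<Rightarrow> 'n::finite cpoly \<Rightarrow> complex poly" where
  "line b v = poly_ev (\<lambda>c. [:c:]) (\<lambda>i. [:vec_nth b i, vec_nth v i:])"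

lemma pconst_hom: "comm_ring_hom (\<lambda>c::complex. [:c:])"
  by unfold_locales (simp_all add: one_pCons)

lemma line_hom: "comm_ring_hom (line b v)"
  unfolding line_def by (rule poly_ev_hom) (rule pconst_hom)

interpretation line: comm_ring_hom "line b v" for b v
  by (rule line_hom)

lemma line_const [simp]: "line b v (const_poly c) = [:c:]"
  by (simp add: line_def pconst_hom)

lemma line_var [simp]: "line b v (var_poly i) = [:vec_nth b i, vec_nth v i:]"
  by (simp add: line_def pconst_hom)

lemma poly_hom: "comm_ring_hom (\<lambda>p::'a::comm_ring_1 poly. poly p t)"
  by unfold_locales simp_all

lemma poly_line: "poly (line b v p) t = eval_poly p (\<chi> i. vec_nth b i + t * vec_nth v i)"
  by (rule cpoly_hom_unique[OF comm_ring_hom_comp[OF poly_hom line_hom] eval_poly_hom]) simp_all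

lemma line_translate:
  "line 0 v (subst (\<lambda>i. var_poly i + const_poly (vec_nth b i)) p) = line b v p"
  by (rule cpoly_hom_unique[OF comm_ring_hom_comp[OF line_hom subst_hom] line_hom])
    (simp_all add: line.hom_add)

lemma degree_line_le:
  fixes p :: "'n::finite cpoly"
  assumes "\<And>\<gamma>. \<gamma> \<in> Poly_Mapping.keys p \<Longrightarrow> expo_deg \<gamma> \<le> D"
  shows "degree (line b v p) \<le> D"
  unfolding line_def poly_ev_def
proof (intro degree_sum_le finite_keys)
  fix \<gamma> assume "\<gamma> \<in> Poly_Mapping.keys p"
  have "degree (mono_ev (\<lambda>i. [:vec_nth b i, vec_nth v i:]) \<gamma>) \<le>
      (\<Sum>i\<in>UNIV. degree ([:vec_nth b i, vec_nth v i:] ^ Poly_Mapping.lookup \<gamma> i))"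
    by (simp add: mono_ev_superset[of UNIV] degree_prod_sum_le[unfolded comp_def])
  also have "\<dots> \<le> (\<Sum>i\<in>UNIV. Poly_Mapping.lookup \<gamma> i)"
  proof (intro sum_mono)
    fix i
    have "degree ([:vec_nth b i, vec_nth v i:] ^ Poly_Mapping.lookup \<gamma> i)
        \<le> degree [:vec_nth b i, vec_nth v i:] * Poly_Mapping.lookup \<gamma> i"
      by (rule degree_power_le)
    also have "\<dots> \<le> 1 * Poly_Mapping.lookup \<gamma> i" by (intro mult_right_mono) auto
    finally show "degree ([:vec_nth b i, vec_nth v i:] ^ Poly_Mapping.lookup \<gamma> i) \<le> Poly_Mapping.lookup \<gamma> i"
      by simp
  qed
  also have "\<dots> \<le> D" using assms[OF \<open>\<gamma> \<in> _\<close>] by (simp add: expo_deg_def)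
  finally show "degree ([:Poly_Mapping.lookup p \<gamma>:] * mono_ev (\<lambda>i. [:vec_nth b i, vec_nth v i:]) \<gamma>) \<le> D"
    using degree_smult_le[of "Poly_Mapping.lookup p \<gamma>"] by (auto intro: order_trans)
qed

lemma power_dvd_line:
  fixes p :: "'n::finite cpoly"
  assumes "\<And>\<gamma>. \<gamma> \<in> Poly_Mapping.keys p \<Longrightarrow> D \<le> expo_deg \<gamma>"
  shows "[:0, 1:] ^ D dvd line 0 v p"
  unfolding line_def poly_ev_def
proof (intro dvd_sum)
  fix \<gamma> assume "\<gamma> \<in> Poly_Mapping.keys p"
  have "mono_ev (\<lambda>i. [:vec_nth 0 i, vec_nth v i:]) \<gamma> =
      (\<Prod>i\<in>UNIV. [:vec_nth v i:] ^ Poly_Mapping.lookup \<gamma> i * [:0, 1:] ^ Poly_Mapping.lookup \<gamma> i)"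
    by (simp add: mono_ev_superset[of UNIV] flip: power_mult_distrib)
  also have "\<dots> = (\<Prod>i\<in>UNIV. [:vec_nth v i:] ^ Poly_Mapping.lookup \<gamma> i) * [:0, 1:] ^ expo_deg \<gamma>"
    by (subst prod.distrib) (simp add: expo_deg_def power_sum)
  finally have "[:0, 1:] ^ expo_deg \<gamma> dvd mono_ev (\<lambda>i. [:vec_nth 0 i, vec_nth v i:]) \<gamma>"
    by (simp only: dvd_triv_right)
  then show "[:0, 1:] ^ D dvd [:Poly_Mapping.lookup p \<gamma>:] * mono_ev (\<lambda>i. [:vec_nth 0 i, vec_nth v i:]) \<gamma>"
    using le_imp_power_dvd[OF assms[OF \<open>\<gamma> \<in> _\<close>], of "[:0, 1::complex:]"]
    by (meson dvd_mult dvd_trans)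
qed

lemma power_dvd_cancel_left:
  fixes a b :: "complex poly"
  assumes "[:0, 1:] ^ n dvd a * b" "poly a 0 \<noteq> 0"
  shows "[:0, 1:] ^ n dvd b"
proof (cases "b = 0")
  case False
  from assms(2) have "a \<noteq> 0" by auto
  then have "Polynomial.order 0 (a * b) = Polynomial.order 0 a + Polynomial.order 0 b" using False by (intro order_mult) simp
  moreover have "Polynomial.order 0 a = 0" using assms(2) order_root by blast
  moreover have "n \<le> Polynomial.order 0 (a * b)"
    using assms(1) order_divides[of 0 n "a * b"] \<open>a \<noteq> 0\<close> False by simp
  ultimately show ?thesis using order_divides[of 0 n b] by simp
qed simp

lemma vec_lambda_0: "(\<chi> i. 0) = (0 :: 'a::zero ^ 'n)"
  by (simp add: vector_eq_iff)

text \<open>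
  With \<open>e = 1 - q/q(0)\<close>, the geometric series expands \<open>p/q\<close> into a power series at \<open>0\<close>. On each line
  the quotient is a polynomial of degree at most \<open>D = deg p\<close>, so it is the truncation of that
  series at degree \<open>D\<close>. Hence the truncation, a polynomial in all variables, is the quotient.
\<close>

lemma dvd_if_dvd_on_lines_0:
  fixes p q :: "'n::finite cpoly"
  assumes q0: "eval_poly q 0 \<noteq> 0" and lines: "\<And>v. line 0 v q dvd line 0 v p"
  shows "q dvd p"
proof -
  define D where "D = Max (insert 0 (expo_deg ` Poly_Mapping.keys p))"
  have D: "expo_deg \<gamma> \<le> D" if "\<gamma> \<in> Poly_Mapping.keys p" for \<gamma>
    unfolding D_def using that by (intro Max_ge) auto
  define c where "c = eval_poly q 0"
  define e where "e = 1 - const_poly (1 / c) * q"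
  \<comment> \<open>\<open>q * s\<close> differs from \<open>p\<close> only by the multiple \<open>p * e ^ Suc D\<close> of \<open>e ^ Suc D\<close>.\<close>
  define s where "s = const_poly (1 / c) * p * (\<Sum>k<Suc D. e ^ k)"
  define s1 where "s1 = (\<Sum>\<gamma>\<in>{\<gamma>\<in>Poly_Mapping.keys s. expo_deg \<gamma> \<le> D}.
    Poly_Mapping.single \<gamma> (Poly_Mapping.lookup s \<gamma>))"
  have e0: "eval_poly e 0 = 0"
    using q0 by (simp add: e_def evp.hom_minus evp.hom_mult c_def)
  have keys1: "expo_deg \<gamma> \<le> D" if "\<gamma> \<in> Poly_Mapping.keys s1" for \<gamma>
    using that keys_sum unfolding s1_def by (fastforce split: if_splits)
  have lookup1: "Poly_Mapping.lookup s1 \<gamma> = (if expo_deg \<gamma> \<le> D then Poly_Mapping.lookup s \<gamma> else 0)" for \<gamma>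
    by (auto simp: s1_def lookup_sum lookup_single when_def in_keys_iff)
  have keys2: "Suc D \<le> expo_deg \<gamma>" if "\<gamma> \<in> Poly_Mapping.keys (s - s1)" for \<gamma>
    using that by (auto simp: in_keys_iff lookup_minus lookup1 split: if_splits)
  have e1: "1 - e = const_poly (1 / c) * q" by (simp add: e_def)
  have qs: "q * s = p - p * e ^ Suc D"
  proof -
    have "q * s = p * ((1 - e) * (\<Sum>k<Suc D. e ^ k))"
      unfolding e1 s_def by (simp only: mult.assoc mult.left_commute)
    also have "(1 - e) * (\<Sum>k<Suc D. e ^ k) = 1 - e ^ Suc D"
      by (rule one_diff_power_eq[symmetric])
    finally show ?thesis by (simp add: right_diff_distrib)
  qed
  have "line 0 v p = line 0 v q * line 0 v s1" for v
  proof -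
    let ?L = "line 0 v" and ?X = "[:0, 1:] :: complex poly"
    have Lq0: "poly (?L q) 0 \<noteq> 0"
      using q0 by (simp add: poly_line vec_lambda_0)
    then have Lq: "?L q \<noteq> 0" by auto
    from lines[of v] obtain r where r: "?L p = ?L q * r" by (auto elim: dvdE)
    have degr: "degree r \<le> D"
    proof (cases "r = 0")
      case False
      then have "degree r \<le> degree (?L p)" using Lq by (simp add: r degree_mult_eq)
      also have "\<dots> \<le> D" using D by (rule degree_line_le)
      finally show ?thesis .
    qed simp
    have "?L q * (r - ?L s1) = ?L p - ?L q * ?L s1"
      by (simp only: r right_diff_distrib)
    also have "\<dots> = ?L (p - q * s1)"
      by (simp only: line.hom_minus line.hom_mult)
    also have "p - q * s1 = p * e ^ Suc D + q * (s - s1)"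
      using qs by (simp add: algebra_simps)
    also have "?L \<dots> = ?L p * ?L e ^ Suc D + ?L q * ?L (s - s1)"
      by (simp only: line.hom_add line.hom_mult line.hom_power)
    finally have eq: "?L q * (r - ?L s1) = ?L p * ?L e ^ Suc D + ?L q * ?L (s - s1)" .
    have "poly (?L e) 0 = 0" using e0 by (simp add: poly_line vec_lambda_0)
    then have "?X dvd ?L e" using poly_eq_0_iff_dvd[of "?L e" 0] by simp
    then have "?X ^ Suc D dvd ?L e ^ Suc D" by (rule dvd_power_same)
    moreover have "?X ^ Suc D dvd ?L (s - s1)" using keys2 by (rule power_dvd_line)
    ultimately have "?X ^ Suc D dvd ?L q * (r - ?L s1)"
      unfolding eq by (intro dvd_add dvd_mult)
    then have "?X ^ Suc D dvd r - ?L s1" using Lq0 by (rule power_dvd_cancel_left)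
    moreover have "degree (r - ?L s1) < degree (?X ^ Suc D)"
    proof -
      have "degree (?L s1) \<le> D" by (rule degree_line_le) (rule keys1)
      with degr have "degree (r - ?L s1) \<le> D" by (rule degree_diff_le)
      then show ?thesis unfolding degree_linear_power by (rule le_imp_less_Suc)
    qed
    ultimately have "r - ?L s1 = 0"
      using dvd_imp_degree_le[of "?X ^ Suc D" "r - ?L s1"] leD by blast
    then show ?thesis using r by simp
  qed
  then have "eval_poly p z = eval_poly (q * s1) z" for z
    using poly_line[of 0 z p 1] poly_line[of 0 z q 1] poly_line[of 0 z s1 1]
    by (simp add: evp.hom_mult vec_nth_inverse)
  then have "p = q * s1" by (rule eval_poly_ext)
  then show ?thesis by simp
qed

lemma dvd_if_dvd_on_lines:
  fixes p q :: "'n::finite cpoly"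
  assumes q0: "eval_poly q b \<noteq> 0" and lines: "\<And>v. line b v q dvd line b v p"
  shows "q dvd p"
proof -
  let ?\<tau> = "\<lambda>b. subst (\<lambda>i. var_poly i + const_poly (vec_nth b i)) :: 'n cpoly \<Rightarrow> 'n cpoly"
  have "eval_poly (?\<tau> b q) 0 \<noteq> 0"
    using q0 by (simp add: eval_subst evp.hom_add)
  moreover have "line 0 v (?\<tau> b q) dvd line 0 v (?\<tau> b p)" for v
    using lines by (simp add: line_translate)
  ultimately have "?\<tau> b q dvd ?\<tau> b p" by (rule dvd_if_dvd_on_lines_0)
  then have "?\<tau> (- b) (?\<tau> b q) dvd ?\<tau> (- b) (?\<tau> b p)"
    by (rule sub.hom_dvd)
  moreover have "?\<tau> (- b) (?\<tau> b x) = x" for x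
  proof -
    have "const_poly (vec_nth (- b) i) + const_poly (vec_nth b i) = (0 :: 'n cpoly)" for i
      by (simp add: const_poly_def flip: single_add)
    then show ?thesis by (simp add: subst_subst sub.hom_add subst_id add.assoc)
  qed
  ultimately show ?thesis by simp
qed

section \<open>Normality of polynomial rings\<close>

text \<open>
  Contents are multiplicative (Gauss), so the contents of the two factors have product \<open>c\<close>, up to a
  unit, just like their leading coefficients. As each content divides the leading coefficient of
  its factor, the two are associated.
\<close>

lemma lead_coeff_dvd_if_dvd_monic:
  fixes G F H :: "complex poly poly"
  assumes G: "lead_coeff G = 1" and c: "c \<noteq> 0" and eq: "smult c G = F * H"
  shows "lead_coeff F dvd coeff F i"
proof -
  have nz: "F \<noteq> 0" "H \<noteq> 0" using eq c G by auto
  have cG: "content G = 1"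
    using content_dvd_coeff[of G "degree G"] G by (metis is_unit_content_iff)
  have "content F * content H = normalize c"
    using arg_cong[OF eq, of content] by (simp add: content_mult cG)
  moreover have "lead_coeff F * lead_coeff H = c"
    using arg_cong[OF eq, of lead_coeff] G c by (simp add: lead_coeff_mult)
  moreover obtain u where u: "lead_coeff F = content F * u"
    using content_dvd_coeff[of F "degree F"] by (rule dvdE)
  moreover obtain v where v: "lead_coeff H = content H * v"
    using content_dvd_coeff[of H "degree H"] by (rule dvdE)
  ultimately have eq2: "content F * u * (content H * v) = c" and n: "content F * content H = normalize c"
    by simp_all
  have "normalize c * (u * v) = content F * content H * (u * v)" by (simp only: n)
  also have "\<dots> = normalize c * unit_factor c" using eq2 by (simp add: algebra_simps)
  finally have "u * v = unit_factor c" using c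
    by (metis mult_left_cancel normalize_eq_0_iff)
  then have "u dvd 1" using c by (metis dvd_mult_left unit_factor_is_unit dvd_refl dvd_trans)
  then have "lead_coeff F dvd content F" using u by (simp add: mult_unit_dvd_iff)
  then show ?thesis using content_dvd_coeff dvd_trans by blast
qed

text \<open>
  Normality of the polynomial ring, in the form in which it is used: a factor of a monic polynomial
  over the field of fractions has coefficients in the ring once it is made monic. On a line this
  is Gauss's lemma for \<open>\<complex>[T]\<close>, and divisibility can be tested on lines.
\<close>

lemma polynomial_ring_normal:
  fixes G F H :: "'n::{finite,linorder} cpoly poly"
  assumes G: "lead_coeff G = 1" and c: "c \<noteq> 0" and eq: "smult c G = F * H"
  shows "lead_coeff F dvd coeff F i"
proof -
  have "F \<noteq> 0" using eq c G by auto
  then have "c * lead_coeff F \<noteq> 0" using c by simp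
  moreover have "vars_in UNIV (c * lead_coeff F)" by (simp add: vars_in_def)
  ultimately obtain b where b: "eval_poly (c * lead_coeff F) b \<noteq> 0"
    using nonvanishing_point by blast
  show ?thesis
  proof (rule dvd_if_dvd_on_lines)
    show "eval_poly (lead_coeff F) b \<noteq> 0" using b by (auto simp: evp.hom_mult)
    fix v
    let ?L = "line b v"
    interpret mp: map_poly_comm_ring_hom ?L ..
    have ne: "?L c \<noteq> 0" "?L (lead_coeff F) \<noteq> 0"
      using b poly_line[of b v c 0] poly_line[of b v "lead_coeff F" 0]
      by (auto simp: evp.hom_mult vec_nth_inverse)
    have "lead_coeff (map_poly ?L G) = 1"
      using G by (subst lead_coeff_map_poly_nz) auto
    moreover have "smult (?L c) (map_poly ?L G) = map_poly ?L F * map_poly ?L H"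
      using arg_cong[OF eq, of "map_poly ?L"] by (simp add: mp.hom_mult line.map_poly_hom_smult)
    moreover have "lead_coeff (map_poly ?L F) = ?L (lead_coeff F)"
      using ne by (subst lead_coeff_map_poly_nz) auto
    ultimately show "?L (lead_coeff F) dvd ?L (coeff F i)"
      using lead_coeff_dvd_if_dvd_monic[of "map_poly ?L G" "?L c" "map_poly ?L F" "map_poly ?L H" i] ne(1)
      by simp
  qed
qed

section \<open>Noether normalization\<close>

text \<open>
  Ideals of a ring that is a whole type; this spares the carrier of the record-based notion.
\<close>

locale ring_ideal =
  fixes P :: "'r::comm_ring_1 set"
  assumes zero_mem: "0 \<in> P"
    and add_mem: "a \<in> P \<Longrightarrow> b \<in> P \<Longrightarrow> a + b \<in> P"
    and mult_mem: "a \<in> P \<Longrightarrow> r * a \<in> P"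
begin

lemma mult_mem': "a \<in> P \<Longrightarrow> a * r \<in> P"
  using mult_mem[of a r] by (simp add: mult.commute)

lemma uminus_mem: "a \<in> P \<Longrightarrow> - a \<in> P"
  using mult_mem[of a "- 1"] by simp

lemma diff_mem: "a \<in> P \<Longrightarrow> b \<in> P \<Longrightarrow> a - b \<in> P"
  using add_mem[of a "- b"] uminus_mem[of b] by simp

lemma sum_mem: "(\<And>i. i \<in> A \<Longrightarrow> f i \<in> P) \<Longrightarrow> sum f A \<in> P"
  by (induction A rule: infinite_finite_induct) (auto simp: zero_mem add_mem)

text \<open>
  The determinant trick: multiplication by the adjugate shows that \<open>det B\<close> carries every \<open>w j\<close> into
  the ideal, and \<open>1\<close> is a combination of the \<open>w j\<close> modulo the ideal.
\<close>

lemma det_mem: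
  assumes B: "B \<in> carrier_mat n n"
    and Bw: "\<And>i. i < n \<Longrightarrow> (\<Sum>j<n. B $$ (i, j) * w j) \<in> P"
    and one: "1 - (\<Sum>j<n. c j * w j) \<in> P"
  shows "det B \<in> P"
proof -
  have dw: "det B * w k \<in> P" if k: "k < n" for k
  proof -
    note adj = adj_mat[OF B]
    have entry: "(\<Sum>i<n. adj_mat B $$ (k, i) * B $$ (i, j)) = (if k = j then det B else 0)"
      if j: "j < n" for j
    proof -
      have "(adj_mat B * B) $$ (k, j) = (\<Sum>i<n. adj_mat B $$ (k, i) * B $$ (i, j))"
        using adj(1) B j k by (auto simp: scalar_prod_def atLeast0LessThan)
      then show ?thesis using adj(3) j k by (auto split: if_splits)
    qed
    have "(\<Sum>i<n. adj_mat B $$ (k, i) * (\<Sum>j<n. B $$ (i, j) * w j))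
        = (\<Sum>j<n. (\<Sum>i<n. adj_mat B $$ (k, i) * B $$ (i, j)) * w j)"
      unfolding sum_distrib_left sum_distrib_right by (subst sum.swap) (simp add: mult.assoc)
    also have "\<dots> = (\<Sum>j<n. if k = j then det B * w j else 0)"
      using entry by (intro sum.cong) auto
    also have "\<dots> = det B * w k" using k by simp
    finally show ?thesis using Bw by (metis (no_types, lifting) lessThan_iff mult_mem sum_mem)
  qed
  have "det B = det B * (1 - (\<Sum>j<n. c j * w j)) + (\<Sum>j<n. c j * (det B * w j))"
    by (simp add: algebra_simps sum_distrib_left)
  also have "\<dots> \<in> P"
    by (intro add_mem mult_mem[OF one] sum_mem) (auto intro: mult_mem[OF dw])
  finally show ?thesis .
qed

end

locale poly_ideal = ring_ideal P for P :: "'n::{finite,linorder} cpoly set"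
begin

text \<open>
  The polynomials that are, modulo \<open>P\<close>, combinations of \<open>W\<close> with coefficients in the algebra
  generated by the family \<open>h\<close>. The family is indexed by all variables, and elements that have been
  eliminated are replaced by \<open>0\<close>; so the type of coefficients does not depend on their number.
\<close>

definition gen_mod :: "('n \<Rightarrow> 'n cpoly) \<Rightarrow> 'n cpoly set \<Rightarrow> 'n cpoly set" where
  "gen_mod h W = {s. \<exists>a. s - (\<Sum>w\<in>W. subst h (a w) * w) \<in> P}"

lemma gen_mod_ideal: "s \<in> P \<Longrightarrow> s \<in> gen_mod h W"
  unfolding gen_mod_def by (intro CollectI exI[of _ "\<lambda>_. 0"]) simp

lemma gen_mod_add:
  assumes "s \<in> gen_mod h W" "t \<in> gen_mod h W"
  shows "s + t \<in> gen_mod h W"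
proof -
  from assms obtain a b where "s - (\<Sum>w\<in>W. subst h (a w) * w) \<in> P" "t - (\<Sum>w\<in>W. subst h (b w) * w) \<in> P"
    unfolding gen_mod_def by blast
  from add_mem[OF this]
  have "s + t - (\<Sum>w\<in>W. subst h (a w + b w) * w) \<in> P"
    by (simp add: sub.hom_add distrib_right sum.distrib algebra_simps)
  then show ?thesis unfolding gen_mod_def by (intro CollectI exI)
qed

lemma gen_mod_scale:
  assumes "s \<in> gen_mod h W"
  shows "subst h r * s \<in> gen_mod h W"
proof -
  from assms obtain a where "s - (\<Sum>w\<in>W. subst h (a w) * w) \<in> P"
    unfolding gen_mod_def by blast
  from mult_mem[OF this, of "subst h r"]
  have "subst h r * s - (\<Sum>w\<in>W. subst h (r * a w) * w) \<in> P"
    by (simp add: sub.hom_mult right_diff_distrib sum_distrib_left mult.assoc)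
  then show ?thesis unfolding gen_mod_def by (intro CollectI exI)
qed

lemma gen_mod_const: "s \<in> gen_mod h W \<Longrightarrow> const_poly c * s \<in> gen_mod h W"
  using gen_mod_scale[of s h W "const_poly c"] by simp

lemma gen_mod_var: "s \<in> gen_mod h W \<Longrightarrow> h i * s \<in> gen_mod h W"
  using gen_mod_scale[of s h W "var_poly i"] by simp

lemma gen_mod_zero: "0 \<in> gen_mod h W"
  by (rule gen_mod_ideal) (rule zero_mem)

lemma gen_mod_uminus: "s \<in> gen_mod h W \<Longrightarrow> - s \<in> gen_mod h W"
  using gen_mod_scale[of s h W "- 1"] by (simp add: sub.hom_uminus)

lemma gen_mod_diff: "s \<in> gen_mod h W \<Longrightarrow> t \<in> gen_mod h W \<Longrightarrow> s - t \<in> gen_mod h W"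
  using gen_mod_add[of s h W "- t"] gen_mod_uminus[of t h W] by simp

lemma gen_mod_sum: "(\<And>i. i \<in> A \<Longrightarrow> f i \<in> gen_mod h W) \<Longrightarrow> sum f A \<in> gen_mod h W"
  by (induction A rule: infinite_finite_induct) (auto simp: gen_mod_zero gen_mod_add)

lemma gen_mod_base:
  assumes "finite W" "w \<in> W"
  shows "w \<in> gen_mod h W"
proof -
  have "(\<Sum>v\<in>W. subst h (if v = w then 1 else 0) * v) = (\<Sum>v\<in>W. if v = w then v else 0)"
    by (intro sum.cong) auto
  also have "\<dots> = w" using assms by simp
  finally have "w - (\<Sum>v\<in>W. subst h (if v = w then 1 else 0) * v) \<in> P"
    by (simp add: zero_mem)
  then show ?thesis unfolding gen_mod_def by (intro CollectI exI)
qed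

lemma gen_mod_mult:
  assumes "s \<in> gen_mod h U" and "\<And>v. v \<in> U \<Longrightarrow> v * x \<in> gen_mod h W"
  shows "s * x \<in> gen_mod h W"
proof -
  from assms(1) obtain a where a: "s - (\<Sum>v\<in>U. subst h (a v) * v) \<in> P"
    unfolding gen_mod_def by blast
  have "s * x = (s - (\<Sum>v\<in>U. subst h (a v) * v)) * x + (\<Sum>v\<in>U. subst h (a v) * (v * x))"
    by (simp add: left_diff_distrib sum_distrib_right mult.assoc)
  moreover have "(s - (\<Sum>v\<in>U. subst h (a v) * v)) * x \<in> gen_mod h W"
    using mult_mem'[OF a] by (rule gen_mod_ideal)
  ultimately show ?thesis
    using assms(2) by (auto intro!: gen_mod_add gen_mod_sum gen_mod_scale)
qed

lemma gen_mod_mono: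
  assumes "finite W" "U \<subseteq> W" "s \<in> gen_mod h U"
  shows "s \<in> gen_mod h W"
  using gen_mod_mult[of s h U 1 W] assms gen_mod_base[OF assms(1)] by auto

definition pows :: "'n cpoly \<Rightarrow> nat \<Rightarrow> 'n cpoly set" where
  "pows u k = (\<lambda>l. u ^ l) ` {..<k}"

lemma finite_pows [simp]: "finite (pows u k)"
  by (simp add: pows_def)

lemma pows_mult_mem:
  assumes "s \<in> gen_mod h (pows u k)"
  shows "s * u \<in> gen_mod h (pows u (Suc k))"
proof (rule gen_mod_mult[OF assms])
  fix v assume "v \<in> pows u k"
  then have "v * u \<in> pows u (Suc k)"
    by (auto simp: pows_def simp flip: power_Suc2 intro!: image_eqI[of _ _ "Suc _"])
  then show "v * u \<in> gen_mod h (pows u (Suc k))" by (intro gen_mod_base) simp_all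
qed

lemma pows_mono:
  assumes "s \<in> gen_mod h (pows u k)" "k \<le> l"
  shows "s \<in> gen_mod h (pows u l)"
  using assms by (intro gen_mod_mono[of "pows u l" "pows u k"]) (auto simp: pows_def)

text \<open>
  Written in the new coordinates, a monomial of degree \<open>d\<close> is a polynomial of degree at most \<open>d\<close> in
  \<open>u\<close>, and its coefficient of \<open>u\<^sup>d\<close> is the value of the monomial at \<open>c\<close>.
\<close>

lemma monomial_leading_power:
  assumes h: "\<And>j. h j = g j + const_poly (vec_nth c j) * u"
  shows "mono_ev h \<gamma> - const_poly (mono_ev (vec_nth c) \<gamma>) * u ^ expo_deg \<gamma>
    \<in> gen_mod g (pows u (expo_deg \<gamma>))"
proof (induction \<gamma> rule: expo_induct)
  case zero
  show ?case by (simp add: expo_deg_def const_poly_def gen_mod_zero)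
next
  case (step \<gamma> i)
  define d where "d = expo_deg \<gamma>"
  define l where "l = mono_ev h \<gamma> - const_poly (mono_ev (vec_nth c) \<gamma>) * u ^ d"
  let ?M = "gen_mod g (pows u (Suc d))"
  have l: "l \<in> gen_mod g (pows u d)" using step by (simp add: l_def d_def)
  have ud: "u ^ d \<in> ?M" by (intro gen_mod_base) (auto simp: pows_def)
  have "mono_ev h (\<gamma> + unit_expo i) - const_poly (mono_ev (vec_nth c) (\<gamma> + unit_expo i)) * u ^ Suc d
      = g i * l + const_poly (vec_nth c i) * (l * u)
        + const_poly (mono_ev (vec_nth c) \<gamma>) * (g i * u ^ d)"
    by (simp add: mono_ev_add l_def h[of i] cp.hom_mult algebra_simps)
  also have "\<dots> \<in> ?M"
    using pows_mono[OF l, of "Suc d"] pows_mult_mem[OF l] ud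
    by (intro gen_mod_add gen_mod_const gen_mod_var) auto
  finally show ?case by (simp add: expo_deg_add_unit d_def)
qed

text \<open>
  A relation \<open>F\<close> between the parameters allows to eliminate one of them: at a point \<open>c\<close> where the form
  of top degree of \<open>F\<close> does not vanish, the coordinates \<open>h j = g j + c\<^sub>j u\<close> turn \<open>F\<close> into a relation
  that is monic in \<open>u\<close> up to a constant, so \<open>u\<close> is integral over the \<open>g j\<close>.
\<close>

lemma noether_step:
  assumes one: "1 \<notin> P" and hY: "\<And>j. j \<notin> Y \<Longrightarrow> h j = 0" and F: "F \<noteq> 0" "vars_in Y F" "subst h F \<in> P"
    and W: "finite W" "gen_mod h W = UNIV" and h\<xi>: "\<And>j. eval_poly (h j) \<xi> = 0"
  obtains i g W' where "i \<in> Y" "\<And>j. j \<notin> Y - {i} \<Longrightarrow> g j = 0" "\<And>j. eval_poly (g j) \<xi> = 0"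
    "finite W'" "gen_mod g W' = UNIV"
proof -
  define D where "D = Max (expo_deg ` Poly_Mapping.keys F)"
  have ne: "expo_deg ` Poly_Mapping.keys F \<noteq> {}" using F by simp
  then have "D \<in> expo_deg ` Poly_Mapping.keys F" unfolding D_def by (intro Max_in) auto
  then obtain \<gamma>0 where \<gamma>0: "\<gamma>0 \<in> Poly_Mapping.keys F" "expo_deg \<gamma>0 = D" by auto
  have D: "expo_deg \<gamma> \<le> D" if "\<gamma> \<in> Poly_Mapping.keys F" for \<gamma>
    unfolding D_def using that by (intro Max_ge) auto
  have D0: "D > 0"
  proof (rule ccontr)
    assume "\<not> D > 0"
    then have "\<gamma> = 0" if "\<gamma> \<in> Poly_Mapping.keys F" for \<gamma>
      using D[OF that] by (intro poly_mapping_eqI) (simp add: expo_deg_def)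
    then have "Poly_Mapping.keys F = {0}" using \<gamma>0(1) by blast
    then have c: "Poly_Mapping.lookup F 0 \<noteq> 0" "F = const_poly (Poly_Mapping.lookup F 0)"
      using cpoly_as_sum[of F] by (auto simp: const_poly_def in_keys_iff)
    have "subst h F = const_poly (Poly_Mapping.lookup F 0)" using c(2) by (metis subst_const)
    then have "const_poly (1 / Poly_Mapping.lookup F 0) * subst h F = 1"
      using c(1) by (simp flip: cp.hom_mult)
    then show False using mult_mem[OF F(3)] one by metis
  qed
  \<comment> \<open>\<open>T\<close> is the form of top degree of \<open>F\<close>.\<close>
  define T where "T = (\<Sum>\<gamma>\<in>{\<gamma>\<in>Poly_Mapping.keys F. expo_deg \<gamma> = D}.
    Poly_Mapping.single \<gamma> (Poly_Mapping.lookup F \<gamma>))"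
  have lookupT: "Poly_Mapping.lookup T \<gamma> = (if expo_deg \<gamma> = D then Poly_Mapping.lookup F \<gamma> else 0)" for \<gamma>
    by (auto simp: T_def lookup_sum lookup_single when_def in_keys_iff)
  have keysT: "Poly_Mapping.keys T = {\<gamma>\<in>Poly_Mapping.keys F. expo_deg \<gamma> = D}"
    by (auto simp: in_keys_iff lookupT split: if_splits)
  have "T \<noteq> 0" using \<gamma>0 keysT by auto
  moreover have "vars_in Y T" using F(2) by (auto simp: vars_in_def keysT)
  ultimately obtain c where c: "\<And>j. j \<notin> Y \<Longrightarrow> vec_nth c j = 0" "eval_poly T c \<noteq> 0"
    using nonvanishing_point by blast
  have evT: "eval_poly T c = (\<Sum>\<gamma>\<in>{\<gamma>\<in>Poly_Mapping.keys F. expo_deg \<gamma> = D}.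
      Poly_Mapping.lookup F \<gamma> * mono_ev (vec_nth c) \<gamma>)"
    unfolding eval_poly_eq_poly_ev poly_ev_def keysT by (intro sum.cong) (auto simp: lookupT)
  have "\<exists>i. vec_nth c i \<noteq> 0"
  proof (rule ccontr)
    assume "\<nexists>i. vec_nth c i \<noteq> 0"
    then have c0: "vec_nth c i = 0" for i by simp
    have "mono_ev (vec_nth c) \<gamma> = 0" if "expo_deg \<gamma> = D" for \<gamma>
    proof -
      have "\<not> (\<forall>i. Poly_Mapping.lookup \<gamma> i = 0)"
      proof
        assume "\<forall>i. Poly_Mapping.lookup \<gamma> i = 0"
        then have "expo_deg \<gamma> = 0" by (simp add: expo_deg_def)
        with that D0 show False by simp
      qed
      then obtain i where "Poly_Mapping.lookup \<gamma> i \<noteq> 0" by blast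
      then show ?thesis by (auto simp: mono_ev_superset[of UNIV] c0 intro!: prod_zero)
    qed
    then show False using c(2) unfolding evT by simp
  qed
  then obtain i where ci: "vec_nth c i \<noteq> 0" by blast
  then have iY: "i \<in> Y" using c(1) by blast
  \<comment> \<open>The scaling makes \<open>g i\<close> vanish, so that the parameter \<open>i\<close> disappears.\<close>
  define u where "u = const_poly (1 / vec_nth c i) * h i"
  define g where "g j = h j - const_poly (vec_nth c j) * u" for j
  have h: "h j = g j + const_poly (vec_nth c j) * u" for j by (simp add: g_def)
  have gi: "g i = 0" using ci by (simp add: g_def u_def flip: cp.hom_mult mult.assoc)
  have g0: "g j = 0" if "j \<notin> Y - {i}" for j
    using that hY c(1) gi by (cases "j = i") (auto simp: g_def)
  have g\<xi>: "eval_poly (g j) \<xi> = 0" for j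
    by (simp add: g_def u_def evp.hom_minus evp.hom_mult h\<xi>)
  let ?R = "gen_mod g (pows u D)"
  have uD: "u ^ D \<in> ?R"
  proof -
    define lead where "lead \<gamma> = const_poly (Poly_Mapping.lookup F \<gamma> * mono_ev (vec_nth c) \<gamma>) * u ^ expo_deg \<gamma>" for \<gamma>
    have "subst h F - (\<Sum>\<gamma>\<in>Poly_Mapping.keys F. lead \<gamma>)
        = (\<Sum>\<gamma>\<in>Poly_Mapping.keys F. const_poly (Poly_Mapping.lookup F \<gamma>) *
            (mono_ev h \<gamma> - const_poly (mono_ev (vec_nth c) \<gamma>) * u ^ expo_deg \<gamma>))"
      by (simp add: poly_ev_def lead_def sum_subtractf right_diff_distrib cp.hom_mult mult.assoc)
    also have "\<dots> \<in> ?R"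
      using D by (intro gen_mod_sum gen_mod_const pows_mono[OF monomial_leading_power[OF h]])
    finally have diff: "subst h F - (\<Sum>\<gamma>\<in>Poly_Mapping.keys F. lead \<gamma>) \<in> ?R" .
    have all: "(\<Sum>\<gamma>\<in>Poly_Mapping.keys F. lead \<gamma>) \<in> ?R"
      using gen_mod_diff[OF gen_mod_ideal[OF F(3)] diff]
      unfolding diff_diff_eq2 add_diff_cancel_left' .
    have low: "lead \<gamma> \<in> ?R" if "expo_deg \<gamma> < D" for \<gamma>
      unfolding lead_def using that by (intro gen_mod_const gen_mod_base) (auto simp: pows_def)
    have split: "(\<Sum>\<gamma>\<in>Poly_Mapping.keys F. lead \<gamma>) =
        (\<Sum>\<gamma>\<in>{\<gamma>\<in>Poly_Mapping.keys F. expo_deg \<gamma> = D}. lead \<gamma>) +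
        (\<Sum>\<gamma>\<in>{\<gamma>\<in>Poly_Mapping.keys F. expo_deg \<gamma> < D}. lead \<gamma>)"
      using D by (subst sum.union_disjoint[symmetric]) (auto intro!: sum.cong simp: le_less)
    have "(\<Sum>\<gamma>\<in>{\<gamma>\<in>Poly_Mapping.keys F. expo_deg \<gamma> < D}. lead \<gamma>) \<in> ?R"
      using low by (intro gen_mod_sum) auto
    from gen_mod_diff[OF all this] have "(\<Sum>\<gamma>\<in>{\<gamma>\<in>Poly_Mapping.keys F. expo_deg \<gamma> = D}. lead \<gamma>) \<in> ?R"
      unfolding split add_diff_cancel_right' .
    also have "(\<Sum>\<gamma>\<in>{\<gamma>\<in>Poly_Mapping.keys F. expo_deg \<gamma> = D}. lead \<gamma>) = const_poly (eval_poly T c) * u ^ D"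
      unfolding evT cp.hom_sum sum_distrib_right by (intro sum.cong) (auto simp: lead_def)
    finally have "const_poly (1 / eval_poly T c) * (const_poly (eval_poly T c) * u ^ D) \<in> ?R"
      by (rule gen_mod_const)
    then show ?thesis using c(2) by (simp flip: cp.hom_mult mult.assoc)
  qed
  have closed: "s * u \<in> ?R" if "s \<in> ?R" for s
  proof (rule gen_mod_mult[OF that])
    fix v assume "v \<in> pows u D"
    then obtain l where l: "l < D" "v * u = u ^ Suc l" by (auto simp: pows_def mult.commute)
    show "v * u \<in> ?R"
    proof (cases "Suc l = D")
      case False
      with l show ?thesis by (intro gen_mod_base) (auto simp: pows_def intro!: image_eqI[of _ _ "Suc l"])
    qed (use l uD in simp)
  qed
  have img: "subst h p \<in> ?R" for p
  proof (induction p rule: cpoly_induct)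
    case (const c)
    have "const_poly c * 1 \<in> ?R"
      using D0 by (intro gen_mod_const gen_mod_base) (auto simp: pows_def intro!: image_eqI[of _ _ 0])
    then show ?case by simp
  next
    case (add p q)
    then show ?case by (simp add: sub.hom_add gen_mod_add)
  next
    case (var j p)
    have "subst h (var_poly j * p) = g j * subst h p + const_poly (vec_nth c j) * (subst h p * u)"
      by (simp add: sub.hom_mult h[of j] algebra_simps)
    then show ?case using var closed by (auto intro!: gen_mod_add gen_mod_var gen_mod_const)
  qed
  define W' where "W' = (\<lambda>(v, w). v * w) ` (pows u D \<times> W)"
  have finW': "finite W'" using W(1) by (simp add: W'_def)
  have "s \<in> gen_mod g W'" for s
  proof -
    have "s \<in> gen_mod h W" using W(2) by simp
    then obtain a where a: "s - (\<Sum>w\<in>W. subst h (a w) * w) \<in> P" unfolding gen_mod_def by blast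
    have "subst h (a w) * w \<in> gen_mod g W'" if "w \<in> W" for w
      using that by (intro gen_mod_mult[OF img] gen_mod_base[OF finW']) (auto simp: W'_def)
    then have "(s - (\<Sum>w\<in>W. subst h (a w) * w)) + (\<Sum>w\<in>W. subst h (a w) * w) \<in> gen_mod g W'"
      by (intro gen_mod_add gen_mod_sum gen_mod_ideal[OF a]) auto
    then show ?thesis by simp
  qed
  then have "gen_mod g W' = UNIV" by blast
  with iY g0 g\<xi> finW' show ?thesis by (rule that)
qed

text \<open>
  Starting from the coordinates centred at \<open>\<xi>\<close>, parameters are eliminated until the remaining ones
  are algebraically independent modulo \<open>P\<close>; all of them keep vanishing at \<open>\<xi>\<close>.
\<close>

theorem noether_normalization:
  assumes one: "1 \<notin> P"
  obtains Y h W where "\<And>j. j \<notin> Y \<Longrightarrow> h j = 0" "\<And>j. eval_poly (h j) \<xi> = 0"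
    "finite W" "gen_mod h W = UNIV" "\<And>p. vars_in Y p \<Longrightarrow> subst h p \<in> P \<Longrightarrow> p = 0"
proof -
  define ok where "ok Y h W \<longleftrightarrow> (\<forall>j. j \<notin> Y \<longrightarrow> h j = 0) \<and> (\<forall>j. eval_poly (h j) \<xi> = 0) \<and>
    finite W \<and> gen_mod h W = UNIV" for Y h W
  have step: "ok Y h W \<Longrightarrow> \<exists>Y h W. ok Y h W \<and> (\<forall>p. vars_in Y p \<longrightarrow> subst h p \<in> P \<longrightarrow> p = 0)" for Y h W
  proof (induction "card Y" arbitrary: Y h W rule: less_induct)
    case less
    show ?case
    proof (cases "\<forall>p. vars_in Y p \<longrightarrow> subst h p \<in> P \<longrightarrow> p = 0")
      case False
      then obtain F where F: "F \<noteq> 0" "vars_in Y F" "subst h F \<in> P" by blast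
      from less.prems have hY: "\<And>j. j \<notin> Y \<Longrightarrow> h j = 0" and h\<xi>: "\<And>j. eval_poly (h j) \<xi> = 0"
        and W: "finite W" "gen_mod h W = UNIV"
        by (auto simp: ok_def)
      obtain i g W' where "i \<in> Y" and ok: "ok (Y - {i}) g W'"
      proof (rule noether_step[OF one hY F W h\<xi>])
        fix i g W'
        assume "i \<in> Y" "\<And>j. j \<notin> Y - {i} \<Longrightarrow> g j = 0" "\<And>j. eval_poly (g j) \<xi> = 0"
          "finite W'" "gen_mod g W' = UNIV"
        then show thesis by (intro that[of i g W']) (simp_all add: ok_def)
      qed
      have "card (Y - {i}) < card Y" using \<open>i \<in> Y\<close> by (intro psubset_card_mono) auto
      from less.hyps[OF this ok] show ?thesis .
    qed (use less.prems in blast)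
  qed
  have base: "ok UNIV (\<lambda>j. var_poly j - const_poly (vec_nth \<xi> j)) {1}"
  proof -
    let ?h = "\<lambda>j. var_poly j - const_poly (vec_nth \<xi> j)"
    have "s \<in> gen_mod ?h {1}" for s
    proof -
      have "1 \<in> gen_mod ?h {1}" by (rule gen_mod_base) auto
      from gen_mod_scale[OF this, of "subst (\<lambda>j. var_poly j + const_poly (vec_nth \<xi> j)) s"]
      show ?thesis by (simp add: subst_subst sub.hom_add subst_id)
    qed
    then show ?thesis by (auto simp: ok_def evp.hom_minus)
  qed
  from step[OF base] obtain Y h W where okW: "ok Y h W"
    and indep: "\<forall>p. vars_in Y p \<longrightarrow> subst h p \<in> P \<longrightarrow> p = 0"
    by (elim exE conjE)
  show ?thesis
  proof (rule that[of Y h W])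
    show "p = 0" if "vars_in Y p" "subst h p \<in> P" for p using indep that by simp
  qed (use okW in \<open>simp_all add: ok_def\<close>)
qed

end

section \<open>Minimal polynomials over a Noether normalization\<close>

text \<open>
  For a prime ideal \<open>P\<close>, the ring \<open>\<complex>[x]/P\<close> is a finite module, generated by \<open>W\<close>, over the polynomial
  ring \<open>A\<close> in the variables \<open>Y\<close>, which \<open>h\<close> embeds.
\<close>

locale noether_data = poly_ideal P for P :: "'n::{finite,linorder} cpoly set" +
  fixes Y :: "'n set" and h :: "'n \<Rightarrow> 'n cpoly" and W :: "'n cpoly set"
  assumes one_notin: "1 \<notin> P"
    and prime: "a * b \<in> P \<Longrightarrow> a \<in> P \<or> b \<in> P"
    and h_zero: "j \<notin> Y \<Longrightarrow> h j = 0"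
    and finite_W: "finite W"
    and gen_UNIV: "gen_mod h W = UNIV"
    and indep: "vars_in Y p \<Longrightarrow> subst h p \<in> P \<Longrightarrow> p = 0"
begin

definition supported :: "complex^('n::{finite,linorder}) \<Rightarrow> bool" where
  "supported y \<longleftrightarrow> (\<forall>j. j \<notin> Y \<longrightarrow> vec_nth y j = 0)"

text \<open>
  The projection onto \<open>A\<close>. As \<open>h\<close> kills the other variables, it does not change images under \<open>h\<close>.
\<close>

definition restr :: "'n cpoly \<Rightarrow> 'n cpoly" where
  "restr = subst (\<lambda>j. if j \<in> Y then var_poly j else 0)"

lemma restr_hom: "comm_ring_hom restr"
  unfolding restr_def by (rule subst_hom)

sublocale restr: comm_ring_hom restr
  by (rule restr_hom)

lemma subst_restr [simp]: "subst h (restr p) = subst h p"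
proof -
  have "subst h (if j \<in> Y then var_poly j else 0) = h j" for j
    using h_zero by simp
  then show ?thesis by (simp add: restr_def subst_subst)
qed

lemma restr_restr [simp]: "restr (restr p) = restr p"
proof -
  have "subst (\<lambda>j. if j \<in> Y then var_poly j else 0) (if j \<in> Y then var_poly j else 0)
    = (if j \<in> Y then var_poly j else 0)" for j :: 'n
    by simp
  then show ?thesis by (simp add: restr_def subst_subst)
qed

lemma eval_restr:
  assumes "supported y"
  shows "eval_poly (restr p) y = eval_poly p y"
proof -
  have "(\<chi> i. eval_poly (if i \<in> Y then var_poly i else 0) y) = y"
    using assms by (simp add: vector_eq_iff supported_def)
  then show ?thesis by (simp add: restr_def eval_subst)
qed

lemma vars_in_restr: "vars_in Y (restr p)"
proof (induction p rule: cpoly_induct)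
  case (const c)
  have "restr (const_poly c) = const_poly c" by (simp add: restr_def)
  then show ?case by (simp add: vars_in_const)
next
  case (add p q)
  then show ?case by (simp add: restr.hom_add vars_in_add)
next
  case (var i p)
  have "restr (var_poly i) = (if i \<in> Y then var_poly i else 0)" by (simp add: restr_def)
  then show ?case using var by (simp add: restr.hom_mult vars_in_mult vars_in_var vars_in_zero)
qed

lemma restr_zero: "subst h p \<in> P \<Longrightarrow> restr p = 0"
  using indep[OF vars_in_restr, of p] by simp

text \<open>
  The image of \<open>G \<in> A[T]\<close> in \<open>\<complex>[x]\<close> when \<open>T\<close> is sent to \<open>z\<close>; \<open>neval\<close> below is the value of \<open>G\<close> at a
  point of the parameter space and a number. The two correspond at points of the variety
  (\<open>eval_peval\<close>).
\<close>

definition peval :: "'n cpoly \<Rightarrow> 'n cpoly poly \<Rightarrow> 'n cpoly" where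
  "peval z G = poly (map_poly (subst h) G) z"

definition neval :: "complex^('n::{finite,linorder}) \<Rightarrow> complex \<Rightarrow> 'n cpoly poly \<Rightarrow> complex" where
  "neval y t G = poly (map_poly (\<lambda>p. eval_poly p y) G) t"

lemma peval_hom: "comm_ring_hom (peval z)"
proof -
  interpret mp: map_poly_comm_ring_hom "subst h" ..
  show ?thesis unfolding peval_def
    by unfold_locales (simp_all add: mp.hom_add mp.hom_mult)
qed

lemma neval_hom: "comm_ring_hom (neval y t)"
proof -
  interpret mp: map_poly_comm_ring_hom "\<lambda>p. eval_poly p y" ..
  show ?thesis unfolding neval_def
    by unfold_locales (simp_all add: mp.hom_add mp.hom_mult)
qed

sublocale pev: comm_ring_hom "peval z" for z by (rule peval_hom)
sublocale nev: comm_ring_hom "neval y t" for y t by (rule neval_hom)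
sublocale mres: map_poly_comm_ring_hom restr ..

lemma peval_pCons: "peval z (pCons a G) = subst h a + z * peval z G"
  by (simp add: peval_def sub.map_poly_pCons_hom)

lemma neval_pCons: "neval y t (pCons a G) = eval_poly a y + t * neval y t G"
  by (simp add: neval_def evp.map_poly_pCons_hom)

lemma peval_map_restr [simp]: "peval z (map_poly restr G) = peval z G"
  by (induction G) (simp_all add: peval_pCons restr.map_poly_pCons_hom)

lemma neval_map_restr: "supported y \<Longrightarrow> neval y t (map_poly restr G) = neval y t G"
  by (induction G) (simp_all add: neval_pCons restr.map_poly_pCons_hom eval_restr)

lemma eval_peval:
  "eval_poly (peval z G) x = neval (\<chi> j. eval_poly (h j) x) (eval_poly z x) G"
  by (induction G) (simp_all add: peval_pCons neval_pCons evp.hom_add evp.hom_mult eval_subst)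

lemma map_restr_idem [simp]: "map_poly restr (map_poly restr G) = map_poly restr G"
  by (induction G) (simp_all add: restr.map_poly_pCons_hom)

lemma enum_W: obtains w where "bij_betw w {..<card W} W"
  using ex_bij_betw_nat_finite[OF finite_W] by (auto simp: atLeast0LessThan)

lemma W_sum_nat:
  assumes "bij_betw w {..<card W} W"
  shows "(\<Sum>v\<in>W. f v) = (\<Sum>j<card W. f (w j))"
  using sum.reindex_bij_betw[OF assms, of f] by simp

lemma one_gen: obtains c where "1 - (\<Sum>w\<in>W. subst h (c w) * w) \<in> P"
  using gen_UNIV unfolding gen_mod_def by blast

lemma gen_exists: "\<exists>a. s - (\<Sum>w\<in>W. subst h (a w) * w) \<in> P"
  using gen_UNIV unfolding gen_mod_def by blast

lemma peval_det_mem: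
  assumes A: "A \<in> carrier_mat (card W) (card W)" and w: "bij_betw w {..<card W} W"
    and rel: "\<And>i. i < card W \<Longrightarrow> (\<Sum>j<card W. peval z (A $$ (i, j)) * w j) \<in> P"
  shows "peval z (det A) \<in> P"
proof -
  obtain c where c: "1 - (\<Sum>v\<in>W. subst h (c v) * v) \<in> P" by (rule one_gen)
  have "det (map_mat (peval z) A) \<in> P"
  proof (rule det_mem)
    show "map_mat (peval z) A \<in> carrier_mat (card W) (card W)" using A by simp
    show "1 - (\<Sum>j<card W. subst h (c (w j)) * w j) \<in> P"
      using c by (simp add: W_sum_nat[OF w])
    fix i assume i: "i < card W"
    have "(\<Sum>j<card W. map_mat (peval z) A $$ (i, j) * w j) = (\<Sum>j<card W. peval z (A $$ (i, j)) * w j)"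
      using A i by (intro sum.cong) auto
    then show "(\<Sum>j<card W. map_mat (peval z) A $$ (i, j) * w j) \<in> P" using rel[OF i] by simp
  qed
  then show ?thesis by simp
qed

text \<open>
  Multiplication by \<open>z\<close> on the finite module is described by a matrix over \<open>A\<close>; its characteristic
  polynomial is an integral equation of \<open>z\<close>.
\<close>

lemma integral_equation: "\<exists>G. lead_coeff G = 1 \<and> peval z G \<in> P"
proof -
  obtain w where w: "bij_betw w {..<card W} W" by (rule enum_W)
  have "\<forall>s. \<exists>a. s - (\<Sum>w\<in>W. subst h (a w) * w) \<in> P" using gen_exists by blast
  then obtain a where a: "s - (\<Sum>w\<in>W. subst h (a s w) * w) \<in> P" for s
    by (auto simp: choice_iff)
  define A where "A = mat (card W) (card W) (\<lambda>(i, j). a (z * w i) (w j))"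
  have A: "A \<in> carrier_mat (card W) (card W)" by (simp add: A_def)
  have "peval z (det (char_poly_matrix A)) \<in> P"
  proof (rule peval_det_mem[OF _ w])
    show "char_poly_matrix A \<in> carrier_mat (card W) (card W)" using A by simp
    fix i assume i: "i < card W"
    have "(\<Sum>j<card W. peval z (char_poly_matrix A $$ (i, j)) * w j) =
        (\<Sum>j<card W. (if i = j then z * w j else 0) - subst h (a (z * w i) (w j)) * w j)"
    proof (intro sum.cong refl)
      fix j assume j: "j \<in> {..<card W}"
      show "peval z (char_poly_matrix A $$ (i, j)) * w j
          = (if i = j then z * w j else 0) - subst h (a (z * w i) (w j)) * w j"
        using i j by (simp add: char_poly_matrix_def A_def peval_pCons pev.hom_add sub.hom_uminus algebra_simps)
    qed
    also have "\<dots> = z * w i - (\<Sum>v\<in>W. subst h (a (z * w i) v) * v)"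
      using i by (simp add: sum_subtractf W_sum_nat[OF w])
    also have "\<dots> \<in> P" by (rule a)
    finally show "(\<Sum>j<card W. peval z (char_poly_matrix A $$ (i, j)) * w j) \<in> P" .
  qed
  then show ?thesis
    using degree_monic_char_poly[OF A]
    by (intro exI[of _ "det (char_poly_matrix A)"]) (simp add: char_poly_def)
qed

text \<open>
  By pseudo-division, a relation \<open>F0\<close> of least degree divides every relation up to powers of its
  leading coefficient \<open>a\<close>. It divides in particular a monic relation, so normality of \<open>A\<close> permits to
  divide \<open>F0\<close> by \<open>a\<close>. The quotient is a relation again because \<open>P\<close> is prime and does not contain \<open>a\<close>.
\<close>

theorem minimal_polynomial:
  obtains F where "lead_coeff F = 1" "peval z F \<in> P"
    "\<And>G. peval z G \<in> P \<Longrightarrow> F dvd map_poly restr G"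
proof -
  define good where "good G \<longleftrightarrow> G \<noteq> 0 \<and> map_poly restr G = G \<and> peval z G \<in> P" for G
  obtain G0 where G0: "lead_coeff G0 = 1" "peval z G0 \<in> P" using integral_equation by blast
  define G1 where "G1 = map_poly restr G0"
  have lead1: "lead_coeff G1 = 1"
    using G0(1) unfolding G1_def by (subst lead_coeff_map_poly_nz) auto
  have "G1 \<noteq> 0" using lead1 by auto
  then have G1: "good G1" using G0(2) by (simp add: good_def G1_def)
  define d where "d = (LEAST d. \<exists>G. good G \<and> degree G = d)"
  have "\<exists>G. good G \<and> degree G = d"
    unfolding d_def by (rule LeastI_ex) (use G1 in blast)
  then obtain F0 where F0: "good F0" "degree F0 = d" by blast
  have least: "d \<le> degree G" if "good G" for G
    unfolding d_def by (rule Least_le) (use that in blast)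
  have division: "\<exists>q k. smult (lead_coeff F ^ k) G = F * q"
    if F: "good F" "degree F = d" and G: "map_poly restr G = G" "peval z G \<in> P" for F G
  proof -
    obtain q r where qr: "pseudo_divmod G F = (q, r)" by (cases "pseudo_divmod G F")
    have "F \<noteq> 0" using F by (simp add: good_def)
    from pseudo_divmod[OF this qr] obtain k where
      eq: "smult (lead_coeff F ^ k) G = F * q + r" and r: "r = 0 \<or> degree r < degree F"
      by blast
    have l: "restr (lead_coeff F ^ k) = lead_coeff F ^ k"
    proof -
      have "restr (coeff F i) = coeff F i" for i
        using F unfolding good_def by (metis coeff_map_poly restr.hom_zero)
      then show ?thesis by (simp add: restr.hom_power)
    qed
    have eq': "smult (lead_coeff F ^ k) G = F * map_poly restr q + map_poly restr r"
      using arg_cong[OF eq, of "map_poly restr"] F G l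
      by (simp add: mres.hom_add mres.hom_mult restr.map_poly_hom_smult good_def)
    have "peval z (map_poly restr r) \<in> P"
    proof -
      have "map_poly restr r = [:lead_coeff F ^ k:] * G - F * map_poly restr q"
        using eq' by simp
      then have "peval z (map_poly restr r) =
          peval z [:lead_coeff F ^ k:] * peval z G - peval z F * peval z (map_poly restr q)"
        by (simp only: pev.hom_minus pev.hom_mult)
      also have "\<dots> \<in> P" using F G by (intro diff_mem mult_mem mult_mem') (simp_all add: good_def)
      finally show ?thesis .
    qed
    moreover have "degree (map_poly restr r) \<le> degree r" by (rule degree_map_poly_le)
    ultimately have "map_poly restr r = 0"
      using r F(2) least[of "map_poly restr r"]
      by (cases "map_poly restr r = 0") (auto simp: good_def)
    then show ?thesis using eq' by auto
  qed
  define a where "a = lead_coeff F0"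
  have "F0 \<noteq> 0" using F0(1) by (simp add: good_def)
  then have a0: "a \<noteq> 0" by (simp add: a_def)
  have resa: "restr a = a" using F0 unfolding a_def good_def by (metis coeff_map_poly restr.hom_zero)
  have suba: "subst h a \<notin> P" using restr_zero[of a] resa a0 by auto
  have "a dvd coeff F0 i" for i
  proof -
    obtain q k where "smult (lead_coeff F0 ^ k) G1 = F0 * q"
      using division[OF F0] G1 unfolding good_def by blast
    moreover have "a ^ k \<noteq> 0" using a0 by simp
    ultimately show ?thesis unfolding a_def by (intro polynomial_ring_normal[OF lead1])
  qed
  then have "[:a:] dvd F0" by (simp add: const_poly_dvd_iff)
  then obtain F1 where F1: "F0 = smult a F1" by (auto elim: dvdE)
  define F where "F = map_poly restr F1"
  have F0F: "F0 = smult a F"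
    using F0(1) F1 resa unfolding F_def good_def by (metis restr.map_poly_hom_smult)
  have leadF: "lead_coeff F = 1"
    using arg_cong[OF F0F, of lead_coeff] a0 by (simp add: a_def[symmetric])
  have "peval z ([:a:] * F) \<in> P" using F0 F0F by (simp add: good_def)
  then have "subst h a * peval z F \<in> P" by (simp only: pev.hom_mult) (simp add: peval_pCons)
  then have pF: "peval z F \<in> P" using prime suba by blast
  have goodF: "good F" "degree F = d"
    using leadF pF F0 F0F a0 by (auto simp: good_def F_def)
  show thesis
  proof (rule that[OF leadF pF])
    fix G assume "peval z G \<in> P"
    then obtain q k where "smult (lead_coeff F ^ k) (map_poly restr G) = F * q"
      using division[OF goodF, of "map_poly restr G"] by auto
    then show "F dvd map_poly restr G" using leadF by simp
  qed
qed

end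

section \<open>Maximal ideals and lifting of points\<close>

lemma maximal_ideal_exists:
  fixes N :: "'r::comm_ring_1 set"
  assumes N: "ring_ideal N" "1 \<notin> N"
  obtains M where "ring_ideal M" "N \<subseteq> M" "1 \<notin> M" "\<forall>a. a \<notin> M \<longrightarrow> (\<exists>r. 1 - r * a \<in> M)"
proof -
  define Ids where "Ids = {I. ring_ideal I \<and> N \<subseteq> I \<and> 1 \<notin> I}"
  have "\<exists>M\<in>Ids. \<forall>J\<in>Ids. M \<subseteq> J \<longrightarrow> J = M"
  proof (rule subset_Zorn_nonempty)
    show "Ids \<noteq> {}" using N by (auto simp: Ids_def)
    fix C assume C: "C \<noteq> {}" "subset.chain Ids C"
    then have sub: "C \<subseteq> Ids" and lin: "\<And>J Z. J \<in> C \<Longrightarrow> Z \<in> C \<Longrightarrow> J \<subseteq> Z \<or> Z \<subseteq> J"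
      by (auto simp: subset_chain_def)
    have id: "ring_ideal J" if "J \<in> C" for J using that sub by (auto simp: Ids_def)
    have "ring_ideal (\<Union>C)"
    proof
      show "0 \<in> \<Union>C" using C(1) id ring_ideal.zero_mem by blast
      show "a + b \<in> \<Union>C" if ab: "a \<in> \<Union>C" "b \<in> \<Union>C" for a b
      proof -
        obtain J Z where XZ: "J \<in> C" "Z \<in> C" "a \<in> J" "b \<in> Z" using ab by blast
        show ?thesis
        proof (cases "J \<subseteq> Z")
          case True
          then have "a + b \<in> Z" using XZ by (intro ring_ideal.add_mem[OF id]) auto
          then show ?thesis using XZ by blast
        next
          case False
          then have "Z \<subseteq> J" using lin XZ by blast
          then have "a + b \<in> J" using XZ by (intro ring_ideal.add_mem[OF id]) auto
          then show ?thesis using XZ by blast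
        qed
      qed
      show "r * a \<in> \<Union>C" if "a \<in> \<Union>C" for a r
        using that id ring_ideal.mult_mem by blast
    qed
    moreover have "N \<subseteq> \<Union>C" "1 \<notin> \<Union>C" using C(1) sub by (auto simp: Ids_def)
    ultimately show "\<Union>C \<in> Ids" by (simp add: Ids_def)
  qed
  then obtain M where M: "M \<in> Ids" and max: "\<And>J. J \<in> Ids \<Longrightarrow> M \<subseteq> J \<Longrightarrow> J = M" by auto
  interpret M: ring_ideal M using M by (simp add: Ids_def)
  show thesis
  proof (rule that[of M])
    show "ring_ideal M" "N \<subseteq> M" "1 \<notin> M" using M by (auto simp: Ids_def)
    have "\<exists>r. 1 - r * a \<in> M" if a: "a \<notin> M" for a
    proof -
      define J where "J = {x. \<exists>r. x - r * a \<in> M}"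
      have "ring_ideal J"
      proof
        show "0 \<in> J" unfolding J_def by (intro CollectI exI[of _ 0]) (simp add: M.zero_mem)
        fix x z assume "x \<in> J" "z \<in> J"
        then obtain r s where "x - r * a \<in> M" "z - s * a \<in> M" by (auto simp: J_def)
        from M.add_mem[OF this] have "x + z - (r + s) * a \<in> M" by (simp add: algebra_simps)
        then show "x + z \<in> J" by (auto simp: J_def)
      next
        fix x c assume "x \<in> J"
        then obtain r where "x - r * a \<in> M" by (auto simp: J_def)
        from M.mult_mem[OF this, of c] have "c * x - (c * r) * a \<in> M" by (simp add: algebra_simps)
        then show "c * x \<in> J" by (auto simp: J_def)
      qed
      moreover have "M \<subseteq> J"
      proof
        fix x assume "x \<in> M"
        then show "x \<in> J" unfolding J_def by (intro CollectI exI[of _ 0]) simp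
      qed
      moreover have "a \<in> J"
        unfolding J_def by (intro CollectI exI[of _ 1]) (simp add: M.zero_mem)
      ultimately have "1 \<in> J" using max[of J] a M by (auto simp: Ids_def)
      then show "\<exists>r. 1 - r * a \<in> M" by (simp add: J_def)
    qed
    then show "\<forall>a. a \<notin> M \<longrightarrow> (\<exists>r. 1 - r * a \<in> M)" by blast
  qed
qed

context noether_data
begin

text \<open>
  Over \<open>\<complex>\<close> a polynomial relation splits into linear factors, one of which lies in the prime ideal.
\<close>

lemma split_into_linear:
  fixes g :: "complex poly"
  assumes "g \<noteq> 0" "poly (map_poly const_poly g) z \<in> P"
  shows "\<exists>t. z - const_poly t \<in> P"
  using assms
proof (induction "degree g" arbitrary: g rule: less_induct)
  case less
  interpret mp: map_poly_comm_ring_hom "const_poly :: complex \<Rightarrow> 'n cpoly" ..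
  show ?case
  proof (cases "degree g = 0")
    case True
    then obtain c where g: "g = [:c:]" by (auto elim: degree_eq_zeroE)
    then have c: "c \<noteq> 0" "const_poly c \<in> P" using less.prems by auto
    have "const_poly (1 / c) * const_poly c = (1 :: 'n cpoly)" using c(1) by (simp flip: cp.hom_mult)
    then show ?thesis using mult_mem[OF c(2)] one_notin by metis
  next
    case False
    then obtain t where "poly g t = 0" using fundamental_theorem_of_algebra[of g] constant_degree[of g] by auto
    then obtain q where q: "g = [:- t, 1:] * q" by (auto simp: poly_eq_0_iff_dvd elim: dvdE)
    have "poly (map_poly const_poly g) z = (z - const_poly t) * poly (map_poly const_poly q) z"
      unfolding q mp.hom_mult poly_mult
      by (simp add: cp.map_poly_pCons_hom cp.hom_uminus)
    then have "z - const_poly t \<in> P \<or> poly (map_poly const_poly q) z \<in> P"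
      using less.prems prime by metis
    moreover have "q \<noteq> 0" using less.prems q by auto
    then have "degree q < degree g" unfolding q by (subst degree_mult_eq) auto
    ultimately show ?thesis using less.hyps[OF _ \<open>q \<noteq> 0\<close>] by blast
  qed
qed

text \<open>
  Without parameters every variable is algebraic over \<open>\<complex>\<close>, hence congruent to a constant.
\<close>

lemma point_if_no_parameters:
  assumes "Y = {}"
  obtains x where "\<And>p. p - const_poly (eval_poly p x) \<in> P"
proof -
  have h0: "h = (\<lambda>_. 0)" using h_zero assms by auto
  have subst0: "subst h p = const_poly (eval_poly p 0)" for p
    unfolding h0
    by (rule cpoly_hom_unique[OF subst_hom comm_ring_hom_comp[OF const_poly_hom eval_poly_hom]])
      simp_all
  have "\<exists>t. var_poly i - const_poly t \<in> P" for i
  proof -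
    obtain G where G: "lead_coeff G = 1" "peval (var_poly i) G \<in> P" using integral_equation by blast
    define g where "g = map_poly (\<lambda>p. eval_poly p 0) G"
    have "map_poly (subst h) G = map_poly const_poly g"
      unfolding g_def by (intro poly_eqI) (simp add: coeff_map_poly subst0)
    moreover have "g \<noteq> 0"
    proof -
      have "coeff g (degree G) = 1" unfolding g_def using G(1) by (simp add: coeff_map_poly)
      then show ?thesis by auto
    qed
    ultimately show ?thesis using G(2) split_into_linear[of g "var_poly i"] by (simp add: peval_def)
  qed
  then obtain t where t: "var_poly i - const_poly (t i) \<in> P" for i by metis
  define x where "x = (\<chi> i. t i)"
  have "p - const_poly (eval_poly p x) \<in> P" for p
  proof (induction p rule: cpoly_induct)
    case (const c)
    then show ?case by (simp add: zero_mem)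
  next
    case (add p q)
    from add_mem[OF this] show ?case by (simp add: evp.hom_add cp.hom_add algebra_simps)
  next
    case (var i p)
    have "var_poly i * p - const_poly (eval_poly (var_poly i * p) x) =
      var_poly i * (p - const_poly (eval_poly p x)) + const_poly (eval_poly p x) * (var_poly i - const_poly (t i))"
      by (simp add: evp.hom_mult cp.hom_mult x_def algebra_simps)
    then show ?case using var t by (simp add: add_mem mult_mem)
  qed
  then show thesis by (rule that)
qed

end

lemma var_poly_nonzero: "var_poly j \<noteq> (0 :: 'v cpoly)"
proof
  assume "var_poly j = (0 :: 'v cpoly)"
  then have "Poly_Mapping.lookup (var_poly j :: 'v cpoly) (unit_expo j) = 0" by simp
  then show False by (simp add: var_poly_def)
qed

lemma prime_if_maximal:
  assumes "ring_ideal M" and max: "\<forall>a. a \<notin> M \<longrightarrow> (\<exists>r. 1 - r * a \<in> M)" and ab: "a * b \<in> M"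
  shows "a \<in> M \<or> b \<in> M"
proof (rule disjCI)
  interpret ring_ideal M by fact
  assume "b \<notin> M"
  then obtain r where r: "1 - r * b \<in> M" using max by blast
  have "a = a * (1 - r * b) + r * (a * b)" by (simp add: algebra_simps)
  also have "\<dots> \<in> M" by (intro add_mem mult_mem[OF r] mult_mem[OF ab])
  finally show "a \<in> M" .
qed

text \<open>
  The weak Nullstellensatz. If there were a parameter \<open>h j\<close>, it would have an inverse \<open>r\<close> modulo \<open>M\<close>.
  An integral equation of \<open>r\<close>, multiplied by a power of \<open>h j\<close>, becomes an algebraic relation \<open>p\<close>
  between the parameters that has the value \<open>1\<close> at the origin, contrary to independence.
\<close>

theorem zero_of_maximal_ideal:
  fixes M :: "'n::{finite,linorder} cpoly set"
  assumes M: "ring_ideal M" and one: "1 \<notin> M" and max: "\<forall>a. a \<notin> M \<longrightarrow> (\<exists>r. 1 - r * a \<in> M)"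
  obtains x where "\<forall>p\<in>M. eval_poly p x = 0"
proof -
  interpret poly_ideal M using M by (simp add: poly_ideal_def)
  obtain Y h W where nd: "noether_data M Y h W"
  proof (rule noether_normalization[OF one, of 0])
    fix Y h W
    assume "\<And>j. j \<notin> Y \<Longrightarrow> h j = 0" "finite W" "gen_mod h W = UNIV"
      "\<And>p. vars_in Y p \<Longrightarrow> subst h p \<in> M \<Longrightarrow> p = 0"
    then have "noether_data M Y h W"
      by unfold_locales (use one prime_if_maximal[OF M max] in auto)
    then show thesis by (rule that)
  qed
  interpret noether_data M Y h W by (rule nd)
  have "Y = {}"
  proof (rule ccontr)
    assume "Y \<noteq> {}"
    then obtain j where j: "j \<in> Y" by blast
    have "h j \<notin> M"
    proof
      assume "h j \<in> M"
      then have "restr (var_poly j) = 0" using restr_zero[of "var_poly j"] by simp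
      then have "var_poly j = (0 :: 'n cpoly)" using j by (simp add: restr_def)
      then show False by (simp add: var_poly_nonzero)
    qed
    then obtain r where r: "1 - r * h j \<in> M" using max by blast
    obtain G where G: "lead_coeff G = 1" "peval r G \<in> M" using integral_equation by blast
    define d where "d = degree G"
    define p where "p = (\<Sum>k\<le>d. coeff G k * var_poly j ^ (d - k))"
    have pw: "r ^ k * h j ^ k - 1 \<in> M" for k
    proof (induction k)
      case (Suc k)
      have "r ^ Suc k * h j ^ Suc k - 1 = (r * h j) * (r ^ k * h j ^ k - 1) - (1 - r * h j)"
        by (simp add: algebra_simps)
      also have "\<dots> \<in> M" by (rule diff_mem[OF mult_mem[OF Suc] r])
      finally show ?case .
    qed (simp add: zero_mem)
    have "subst h p - h j ^ d * peval r G \<in> M"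
    proof -
      have pr: "peval r G = (\<Sum>k\<le>d. subst h (coeff G k) * r ^ k)"
      proof -
        have "degree (map_poly (subst h) G) = d"
          unfolding d_def using G(1) by (intro degree_map_poly) auto
        then show ?thesis by (simp add: peval_def poly_altdef coeff_map_poly)
      qed
      have "subst h p - h j ^ d * peval r G =
          (\<Sum>k\<le>d. subst h (coeff G k) * h j ^ (d - k) - h j ^ d * (subst h (coeff G k) * r ^ k))"
        by (simp add: p_def pr sub.hom_sum sub.hom_mult sub.hom_power sum_distrib_left sum_subtractf)
      also have "\<dots> = (\<Sum>k\<le>d. - (subst h (coeff G k) * h j ^ (d - k)) * (r ^ k * h j ^ k - 1))"
      proof (intro sum.cong refl)
        fix k assume "k \<in> {..d}"
        then have "h j ^ d = h j ^ (d - k) * h j ^ k" by (simp flip: power_add)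
        then show "subst h (coeff G k) * h j ^ (d - k) - h j ^ d * (subst h (coeff G k) * r ^ k)
            = - (subst h (coeff G k) * h j ^ (d - k)) * (r ^ k * h j ^ k - 1)"
          by (simp add: algebra_simps)
      qed
      also have "\<dots> \<in> M" using pw by (intro sum_mem mult_mem)
      finally show ?thesis .
    qed
    then have "(subst h p - h j ^ d * peval r G) + h j ^ d * peval r G \<in> M"
      using G(2) by (intro add_mem mult_mem)
    then have "restr p = 0" by (intro restr_zero) simp
    then have "eval_poly p 0 = 0" using eval_restr[of 0 p] by (simp add: supported_def)
    moreover have "eval_poly p 0 = (\<Sum>k\<le>d. if k = d then eval_poly (coeff G d) 0 else 0)"
      unfolding p_def evp.hom_sum
      by (intro sum.cong) (auto simp: evp.hom_mult evp.hom_power power_0_left)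
    ultimately show False using G(1) by (simp add: d_def)
  qed
  then obtain x where x: "\<And>p. p - const_poly (eval_poly p x) \<in> M"
    using point_if_no_parameters by metis
  show thesis
  proof (rule that, rule ballI)
    fix p assume p: "p \<in> M"
    show "eval_poly p x = 0"
    proof (rule ccontr)
      assume c: "eval_poly p x \<noteq> 0"
      have "const_poly (eval_poly p x) \<in> M" using diff_mem[OF p x[of p]] by simp
      from mult_mem[OF this, of "const_poly (1 / eval_poly p x)"] show False
        using c one by (simp flip: cp.hom_mult)
    qed
  qed
qed

context noether_data
begin

text \<open>
  Lying over. The ideal \<open>N\<close> generated by \<open>P\<close> and by the images of all \<open>b \<in> A[T]\<close> with \<open>b(y, t) = 0\<close> is
  proper: otherwise the determinant trick yields a relation of \<open>z\<close> whose value at \<open>(y, t)\<close> is \<open>1\<close>,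
  although it is a multiple of \<open>F\<close>, which vanishes there. A zero of a maximal ideal above \<open>N\<close> is the
  required point.
\<close>

theorem lift_point:
  assumes F: "\<And>G. peval z G \<in> P \<Longrightarrow> F dvd map_poly restr G"
    and y: "supported y" and t: "neval y t F = 0"
  obtains x where "\<And>p. p \<in> P \<Longrightarrow> eval_poly p x = 0"
    "\<And>j. eval_poly (h j) x = vec_nth y j" "eval_poly z x = t"
proof -
  define N where "N = {s. \<exists>b. (\<forall>v. neval y t (b v) = 0) \<and> s - (\<Sum>v\<in>W. peval z (b v) * v) \<in> P}"
  have NI: "s \<in> N" if "\<And>v. neval y t (b v) = 0" "s - (\<Sum>v\<in>W. peval z (b v) * v) \<in> P" for s b
    using that unfolding N_def by blast
  have N_mult: "peval z b * s \<in> N" if b: "neval y t b = 0" for b s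
  proof -
    obtain a where a: "s - (\<Sum>w\<in>W. subst h (a w) * w) \<in> P" using gen_exists by blast
    show ?thesis
    proof (rule NI[of "\<lambda>v. b * [:a v:]"])
      show "neval y t (b * [:a v:]) = 0" for v by (simp only: nev.hom_mult b mult_zero_left)
      have "peval z b * s - (\<Sum>v\<in>W. peval z (b * [:a v:]) * v) = peval z b * (s - (\<Sum>w\<in>W. subst h (a w) * w))"
        by (simp only: pev.hom_mult right_diff_distrib sum_distrib_left mult.assoc)
          (simp add: peval_pCons)
      also have "\<dots> \<in> P" using a by (rule mult_mem)
      finally show "peval z b * s - (\<Sum>v\<in>W. peval z (b * [:a v:]) * v) \<in> P" .
    qed
  qed
  have N_P: "s \<in> N" if "s \<in> P" for s
    by (rule NI[of "\<lambda>_. 0"]) (use that in simp_all)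
  have N_add: "s + s' \<in> N" if ss: "s \<in> N" "s' \<in> N" for s s'
  proof -
    from ss obtain b b' where b: "\<And>v. neval y t (b v) = 0" "s - (\<Sum>v\<in>W. peval z (b v) * v) \<in> P"
      and b': "\<And>v. neval y t (b' v) = 0" "s' - (\<Sum>v\<in>W. peval z (b' v) * v) \<in> P"
      unfolding N_def by blast
    show ?thesis
    proof (rule NI[of "\<lambda>v. b v + b' v"])
      show "neval y t (b v + b' v) = 0" for v by (simp add: nev.hom_add b b')
      have "s + s' - (\<Sum>v\<in>W. peval z (b v + b' v) * v) =
          (s - (\<Sum>v\<in>W. peval z (b v) * v)) + (s' - (\<Sum>v\<in>W. peval z (b' v) * v))"
        by (simp add: pev.hom_add distrib_right sum.distrib)
      also have "\<dots> \<in> P" using b(2) b'(2) by (rule add_mem)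
      finally show "s + s' - (\<Sum>v\<in>W. peval z (b v + b' v) * v) \<in> P" .
    qed
  qed
  have N_sum: "(\<And>i. i \<in> A \<Longrightarrow> f i \<in> N) \<Longrightarrow> sum f A \<in> N" for f :: "'n cpoly \<Rightarrow> _" and A
    by (induction A rule: infinite_finite_induct) (auto simp: N_add N_P zero_mem)
  have N: "ring_ideal N"
  proof
    show "0 \<in> N" by (rule N_P) (rule zero_mem)
    show "s + s' \<in> N" if "s \<in> N" "s' \<in> N" for s s' using that by (rule N_add)
    fix s r assume "s \<in> N"
    then obtain b where b: "\<And>v. neval y t (b v) = 0" "s - (\<Sum>v\<in>W. peval z (b v) * v) \<in> P"
      unfolding N_def by blast
    have "r * s = r * (s - (\<Sum>v\<in>W. peval z (b v) * v)) + (\<Sum>v\<in>W. peval z (b v) * (r * v))"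
      by (simp add: right_diff_distrib sum_distrib_left mult.left_commute)
    also have "\<dots> \<in> N"
      by (intro N_add N_P[OF mult_mem[OF b(2)]] N_sum N_mult b(1))
    finally show "r * s \<in> N" .
  qed
  have "1 \<notin> N"
  proof
    assume one: "1 \<in> N"
    obtain w where w: "bij_betw w {..<card W} W" by (rule enum_W)
    have "\<forall>i. \<exists>b. (\<forall>v. neval y t (b v) = 0) \<and> w i - (\<Sum>v\<in>W. peval z (b v) * v) \<in> P"
      using ring_ideal.mult_mem[OF N one] unfolding N_def by simp
    then obtain b where b0: "\<And>i v. neval y t (b i v) = 0"
      and b: "\<And>i. w i - (\<Sum>v\<in>W. peval z (b i v) * v) \<in> P"
      unfolding choice_iff by blast
    define A where "A = mat (card W) (card W) (\<lambda>(i, j). (if i = j then 1 else 0) - b i (w j))"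
    have "peval z (det A) \<in> P"
    proof (rule peval_det_mem[OF _ w])
      show "A \<in> carrier_mat (card W) (card W)" by (simp add: A_def)
      fix i assume i: "i < card W"
      have "(\<Sum>j<card W. peval z (A $$ (i, j)) * w j) =
          (\<Sum>j<card W. (if i = j then w j else 0) - peval z (b i (w j)) * w j)"
        using i by (intro sum.cong) (auto simp: A_def pev.hom_minus algebra_simps pev.hom_uminus)
      also have "\<dots> = w i - (\<Sum>v\<in>W. peval z (b i v) * v)"
        using i by (simp add: sum_subtractf W_sum_nat[OF w])
      also have "\<dots> \<in> P" by (rule b)
      finally show "(\<Sum>j<card W. peval z (A $$ (i, j)) * w j) \<in> P" .
    qed
    from F[OF this] have "neval y t F dvd neval y t (map_poly restr (det A))" by (rule nev.hom_dvd)
    then have "neval y t (det A) = 0" using t by (simp add: neval_map_restr[OF y])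
    moreover have "neval y t (det A) = 1"
    proof -
      have "map_mat (neval y t) A = 1\<^sub>m (card W)"
        by (rule eq_matI) (auto simp: A_def nev.hom_minus b0 nev.hom_uminus)
      then show ?thesis using nev.hom_det[of y t A] by simp
    qed
    ultimately show False by simp
  qed
  from maximal_ideal_exists[OF N this] obtain M where M: "ring_ideal M" "N \<subseteq> M" "1 \<notin> M" "\<forall>a. a \<notin> M \<longrightarrow> (\<exists>r. 1 - r * a \<in> M)"
    by blast
  obtain x where x: "\<forall>p\<in>M. eval_poly p x = 0"
    by (rule zero_of_maximal_ideal[OF M(1,3,4)])
  have xN: "eval_poly (peval z b) x = 0" if "neval y t b = 0" for b
    using x M(2) N_mult[OF that, of 1] by auto
  show thesis
  proof (rule that)
    show "eval_poly p x = 0" if "p \<in> P" for p using x M(2) N_P[OF that] by blast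
    show "eval_poly (h j) x = vec_nth y j" for j
    proof -
      have "eval_poly (peval z [:var_poly j - const_poly (vec_nth y j):]) x = 0"
        by (rule xN) (simp add: neval_pCons evp.hom_minus)
      then show ?thesis by (simp add: peval_pCons sub.hom_minus evp.hom_minus)
    qed
    have "eval_poly (peval z [:- const_poly t, 1:]) x = 0"
      by (rule xN) (simp add: neval_pCons evp.hom_uminus)
    then show "eval_poly z x = t" by (simp add: evp.hom_minus peval_pCons sub.hom_uminus evp.hom_add evp.hom_uminus)
  qed
qed

end

section \<open>Zeros of a prime ideal near a point\<close>

text \<open>
  Up to sign, \<open>f(0)\<close> is the product of the roots.
\<close>

lemma small_root:
  fixes f :: "complex poly"
  assumes "lead_coeff f = 1" "0 \<le> e" "cmod (poly f 0) < e ^ degree f"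
  shows "\<exists>t. poly f t = 0 \<and> cmod t < e"
proof (rule ccontr)
  assume "\<nexists>t. poly f t = 0 \<and> cmod t < e"
  then have "\<And>t. poly f t = 0 \<Longrightarrow> e \<le> cmod t" by force
  with assms(1) have "e ^ degree f \<le> cmod (poly f 0)"
  proof (induction "degree f" arbitrary: f)
    case 0
    then obtain c where "f = [:c:]" by (metis degree_eq_zeroE)
    with 0 show ?case by simp
  next
    case (Suc m)
    then have "\<not> constant (poly f)" by (simp add: constant_degree)
    then obtain t where t: "poly f t = 0" using fundamental_theorem_of_algebra by blast
    then obtain g where g: "f = [:- t, 1:] * g" by (auto simp: poly_eq_0_iff_dvd elim: dvdE)
    have "g \<noteq> 0" using Suc.prems(1) g by auto
    then have deg: "degree f = Suc (degree g)" unfolding g by (subst degree_mult_eq) auto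
    have lead: "lead_coeff g = 1" using Suc.prems(1) unfolding g lead_coeff_mult by simp
    have "e ^ degree g \<le> cmod (poly g 0)"
      using Suc.hyps deg lead Suc.prems(2) by (intro Suc.hyps(1)) (auto simp: g)
    moreover have "e \<le> cmod t" using Suc.prems(2) t by blast
    ultimately have "e * e ^ degree g \<le> cmod t * cmod (poly g 0)"
      using assms(2) by (intro mult_mono) auto
    then show ?case using deg by (simp add: g norm_mult)
  qed
  then show False using assms(3) by simp
qed

lemma root_bound:
  fixes g :: "complex poly"
  assumes g: "lead_coeff g = 1" "poly g t = 0"
  shows "cmod t \<le> max 1 (\<Sum>k<degree g. cmod (coeff g k))"
proof (cases "cmod t \<le> 1")
  case False
  define d where "d = degree g"
  have "d \<noteq> 0"
  proof
    assume "d = 0"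
    then obtain c where "g = [:c:]" unfolding d_def by (metis degree_eq_zeroE)
    with g show False by simp
  qed
  have "0 = (\<Sum>k\<le>d. coeff g k * t ^ k)" using g(2) by (simp add: poly_altdef d_def)
  also have "\<dots> = (\<Sum>k<d. coeff g k * t ^ k) + t ^ d"
    using g(1) by (simp add: d_def flip: lessThan_Suc_atMost)
  finally have "t ^ d = - (\<Sum>k<d. coeff g k * t ^ k)" by (metis add.commute add_eq_0_iff)
  then have "cmod t ^ d = cmod (\<Sum>k<d. coeff g k * t ^ k)"
    by (metis norm_minus_cancel norm_power)
  also have "\<dots> \<le> (\<Sum>k<d. cmod (coeff g k) * cmod t ^ (d - 1))"
  proof (rule sum_norm_le)
    fix k assume "k \<in> {..<d}"
    then have "cmod t ^ k \<le> cmod t ^ (d - 1)" using False by (intro power_increasing) auto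
    then show "cmod (coeff g k * t ^ k) \<le> cmod (coeff g k) * cmod t ^ (d - 1)"
      by (simp add: norm_mult norm_power mult_left_mono)
  qed
  also have "\<dots> = (\<Sum>k<d. cmod (coeff g k)) * cmod t ^ (d - 1)"
    by (rule sum_distrib_right[symmetric])
  finally have "cmod t * cmod t ^ (d - 1) \<le> (\<Sum>k<d. cmod (coeff g k)) * cmod t ^ (d - 1)"
    using \<open>d \<noteq> 0\<close> by (cases d) auto
  moreover have "cmod t ^ (d - 1) > 0" using False by (intro zero_less_power) auto
  ultimately have "cmod t \<le> (\<Sum>k<d. cmod (coeff g k))" by (simp only: mult_le_cancel_right_pos)
  then show ?thesis by (simp add: d_def)
qed simp

lemma separating_polynomial:
  fixes \<xi> :: "complex^'n"
  assumes "finite S" "\<xi> \<notin> S"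
  shows "\<exists>z :: 'n::finite cpoly. eval_poly z \<xi> = 0 \<and> (\<forall>x\<in>S. eval_poly z x = 1)"
proof -
  have "\<exists>j. vec_nth x j \<noteq> vec_nth \<xi> j" if "x \<in> S" for x
  proof -
    have "x \<noteq> \<xi>" using that assms(2) by blast
    then show ?thesis by (simp add: vector_eq_iff)
  qed
  then obtain j where j: "vec_nth x (j x) \<noteq> vec_nth \<xi> (j x)" if "x \<in> S" for x
    by metis
  define q where "q x = const_poly (1 / (vec_nth \<xi> (j x) - vec_nth x (j x)))
    * (var_poly (j x) - const_poly (vec_nth x (j x)))" for x
  have "eval_poly (q x) \<xi> = 1" "eval_poly (q x) x = 0" if "x \<in> S" for x
    using j[OF that] by (auto simp: q_def evp.hom_mult evp.hom_minus)
  then have "eval_poly (1 - (\<Prod>x\<in>S. q x)) \<xi> = 0" "\<forall>x\<in>S. eval_poly (1 - (\<Prod>x\<in>S. q x)) x = 1"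
    using assms(1) by (auto simp: evp.hom_minus evp.hom_prod prod_zero_iff)
  then show ?thesis by blast
qed

lemma finite_vectors:
  fixes R :: "'n::finite \<Rightarrow> 'a set"
  assumes "\<And>i. finite (R i)"
  shows "finite {x :: 'a^'n. \<forall>i. vec_nth x i \<in> R i}"
proof (rule finite_imageD)
  have "vec_nth ` {x :: 'a^'n. \<forall>i. vec_nth x i \<in> R i} \<subseteq> PiE UNIV R" by (auto simp: PiE_def)
  moreover have "finite (PiE UNIV R)" using assms by (intro finite_PiE) auto
  ultimately show "finite (vec_nth ` {x :: 'a^'n. \<forall>i. vec_nth x i \<in> R i})"
    by (rule finite_subset)
  show "inj_on vec_nth {x :: 'a^'n. \<forall>i. vec_nth x i \<in> R i}"
    by (auto simp: inj_on_def vec_nth_inject)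
qed

context noether_data
begin

definition zeros :: "('n cvec) set" where
  "zeros = {x. \<forall>p\<in>P. eval_poly p x = 0}"

definition params :: "'n cvec \<Rightarrow> 'n cvec" where
  "params x = (\<chi> j. eval_poly (h j) x)"

lemma neval_zero: "x \<in> zeros \<Longrightarrow> peval z G \<in> P \<Longrightarrow> neval (params x) (eval_poly z x) G = 0"
  by (metis (mono_tags, lifting) eval_peval mem_Collect_eq params_def zeros_def)

lemma lead_coeff_map_eval:
  assumes "lead_coeff G = 1"
  shows "lead_coeff (map_poly (\<lambda>p. eval_poly p y) G) = 1" "degree (map_poly (\<lambda>p. eval_poly p y) G) = degree G"
proof -
  show deg: "degree (map_poly (\<lambda>p. eval_poly p y) G) = degree G"
    using assms by (intro degree_map_poly) auto
  show "lead_coeff (map_poly (\<lambda>p. eval_poly p y) G) = 1"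
    unfolding deg using assms by (simp add: coeff_map_poly)
qed

text \<open>
  Each coordinate is a root of an integral equation whose coefficients are determined by \<open>y\<close>.
\<close>

lemma finite_fibre: "finite {x \<in> zeros. params x = y}"
proof -
  define G where "G i = (SOME G. lead_coeff G = 1 \<and> peval (var_poly i) G \<in> P)" for i
  have G: "lead_coeff (G i) = 1" "peval (var_poly i) (G i) \<in> P" for i
    using someI_ex[OF integral_equation[of "var_poly i"]] by (simp_all add: G_def)
  define R where "R i = {t. poly (map_poly (\<lambda>p. eval_poly p y) (G i)) t = 0}" for i
  have "finite (R i)" for i
  proof -
    have "map_poly (\<lambda>p. eval_poly p y) (G i) \<noteq> 0"
      using lead_coeff_map_eval(1)[OF G(1), of y i] by (metis leading_coeff_0_iff zero_neq_one)
    then show ?thesis unfolding R_def by (rule poly_roots_finite)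
  qed
  then have "finite {x. \<forall>i. vec_nth x i \<in> R i}" by (rule finite_vectors)
  moreover have "{x \<in> zeros. params x = y} \<subseteq> {x. \<forall>i. vec_nth x i \<in> R i}"
    using neval_zero[OF _ G(2)] by (auto simp: R_def neval_def)
  ultimately show ?thesis by (rule finite_subset[rotated])
qed

text \<open>
  Evaluation at \<open>\<xi>\<close> shows that the constant coefficient of the minimal polynomial \<open>F\<close> of \<open>z\<close> vanishes
  at the origin of the parameter space. It is small at nearby parameters \<open>y \<noteq> 0\<close>, so \<open>F\<close> has a small
  root there, which lifts to a zero. This zero is not \<open>\<xi>\<close> because its parameters are not zero.
\<close>

lemma zeros_with_small_values:
  assumes \<xi>: "\<xi> \<in> zeros" "params \<xi> = 0" and Y: "Y \<noteq> {}" and z: "eval_poly z \<xi> = 0" and e: "e > 0"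
  shows "\<exists>x\<in>zeros. x \<noteq> \<xi> \<and> (\<forall>j. cmod (eval_poly (h j) x) < e) \<and> cmod (eval_poly z x) < e"
proof -
  obtain F where F: "lead_coeff F = 1" "peval z F \<in> P"
    and div: "\<And>G. peval z G \<in> P \<Longrightarrow> F dvd map_poly restr G"
    by (rule minimal_polynomial[of z]) (rule that)
  obtain j0 where j0: "j0 \<in> Y" using Y by blast
  define v :: "'n cvec" where "v = (\<chi> j. if j = j0 then 1 else 0)"
  let ?c = "poly (line 0 v (coeff F 0))"
  have c0: "?c 0 = 0"
  proof -
    have "neval 0 0 F = 0" using neval_zero[OF \<xi>(1) F(2)] \<xi>(2) z by simp
    then have "eval_poly (coeff F 0) 0 = 0"
      by (simp add: neval_def poly_0_coeff_0 coeff_map_poly)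
    then show ?thesis by (simp add: poly_line vec_lambda_0)
  qed
  have "isCont ?c 0" by simp
  then obtain d where d: "d > 0" "\<And>s. dist s 0 < d \<Longrightarrow> dist (?c s) (?c 0) < e ^ degree F"
    using e unfolding continuous_at_eps_delta by (metis zero_less_power)
  define s :: complex where "s = of_real (min d e / 2)"
  have s: "cmod s < d" "cmod s < e" "s \<noteq> 0" using d(1) e by (auto simp: s_def)
  define y :: "'n cvec" where "y = (\<chi> j. s * vec_nth v j)"
  have y: "supported y" using j0 by (auto simp: supported_def y_def v_def)
  let ?f = "map_poly (\<lambda>p. eval_poly p y) F"
  have "poly ?f 0 = ?c s"
    by (simp add: poly_0_coeff_0 coeff_map_poly poly_line y_def)
  then have "cmod (poly ?f 0) < e ^ degree ?f"
    using d(2)[of s] s c0 by (simp add: lead_coeff_map_eval[OF F(1)])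
  then obtain t where t: "poly ?f t = 0" "cmod t < e"
    using small_root[OF lead_coeff_map_eval(1)[OF F(1)], of e y] e by auto
  have "neval y t F = 0" using t(1) by (simp add: neval_def)
  obtain x where x: "\<And>p. p \<in> P \<Longrightarrow> eval_poly p x = 0"
    "\<And>j. eval_poly (h j) x = vec_nth y j" "eval_poly z x = t"
  proof (rule lift_point[of z F y t])
    show "F dvd map_poly restr G" if "peval z G \<in> P" for G using that by (rule div)
    show "supported y" "neval y t F = 0" by fact+
    fix x
    assume "\<And>p. p \<in> P \<Longrightarrow> eval_poly p x = 0" "\<And>j. eval_poly (h j) x = vec_nth y j" "eval_poly z x = t"
    then show thesis by (rule that)
  qed
  have "x \<noteq> \<xi>"
  proof
    assume "x = \<xi>"
    moreover have "eval_poly (h j0) \<xi> = 0"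
      using \<xi>(2) by (simp add: params_def vector_eq_iff)
    ultimately have "vec_nth y j0 = 0" using x(2)[of j0] by simp
    then show False using s by (simp add: y_def v_def)
  qed
  moreover have "cmod (vec_nth y j) < e" for j using s e by (simp add: y_def v_def)
  ultimately show ?thesis using x t by (intro bexI[of _ x]) (auto simp: zeros_def)
qed

lemma tendsto_eval_poly: "u \<longlonglongrightarrow> l \<Longrightarrow> (\<lambda>n. eval_poly p (u n)) \<longlonglongrightarrow> eval_poly p l"
  using continuous_eval_poly[of p] by (rule continuous_on_tendsto_compose) auto

text \<open>
  Each coordinate is a root of a monic polynomial whose coefficients converge.
\<close>

lemma bounded_zeros:
  assumes x: "\<And>n::nat. x n \<in> zeros" and lim: "(\<lambda>n. params (x n)) \<longlonglongrightarrow> y"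
  shows "bounded (range x)"
proof -
  have "\<exists>B. \<forall>n. cmod (vec_nth (x n) i) \<le> B" for i
  proof -
    obtain G where G: "lead_coeff G = 1" "peval (var_poly i) G \<in> P"
      using integral_equation[of "var_poly i"] by blast
    let ?b = "\<lambda>n. max 1 (\<Sum>k<degree G. cmod (eval_poly (coeff G k) (params (x n))))"
    have "?b \<longlonglongrightarrow> max 1 (\<Sum>k<degree G. cmod (eval_poly (coeff G k) y))"
      by (intro tendsto_max tendsto_const tendsto_sum tendsto_norm tendsto_eval_poly lim)
    then have "Bseq ?b" by (intro convergent_imp_Bseq) (auto simp: convergent_def)
    then obtain B where B: "\<And>n. norm (?b n) \<le> B" unfolding Bseq_def by blast
    have "cmod (vec_nth (x n) i) \<le> B" for n
    proof -
      have "neval (params (x n)) (vec_nth (x n) i) G = 0" using neval_zero[OF x G(2)] by simp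
      then have "cmod (vec_nth (x n) i) \<le> ?b n"
        using root_bound[OF lead_coeff_map_eval(1)[OF G(1)], of "params (x n)" "vec_nth (x n) i"]
        by (simp add: neval_def lead_coeff_map_eval(2)[OF G(1)] coeff_map_poly)
      also have "\<dots> \<le> B" using B[of n] by simp
      finally show ?thesis .
    qed
    then show ?thesis by blast
  qed
  then obtain B where B: "\<And>i n. cmod (vec_nth (x n) i) \<le> B i" by metis
  have "norm (x n) \<le> (\<Sum>i\<in>UNIV. B i)" for n
  proof -
    have "norm (x n) \<le> (\<Sum>i\<in>UNIV. norm (vec_nth (x n) i))"
      unfolding norm_vec_def by (rule L2_set_le_sum) simp
    also have "\<dots> \<le> (\<Sum>i\<in>UNIV. B i)" by (intro sum_mono B)
    finally show ?thesis .
  qed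
  then show ?thesis by (auto simp: bounded_iff)
qed

text \<open>
  The polynomial \<open>z\<close> separates \<open>\<xi>\<close> from the other zeros over the origin. Hence zeros whose parameters
  and whose value of \<open>z\<close> tend to \<open>0\<close> can only accumulate at \<open>\<xi>\<close>.
\<close>

theorem zeros_near:
  assumes \<xi>: "\<xi> \<in> zeros" "params \<xi> = 0" and Y: "Y \<noteq> {}" and e: "e > 0"
  shows "\<exists>x\<in>zeros. x \<noteq> \<xi> \<and> dist x \<xi> < e"
proof -
  have "finite ({x \<in> zeros. params x = 0} - {\<xi>})" using finite_fibre by simp
  then obtain z where z: "eval_poly z \<xi> = 0" "\<And>x. x \<in> zeros \<Longrightarrow> params x = 0 \<Longrightarrow> x \<noteq> \<xi> \<Longrightarrow> eval_poly z x = 1"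
    using separating_polynomial[of "{x \<in> zeros. params x = 0} - {\<xi>}" \<xi>] by auto
  have "\<forall>n::nat. \<exists>x. x \<in> zeros \<and> x \<noteq> \<xi> \<and> (\<forall>j. cmod (eval_poly (h j) x) < inverse (of_nat (Suc n)))
      \<and> cmod (eval_poly z x) < inverse (of_nat (Suc n))"
    using zeros_with_small_values[OF \<xi> Y z(1)] by (auto simp: Bex_def simp del: of_nat_Suc)
  then obtain x where x: "\<And>n. x n \<in> zeros" "\<And>n. x n \<noteq> \<xi>"
    "\<And>n j. cmod (eval_poly (h j) (x n)) < inverse (of_nat (Suc n))"
    "\<And>n. cmod (eval_poly z (x n)) < inverse (of_nat (Suc n))"
    unfolding choice_iff by blast
  have lim0: "f \<longlonglongrightarrow> 0" if "\<And>n. cmod (f n) < inverse (of_nat (Suc n))" for f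
    by (rule Lim_null_comparison[OF _ LIMSEQ_inverse_real_of_nat])
      (intro always_eventually allI less_imp_le that)
  have params0: "(\<lambda>n. params (x n)) \<longlonglongrightarrow> 0"
    by (rule vec_tendstoI) (use lim0[OF x(3)] in \<open>simp add: params_def\<close>)
  obtain l r where r: "strict_mono r" "(x \<circ> r) \<longlonglongrightarrow> l"
    using bounded_imp_convergent_subsequence[OF bounded_zeros[OF x(1) params0]] by blast
  have eval_l: "eval_poly p l = 0" if "(\<lambda>n. eval_poly p (x n)) \<longlonglongrightarrow> 0" for p
  proof -
    have "(\<lambda>n. eval_poly p ((x \<circ> r) n)) \<longlonglongrightarrow> 0"
      using LIMSEQ_subseq_LIMSEQ[OF that r(1)] by (simp add: comp_def)
    with tendsto_eval_poly[OF r(2)] show ?thesis by (rule LIMSEQ_unique)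
  qed
  have "l \<in> zeros"
    using x(1) by (auto simp: zeros_def intro!: eval_l)
  moreover have "params l = 0"
    using eval_l[OF lim0[OF x(3)]] by (simp add: params_def vector_eq_iff)
  moreover have "eval_poly z l = 0" using lim0[OF x(4)] by (rule eval_l)
  ultimately have "l = \<xi>" using z(2)[of l] by (cases "l = \<xi>") auto
  then obtain n where "dist ((x \<circ> r) n) \<xi> < e"
    using r(2) e unfolding lim_sequentially by blast
  then show ?thesis using x(1,2) by (intro bexI[of _ "x (r n)"]) auto
qed

end

text \<open>
  There is at least one parameter, since otherwise \<open>P\<close> would be the ideal of a point.
\<close>

theorem zeros_near_point_of_prime_ideal:
  fixes P :: "'n::{finite,linorder} cpoly set"
  assumes P: "ring_ideal P" and prime: "\<And>a b. a * b \<in> P \<Longrightarrow> a \<in> P \<or> b \<in> P"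
    and sub: "P \<subset> point_ideal \<xi>" and e: "e > 0"
  shows "\<exists>x. (\<forall>p\<in>P. eval_poly p x = 0) \<and> x \<noteq> \<xi> \<and> dist x \<xi> < e"
proof -
  interpret poly_ideal P using P by (simp add: poly_ideal_def)
  have one: "1 \<notin> P" using sub by (auto simp: point_ideal_def)
  obtain Y h W where nd: "noether_data P Y h W" and h\<xi>: "\<forall>j. eval_poly (h j) \<xi> = 0"
  proof (rule noether_normalization[OF one, of \<xi>])
    fix Y h W
    assume "\<And>j. j \<notin> Y \<Longrightarrow> h j = 0" "finite W" "gen_mod h W = UNIV"
      "\<And>p. vars_in Y p \<Longrightarrow> subst h p \<in> P \<Longrightarrow> p = 0" and h\<xi>: "\<And>j. eval_poly (h j) \<xi> = 0"
    then have nd: "noether_data P Y h W"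
      by unfold_locales (use one prime in auto)
    have "\<forall>j. eval_poly (h j) \<xi> = 0" by (intro allI h\<xi>)
    with nd show thesis by (rule that)
  qed
  interpret noether_data P Y h W by (rule nd)
  have \<xi>: "\<xi> \<in> zeros" using sub by (auto simp: zeros_def point_ideal_def)
  have "Y \<noteq> {}"
  proof
    assume "Y = {}"
    then obtain x where x: "\<And>p. p - const_poly (eval_poly p x) \<in> P"
      using point_if_no_parameters by metis
    have "p \<in> P" if "p \<in> point_ideal \<xi>" for p
    proof -
      have "eval_poly (p - const_poly (eval_poly p x)) \<xi> = 0" using x[of p] \<xi> by (simp add: zeros_def)
      then have "eval_poly p x = 0" using that by (simp add: evp.hom_minus point_ideal_def)
      then show ?thesis using x[of p] by (simp add: const_poly_def)
    qed
    then show False using sub by blast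
  qed
  moreover have "params \<xi> = 0"
    using h\<xi> by (simp add: params_def vector_eq_iff)
  ultimately show ?thesis using zeros_near[OF \<xi> _ _ e] by (auto simp: zeros_def)
qed

section \<open>The primary component of an isolated zero\<close>

lemma ring_ideal_if_ideal:
  assumes "ideal J (ring_of_type_algebra :: 'a::comm_ring_1 ring)"
  shows "ring_ideal J"
proof -
  interpret ideal J "ring_of_type_algebra :: 'a ring" by fact
  show ?thesis
    using additive_subgroup.zero_closed[OF ideal.axioms(1)[OF assms]]
      additive_subgroup.a_closed[OF ideal.axioms(1)[OF assms]] ideal.I_l_closed[OF assms]
    by unfold_locales (auto simp: ring_of_type_algebra_def)
qed

lemma ideal_if_ring_ideal:
  assumes "ring_ideal J"
  shows "ideal J (ring_of_type_algebra :: 'a::comm_ring_1 ring)"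
proof -
  interpret ring_ideal J by fact
  interpret R: cring "ring_of_type_algebra :: 'a ring" by (rule cring_from_type_algebra)
  have inv: "\<ominus>\<^bsub>ring_of_type_algebra\<^esub> a = - a" for a :: 'a
    by (rule R.minus_equality) (auto simp: ring_of_type_algebra_def)
  have "subgroup J (add_monoid (ring_of_type_algebra :: 'a ring))"
    using add_mem zero_mem uminus_mem inv
    by (intro R.add.subgroupI) (auto simp: ring_of_type_algebra_def a_inv_def)
  then show ?thesis
    using mult_mem mult_mem'
    by (intro idealI) (auto simp: ring_of_type_algebra_def intro: R.ring_axioms[unfolded ring_of_type_algebra_def])
qed

lemma genideal_type_self:
  "S \<subseteq> genideal (ring_of_type_algebra :: 'a::comm_ring_1 ring) S"
proof -
  interpret R: cring "ring_of_type_algebra :: 'a ring" by (rule cring_from_type_algebra)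
  show ?thesis by (rule R.genideal_self) (simp add: ring_of_type_algebra_def)
qed

lemma genideal_type_minimal:
  assumes "ring_ideal J" "S \<subseteq> J"
  shows "genideal (ring_of_type_algebra :: 'a::comm_ring_1 ring) S \<subseteq> J"
proof -
  interpret R: cring "ring_of_type_algebra :: 'a ring" by (rule cring_from_type_algebra)
  show ?thesis by (rule R.genideal_minimal[OF ideal_if_ring_ideal[OF assms(1)] assms(2)])
qed

lemma ring_ideal_radical:
  assumes "ring_ideal J"
  shows "ring_ideal (ideal_radical J)"
proof -
  interpret ring_ideal J by fact
  show ?thesis
  proof
    show "0 \<in> ideal_radical J"
      unfolding ideal_radical_def by (intro CollectI exI[of _ 1]) (simp add: zero_mem)
    fix a b assume "a \<in> ideal_radical J" "b \<in> ideal_radical J"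
    then obtain m k where mk: "a ^ m \<in> J" "b ^ k \<in> J" by (auto simp: ideal_radical_def)
    have "of_nat (m + k choose i) * a ^ i * b ^ (m + k - i) \<in> J" if "i \<le> m + k" for i
    proof (cases "m \<le> i")
      case True
      then have "a ^ i = a ^ m * a ^ (i - m)" by (simp flip: power_add)
      then show ?thesis using mult_mem'[OF mk(1)] by (simp add: mult.assoc mult_mem mult_mem')
    next
      case False
      then have "b ^ (m + k - i) = b ^ (m - i) * b ^ k" by (simp flip: power_add)
      then show ?thesis using mult_mem[OF mk(2)] by (simp add: mult_mem)
    qed
    then have "(a + b) ^ (m + k) \<in> J" unfolding binomial_ring by (intro sum_mem) auto
    then show "a + b \<in> ideal_radical J" by (auto simp: ideal_radical_def)
  next
    fix a r assume "a \<in> ideal_radical J"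
    then obtain m where "a ^ m \<in> J" by (auto simp: ideal_radical_def)
    from mult_mem[OF this, of "r ^ m"] have "(r * a) ^ m \<in> J" by (simp add: power_mult_distrib)
    then show "r * a \<in> ideal_radical J" by (auto simp: ideal_radical_def)
  qed
qed

lemma primary_radical_prime:
  assumes "primary_ideal J" "a * b \<in> ideal_radical J"
  shows "a \<in> ideal_radical J \<or> b \<in> ideal_radical J"
proof -
  from assms(2) obtain m where "a ^ m * b ^ m \<in> J" by (auto simp: ideal_radical_def power_mult_distrib)
  with assms(1) have "a ^ m \<in> J \<or> b ^ m \<in> ideal_radical J" by (simp add: primary_ideal_def)
  then show ?thesis
  proof
    assume "b ^ m \<in> ideal_radical J"
    then obtain k where "(b ^ m) ^ k \<in> J" by (auto simp: ideal_radical_def)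
    then have "b ^ (m * k) \<in> J" by (simp add: power_mult)
    then show ?thesis by (auto simp: ideal_radical_def)
  qed (auto simp: ideal_radical_def)
qed

text \<open>
  If another component were contained in the ideal of \<open>\<xi>\<close>, its radical would be a prime ideal
  strictly below that ideal, with zeros accumulating at \<open>\<xi>\<close>. So every other component has an
  element that does not vanish at \<open>\<xi>\<close>, and the product of these elements carries \<open>Q\<close> into all
  components.
\<close>

theorem primary_component_local:
  fixes f :: "nat \<Rightarrow> 'n::{finite,linorder} cpoly"
  assumes iso: "\<xi> isolated_in {z. \<forall>k<N. eval_poly (f k) z = 0}"
    and comp: "primary_component_at \<xi> (genideal ring_of_type_algebra (f ` {..<N})) Q"
  shows "ring_ideal Q" "\<And>k. k < N \<Longrightarrow> f k \<in> Q"
    "\<And>q. q \<in> Q \<Longrightarrow> \<exists>g. eval_poly g \<xi> \<noteq> 0 \<and> g * q \<in> genideal ring_of_type_algebra (f ` {..<N})"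
proof -
  let ?I = "genideal ring_of_type_algebra (f ` {..<N})"
  from comp obtain Qs where Qs: "minimal_primary_decomposition ?I Qs" "Q \<in> Qs"
      "ideal_radical Q = point_ideal \<xi>"
    by (auto simp: primary_component_at_def)
  then have fin: "finite Qs" and prim: "\<And>J. J \<in> Qs \<Longrightarrow> primary_ideal J" and Int: "\<Inter>Qs = ?I"
    and inj: "inj_on ideal_radical Qs"
    by (auto simp: minimal_primary_decomposition_def)
  have id: "ring_ideal J" if "J \<in> Qs" for J
    using prim[OF that] ring_ideal_if_ideal by (auto simp: primary_ideal_def)
  show "ring_ideal Q" using id Qs by blast
  have f: "f k \<in> J" if "k < N" "J \<in> Qs" for k J
    using genideal_type_self[of "f ` {..<N}"] that Int by blast
  show "f k \<in> Q" if "k < N" for k using f[OF that Qs(2)] .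
  have "\<exists>g\<in>J. eval_poly g \<xi> \<noteq> 0" if J: "J \<in> Qs" "J \<noteq> Q" for J
  proof (rule ccontr)
    assume "\<not> (\<exists>g\<in>J. eval_poly g \<xi> \<noteq> 0)"
    then have "ideal_radical J \<subseteq> point_ideal \<xi>"
      by (auto simp: ideal_radical_def point_ideal_def evp.hom_power)
    moreover have "ideal_radical J \<noteq> point_ideal \<xi>"
      using inj J Qs(2,3) by (metis inj_onD)
    ultimately have sub: "ideal_radical J \<subset> point_ideal \<xi>" by blast
    from iso obtain T where T: "open T" "T \<inter> {z. \<forall>k<N. eval_poly (f k) z = 0} = {\<xi>}"
      by (auto simp: isolated_in_def)
    then have "\<xi> \<in> T" by blast
    with T(1) obtain e where e: "e > 0" "ball \<xi> e \<subseteq> T" by (meson open_contains_ball)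
    obtain x where x: "\<forall>p\<in>ideal_radical J. eval_poly p x = 0" "x \<noteq> \<xi>" "dist x \<xi> < e"
      using zeros_near_point_of_prime_ideal[OF ring_ideal_radical[OF id[OF J(1)]]
          primary_radical_prime[OF prim[OF J(1)]] sub e(1)] by auto
    have "eval_poly (f k) x = 0" if "k < N" for k
    proof -
      have "f k ^ 1 \<in> J" using f[OF that J(1)] by simp
      then show ?thesis using x(1) unfolding ideal_radical_def by blast
    qed
    moreover have "x \<in> T" using x(3) e(2) by (auto simp: dist_commute)
    ultimately show False using T(2) x(2) by auto
  qed
  then obtain g where g: "\<And>J. J \<in> Qs - {Q} \<Longrightarrow> g J \<in> J" "\<And>J. J \<in> Qs - {Q} \<Longrightarrow> eval_poly (g J) \<xi> \<noteq> 0"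
    by (metis DiffE singletonI)
  fix q assume q: "q \<in> Q"
  let ?g = "\<Prod>J\<in>Qs - {Q}. g J"
  have "?g * q \<in> J" if J: "J \<in> Qs" for J
  proof (cases "J = Q")
    case True
    then show ?thesis using q ring_ideal.mult_mem[OF id[OF Qs(2)]] by blast
  next
    case False
    then have "?g = (\<Prod>J\<in>Qs - {Q} - {J}. g J) * g J"
      using J fin by (subst prod.remove[of _ J]) (auto simp: mult.commute)
    then show ?thesis
      using ring_ideal.mult_mem'[OF id[OF J] ring_ideal.mult_mem[OF id[OF J] g(1)]] J False by auto
  qed
  moreover have "eval_poly ?g \<xi> \<noteq> 0" using g(2) fin by (simp add: evp.hom_prod)
  ultimately show "\<exists>g. eval_poly g \<xi> \<noteq> 0 \<and> g * q \<in> ?I" using Int by blast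
qed

section \<open>Taylor expansion\<close>

lemma partial_deriv_single:
  "partial_deriv i (Poly_Mapping.single \<gamma> c) =
    Poly_Mapping.single (\<gamma> - unit_expo i) (of_nat (Poly_Mapping.lookup \<gamma> i) * c)"
  by (cases "c = 0") (simp_all add: partial_deriv_def)

lemma partial_deriv_add: "partial_deriv i (p + q) = partial_deriv i p + partial_deriv i q"
  unfolding partial_deriv_def
  by (rule setsum_keys_plus_distrib[of "\<lambda>\<gamma> c. Poly_Mapping.single (\<gamma> - unit_expo i)
        (of_nat (Poly_Mapping.lookup \<gamma> i) * c)"]) (simp_all add: distrib_left single_add)

lemma partial_deriv_const_mult: "partial_deriv i (const_poly c * p) = const_poly c * partial_deriv i p"
proof (induction p rule: cpoly_induct_single)
  case (single \<gamma> d)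
  then show ?case by (simp add: const_poly_def mult_single partial_deriv_single mult.left_commute)
qed (simp add: distrib_left partial_deriv_add)

lemma partial_deriv_var_mult:
  "partial_deriv i (var_poly j * p) = (if i = j then p else 0) + var_poly j * partial_deriv i p"
proof (induction p rule: cpoly_induct_single)
  case (single \<gamma> c)
  show ?case
  proof (cases "i = j")
    case True
    have "\<gamma> + unit_expo i - unit_expo i = \<gamma>" by simp
    moreover have "unit_expo i + (\<gamma> - unit_expo i) = \<gamma>" if "Poly_Mapping.lookup \<gamma> i \<noteq> 0"
      using expo_split[of i \<gamma>] that by (simp add: in_keys_iff add.commute)
    ultimately show ?thesis using True
      by (cases "Poly_Mapping.lookup \<gamma> i = 0")
        (simp_all add: var_poly_def mult_single partial_deriv_single lookup_add unit_expo_lookup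
          distrib_right add.commute[of _ \<gamma>] flip: single_add)
  next
    case False
    have "unit_expo j + \<gamma> - unit_expo i = unit_expo j + (\<gamma> - unit_expo i)"
      using False by (intro poly_mapping_eqI) (auto simp: lookup_add lookup_minus unit_expo_lookup)
    then show ?thesis using False
      by (simp add: var_poly_def mult_single partial_deriv_single lookup_add unit_expo_lookup)
  qed
qed (simp add: distrib_left partial_deriv_add)

text \<open>
  The falling factorial \<open>n (n - 1) \<dots> (n - k + 1)\<close>, which is zero for \<open>k > n\<close>; truncated subtraction is
  harmless because the factor \<open>n - n\<close> occurs in that case.
\<close>

definition falling :: "nat \<Rightarrow> nat \<Rightarrow> complex" where
  "falling n k = (\<Prod>l<k. of_nat (n - l))"

lemma falling_self: "falling n n = fact n"
  unfolding falling_def fact_prod_rev by (simp add: atLeast0LessThan)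

lemma falling_zero: "n < k \<Longrightarrow> falling n k = 0"
  unfolding falling_def by (rule prod_zero) (auto intro!: bexI[of _ n])

abbreviation shift :: "complex^'n \<Rightarrow> 'n::finite \<Rightarrow> 'n cpoly" where
  "shift \<xi> i \<equiv> var_poly i - const_poly (vec_nth \<xi> i)"

lemma shifted_monom_eq: "shifted_monom \<xi> \<gamma> = mono_ev (shift \<xi>) \<gamma>"
  by (simp add: shifted_monom_def mono_ev_superset[of UNIV])

lemma partial_deriv_shift_mult:
  "partial_deriv i (shift \<xi> j * p) = (if i = j then p else 0) + shift \<xi> j * partial_deriv i p"
proof -
  have "shift \<xi> j * p = var_poly j * p + const_poly (- vec_nth \<xi> j) * p"
    by (simp add: const_poly_def single_uminus algebra_simps)
  then show ?thesis
    by (simp only: partial_deriv_add partial_deriv_var_mult partial_deriv_const_mult)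
      (simp add: const_poly_def single_uminus algebra_simps)
qed

lemma partial_deriv_monom:
  "partial_deriv i (mono_ev (shift \<xi>) \<gamma>)
    = const_poly (of_nat (Poly_Mapping.lookup \<gamma> i)) * mono_ev (shift \<xi>) (\<gamma> - unit_expo i)"
proof (induction \<gamma> rule: expo_induct)
  case zero
  show ?case using partial_deriv_single[of i 0 1] by (simp add: const_poly_def)
next
  case (step \<gamma> j)
  have eq: "partial_deriv i (mono_ev (shift \<xi>) (\<gamma> + unit_expo j)) = (if i = j then mono_ev (shift \<xi>) \<gamma> else 0)
      + const_poly (of_nat (Poly_Mapping.lookup \<gamma> i)) * (shift \<xi> j * mono_ev (shift \<xi>) (\<gamma> - unit_expo i))"
    by (simp only: mono_ev_add mono_ev_unit mult.commute[of _ "shift \<xi> j"] partial_deriv_shift_mult step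
        mult.left_commute)
  show ?case
  proof (cases "i = j")
    case True
    have "shift \<xi> i * mono_ev (shift \<xi>) (\<gamma> - unit_expo i) = mono_ev (shift \<xi>) \<gamma>"
      if "Poly_Mapping.lookup \<gamma> i \<noteq> 0"
      using arg_cong[OF expo_split[of i \<gamma>], of "mono_ev (shift \<xi>)"] that
      by (simp add: in_keys_iff mono_ev_add mult.commute)
    then show ?thesis unfolding eq using True
      by (cases "Poly_Mapping.lookup \<gamma> i = 0")
        (simp_all add: lookup_add unit_expo_lookup const_poly_def single_add distrib_right)
  next
    case False
    have "\<gamma> + unit_expo j - unit_expo i = (\<gamma> - unit_expo i) + unit_expo j"
      using False by (intro poly_mapping_eqI) (auto simp: lookup_add lookup_minus unit_expo_lookup)
    then show ?thesis unfolding eq using False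
      by (simp add: lookup_add unit_expo_lookup mono_ev_add mult.commute)
  qed
qed

lemma partial_deriv_funpow_monom:
  "(partial_deriv i ^^ k) (const_poly c * mono_ev (shift \<xi>) \<gamma>)
    = const_poly (c * falling (Poly_Mapping.lookup \<gamma> i) k) * mono_ev (shift \<xi>) (\<gamma> - Poly_Mapping.single i k)"
proof (induction k)
  case (Suc k)
  have "\<gamma> - Poly_Mapping.single i k - unit_expo i = \<gamma> - Poly_Mapping.single i (Suc k)"
    by (intro poly_mapping_eqI) (simp add: lookup_minus unit_expo_lookup lookup_single when_def)
  then show ?case
    by (simp add: Suc partial_deriv_const_mult partial_deriv_monom lookup_minus falling_def
        cp.hom_mult mult.assoc)
qed (simp add: falling_def)

lemma partial_derivs_list_monom:
  assumes "distinct xs"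
  shows "foldr (\<lambda>i. partial_deriv i ^^ Poly_Mapping.lookup \<beta> i) xs (mono_ev (shift \<xi>) \<gamma>)
    = const_poly (\<Prod>i\<in>set xs. falling (Poly_Mapping.lookup \<gamma> i) (Poly_Mapping.lookup \<beta> i))
      * mono_ev (shift \<xi>) (\<gamma> - (\<Sum>i\<in>set xs. Poly_Mapping.single i (Poly_Mapping.lookup \<beta> i)))"
  using assms
proof (induction xs)
  case Nil
  show ?case by (simp add: const_poly_def)
next
  case (Cons x xs)
  let ?s = "\<Sum>i\<in>set xs. Poly_Mapping.single i (Poly_Mapping.lookup \<beta> i)"
  have "Poly_Mapping.lookup ?s x = 0"
    using Cons.prems by (auto simp: lookup_sum lookup_single when_def intro!: sum.neutral)
  moreover have "\<gamma> - ?s - Poly_Mapping.single x (Poly_Mapping.lookup \<beta> x)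
      = \<gamma> - (Poly_Mapping.single x (Poly_Mapping.lookup \<beta> x) + ?s)"
    by (simp add: add.commute diff_diff_add)
  ultimately show ?case
    using Cons by (simp add: partial_deriv_funpow_monom lookup_minus mult.commute)
qed

lemma partial_derivs_monom:
  "eval_poly (partial_derivs \<beta> (mono_ev (shift \<xi>) \<gamma>)) \<xi> = (if \<beta> = \<gamma> then expo_fact \<beta> else 0)"
proof -
  have "(\<Sum>i\<in>UNIV. Poly_Mapping.single i (Poly_Mapping.lookup \<beta> i)) = \<beta>"
    by (intro poly_mapping_eqI) (simp add: lookup_sum lookup_single when_def)
  then have eq: "partial_derivs \<beta> (mono_ev (shift \<xi>) \<gamma>) =
      const_poly (\<Prod>i\<in>UNIV. falling (Poly_Mapping.lookup \<gamma> i) (Poly_Mapping.lookup \<beta> i)) * mono_ev (shift \<xi>) (\<gamma> - \<beta>)"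
    unfolding partial_derivs_def using partial_derivs_list_monom[of "sorted_list_of_set UNIV" \<beta> \<xi> \<gamma>] by simp
  have ev: "eval_poly (mono_ev (shift \<xi>) \<delta>) \<xi> = (\<Prod>i\<in>UNIV. 0 ^ Poly_Mapping.lookup \<delta> i)" for \<delta>
    by (simp add: mono_ev_superset[of UNIV] evp.hom_prod evp.hom_power evp.hom_minus)
  show ?thesis
  proof (cases "\<beta> = \<gamma>")
    case True
    then show ?thesis unfolding eq by (simp add: evp.hom_mult falling_self expo_fact_def)
  next
    case False
    then obtain i where i: "Poly_Mapping.lookup \<beta> i \<noteq> Poly_Mapping.lookup \<gamma> i"
      by (metis poly_mapping_eqI)
    show ?thesis
    proof (cases "Poly_Mapping.lookup \<gamma> i < Poly_Mapping.lookup \<beta> i")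
      case True
      then have "(\<Prod>i\<in>UNIV. falling (Poly_Mapping.lookup \<gamma> i) (Poly_Mapping.lookup \<beta> i)) = 0"
        using falling_zero by (intro prod_zero) auto
      then show ?thesis using False by (simp add: eq evp.hom_mult)
    next
      case False
      with i have "(\<Prod>i\<in>UNIV. (0::complex) ^ Poly_Mapping.lookup (\<gamma> - \<beta>) i) = 0"
        by (intro prod_zero bexI[of _ i]) (auto simp: lookup_minus power_0_left)
      then show ?thesis using \<open>\<beta> \<noteq> \<gamma>\<close> by (simp add: eq evp.hom_mult ev)
    qed
  qed
qed

text \<open>
  The polynomial \<open>p(x + \<xi>)\<close>. Its coefficients are the Taylor coefficients of \<open>p\<close> at \<open>\<xi>\<close>.
\<close>

definition taylor :: "complex^'n \<Rightarrow> 'n::finite cpoly \<Rightarrow> 'n cpoly" where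
  "taylor \<xi> = subst (\<lambda>i. var_poly i + const_poly (vec_nth \<xi> i))"

lemma taylor_hom: "comm_ring_hom (taylor \<xi>)"
  unfolding taylor_def by (rule subst_hom)

interpretation taylor: comm_ring_hom "taylor \<xi>" for \<xi>
  by (rule taylor_hom)

lemma taylor_const: "taylor \<xi> (const_poly c) = const_poly c"
  by (simp add: taylor_def)

lemma subst_shift_taylor: "subst (shift \<xi>) (taylor \<xi> p) = p"
  by (simp add: taylor_def subst_subst sub.hom_add subst_id)

lemma taylor_subst_shift: "taylor \<xi> (subst (shift \<xi>) p) = p"
  by (simp add: taylor_def subst_subst sub.hom_minus subst_id)

lemma taylor_monom: "taylor \<xi> (mono_ev (shift \<xi>) \<gamma>) = Poly_Mapping.single \<gamma> 1"
  using taylor_subst_shift[of \<xi> "Poly_Mapping.single \<gamma> 1"]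
  by (simp add: poly_ev_single[OF const_poly_hom] const_poly_def)

lemma eval_taylor: "eval_poly (taylor \<xi> p) 0 = eval_poly p \<xi>"
  by (simp add: taylor_def eval_subst evp.hom_add vec_nth_inverse)

lemma taylor_expansion:
  "p = (\<Sum>\<gamma>\<in>Poly_Mapping.keys (taylor \<xi> p). const_poly (Poly_Mapping.lookup (taylor \<xi> p) \<gamma>) * mono_ev (shift \<xi>) \<gamma>)"
  using subst_shift_taylor[of \<xi> p, symmetric] by (simp add: poly_ev_def)

lemma partial_derivs_add: "partial_derivs \<beta> (p + q) = partial_derivs \<beta> p + partial_derivs \<beta> q"
proof -
  have "(partial_deriv i ^^ k) (p + q) = (partial_deriv i ^^ k) p + (partial_deriv i ^^ k) q" for i k and p q :: "'a cpoly"
    by (induction k) (simp_all add: partial_deriv_add)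
  then have "foldr (\<lambda>i. partial_deriv i ^^ Poly_Mapping.lookup \<beta> i) xs (p + q) =
    foldr (\<lambda>i. partial_deriv i ^^ Poly_Mapping.lookup \<beta> i) xs p + foldr (\<lambda>i. partial_deriv i ^^ Poly_Mapping.lookup \<beta> i) xs q" for xs
    by (induction xs) simp_all
  then show ?thesis by (simp add: partial_derivs_def)
qed

lemma partial_derivs_const_mult: "partial_derivs \<beta> (const_poly c * p) = const_poly c * partial_derivs \<beta> p"
proof -
  have "(partial_deriv i ^^ k) (const_poly c * p) = const_poly c * (partial_deriv i ^^ k) p" for i k and p :: "'a cpoly"
    by (induction k) (simp_all add: partial_deriv_const_mult)
  then have "foldr (\<lambda>i. partial_deriv i ^^ Poly_Mapping.lookup \<beta> i) xs (const_poly c * p) =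
    const_poly c * foldr (\<lambda>i. partial_deriv i ^^ Poly_Mapping.lookup \<beta> i) xs p" for xs
    by (induction xs) simp_all
  then show ?thesis by (simp add: partial_derivs_def)
qed

text \<open>
  Both sides are linear in \<open>p\<close>, so it suffices to consider the products \<open>(x - \<xi>)\<^sup>\<gamma>\<close>.
\<close>

theorem taylor_coefficient:
  "eval_poly (partial_derivs \<beta> p) \<xi> = expo_fact \<beta> * Poly_Mapping.lookup (taylor \<xi> p) \<beta>"
proof -
  have sum: "eval_poly (partial_derivs \<beta> (\<Sum>\<gamma>\<in>A. F \<gamma>)) \<xi> = (\<Sum>\<gamma>\<in>A. eval_poly (partial_derivs \<beta> (F \<gamma>)) \<xi>)"
    for A :: "'a expo set" and F
  proof (induction A rule: infinite_finite_induct)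
    case (insert x A)
    then show ?case by (simp add: partial_derivs_add evp.hom_add)
  qed (use partial_derivs_const_mult[of \<beta> 0 0] in \<open>simp_all add: const_poly_def\<close>)
  have "eval_poly (partial_derivs \<beta> p) \<xi> =
    (\<Sum>\<gamma>\<in>Poly_Mapping.keys (taylor \<xi> p). Poly_Mapping.lookup (taylor \<xi> p) \<gamma> * (if \<beta> = \<gamma> then expo_fact \<beta> else 0))"
    by (subst taylor_expansion[of p \<xi>], unfold sum)
      (simp add: partial_derivs_const_mult evp.hom_mult partial_derivs_monom)
  also have "\<dots> = (\<Sum>\<gamma>\<in>Poly_Mapping.keys (taylor \<xi> p). if \<beta> = \<gamma> then Poly_Mapping.lookup (taylor \<xi> p) \<gamma> * expo_fact \<beta> else 0)"
    by (intro sum.cong) auto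
  also have "\<dots> = expo_fact \<beta> * Poly_Mapping.lookup (taylor \<xi> p) \<beta>"
    by (auto simp: in_keys_iff)
  finally show ?thesis .
qed

lemma expo_fact_nonzero [simp]: "expo_fact \<beta> \<noteq> 0"
  by (simp add: expo_fact_def)

lemma apply_dfunc_taylor:
  "apply_dfunc \<xi> \<Lambda> p = (\<Sum>\<beta>\<in>Poly_Mapping.keys \<Lambda>. Poly_Mapping.lookup \<Lambda> \<beta> * expo_fact \<beta> * Poly_Mapping.lookup (taylor \<xi> p) \<beta>)"
  by (simp add: apply_dfunc_def taylor_coefficient mult.assoc)

lemma apply_dfunc_add: "apply_dfunc \<xi> \<Lambda> (p + q) = apply_dfunc \<xi> \<Lambda> p + apply_dfunc \<xi> \<Lambda> q"
  by (simp add: apply_dfunc_taylor taylor.hom_add lookup_add distrib_left sum.distrib)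

lemma lookup_const_mult: "Poly_Mapping.lookup (const_poly c * p) \<beta> = c * Poly_Mapping.lookup p \<beta>"
  by (simp add: const_poly_def flip: mult_map_scale_conv_mult) (simp add: map.rep_eq when_def)

lemma apply_dfunc_const_mult: "apply_dfunc \<xi> \<Lambda> (const_poly c * p) = c * apply_dfunc \<xi> \<Lambda> p"
  by (simp add: apply_dfunc_taylor taylor.hom_mult taylor_const lookup_const_mult sum_distrib_left ac_simps)

lemma apply_dfunc_sum: "apply_dfunc \<xi> \<Lambda> (sum F A) = (\<Sum>i\<in>A. apply_dfunc \<xi> \<Lambda> (F i))"
proof (induction A rule: infinite_finite_induct)
  case (insert x A)
  then show ?case by (simp add: apply_dfunc_add)
qed (use apply_dfunc_const_mult[of \<xi> \<Lambda> 0 0] in \<open>simp_all add: const_poly_def\<close>)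

lemma apply_dfunc_monom:
  "apply_dfunc \<xi> \<Lambda> (mono_ev (shift \<xi>) \<beta>) = Poly_Mapping.lookup \<Lambda> \<beta> * expo_fact \<beta>"
proof -
  have "apply_dfunc \<xi> \<Lambda> (mono_ev (shift \<xi>) \<beta>) =
    (\<Sum>\<gamma>\<in>Poly_Mapping.keys \<Lambda>. if \<beta> = \<gamma> then Poly_Mapping.lookup \<Lambda> \<gamma> * expo_fact \<gamma> else 0)"
    unfolding apply_dfunc_taylor taylor_monom by (intro sum.cong) (auto simp: lookup_single when_def)
  also have "\<dots> = Poly_Mapping.lookup \<Lambda> \<beta> * expo_fact \<beta>" by (auto simp: in_keys_iff)
  finally show ?thesis .
qed

section \<open>The dual basis and the multiplication matrices\<close>

lemma finite_expo_deg_le: "finite {\<beta> :: 'n::finite expo. expo_deg \<beta> \<le> d}"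
proof (rule finite_imageD[where f = Poly_Mapping.lookup])
  have "Poly_Mapping.lookup \<beta> i \<le> expo_deg \<beta>" for \<beta> :: "'n expo" and i
    unfolding expo_deg_def by (rule member_le_sum) auto
  then have sub: "Poly_Mapping.lookup ` {\<beta> :: 'n expo. expo_deg \<beta> \<le> d} \<subseteq> PiE UNIV (\<lambda>_. {..d})"
    by (auto simp: PiE_def intro: order_trans)
  have "finite (PiE (UNIV :: 'n set) (\<lambda>_. {..d}))" by (rule finite_PiE) simp_all
  with sub show "finite (Poly_Mapping.lookup ` {\<beta> :: 'n expo. expo_deg \<beta> \<le> d})"
    by (rule finite_subset)
  show "inj_on Poly_Mapping.lookup {\<beta> :: 'n expo. expo_deg \<beta> \<le> d}"
    by (rule inj_onI, rule poly_mapping_eqI) simp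
qed

lemma module_cscale: "Modules.module cscale"
proof -
  show ?thesis
    by unfold_locales (simp_all add: cscale_def cp.hom_add cp.hom_mult distrib_left distrib_right mult.assoc)
qed

locale orthogonal_basis =
  fixes \<xi> :: "complex^('n::{finite,linorder})" and Q :: "'n cpoly set" and \<delta> :: nat
    and \<alpha> :: "nat \<Rightarrow> 'n expo" and \<Lambda> :: "nat \<Rightarrow> 'n dfunc" and \<nu> :: "'n expo \<Rightarrow> 'n expo \<Rightarrow> complex"
  assumes pair: "orthogonal_pair \<xi> Q \<delta> \<alpha> \<Lambda> \<nu>" and Q: "ring_ideal Q"
begin

sublocale Q: ring_ideal Q by (rule Q)

abbreviation E :: "'n expo set" where "E \<equiv> \<alpha> ` {..<\<delta>}"

abbreviation mon :: "'n expo \<Rightarrow> 'n cpoly" where "mon \<equiv> mono_ev (shift \<xi>)"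

lemma pair_facts:
  "quotient_basis Q \<delta> (\<lambda>j. shifted_monom \<xi> (\<alpha> j))" "0 < \<delta>" "\<alpha> 0 = 0" "connected_to_one \<delta> \<alpha>"
  "module.span cscale (\<Lambda> ` {..<\<delta>}) = dual_space \<xi> Q"
  "\<forall>i<\<delta>. \<forall>j<\<delta>. apply_dfunc \<xi> (\<Lambda> i) (shifted_monom \<xi> (\<alpha> j)) = (if i = j then 1 else 0)"
  "\<forall>i<\<delta>. \<Lambda> i = Poly_Mapping.single (\<alpha> i) (1 / expo_fact (\<alpha> i)) +
    (\<Sum>\<beta> | expo_deg \<beta> \<le> expo_deg (\<alpha> i) \<and> \<beta> \<notin> \<alpha> ` {..<\<delta>}.
       Poly_Mapping.single \<beta> (\<nu> (\<alpha> i) \<beta> / expo_fact \<beta>))"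
  "\<forall>i<\<delta>. \<forall>\<beta>. \<beta> \<notin> \<alpha> ` {..<\<delta>} \<and> expo_deg (\<alpha> i) < expo_deg \<beta> \<longrightarrow> \<nu> (\<alpha> i) \<beta> = 0"
  "\<forall>i j. i \<le> j \<and> j < \<delta> \<longrightarrow> dfunc_ord (\<Lambda> i) \<le> dfunc_ord (\<Lambda> j)"
  by - (insert pair, unfold orthogonal_pair_def, (elim conjE, assumption)+)

text \<open>
  The coordinate of the class of \<open>p\<close> in \<open>\<complex>[x]/Q\<close> that belongs to the \<open>l\<close>-th element of the primal
  basis (\<open>coord_expansion\<close>).
\<close>

definition coord :: "nat \<Rightarrow> 'n cpoly \<Rightarrow> complex" where
  "coord l p = apply_dfunc \<xi> (\<Lambda> l) p"

lemma coord_monom: "coord l (mon \<beta>) = Poly_Mapping.lookup (\<Lambda> l) \<beta> * expo_fact \<beta>"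
  by (simp add: coord_def apply_dfunc_monom)

lemma coord_dual: "i < \<delta> \<Longrightarrow> j < \<delta> \<Longrightarrow> coord i (mon (\<alpha> j)) = (if i = j then 1 else 0)"
  using pair_facts(6) by (simp add: coord_def shifted_monom_eq)

lemma \<delta>_pos: "0 < \<delta>" and \<alpha>0: "\<alpha> 0 = 0" and connected: "connected_to_one \<delta> \<alpha>"
  by (fact pair_facts)+

lemma \<alpha>_inj: "i < \<delta> \<Longrightarrow> j < \<delta> \<Longrightarrow> \<alpha> i = \<alpha> j \<longleftrightarrow> i = j"
  using coord_dual[of i j] coord_dual[of i i] by (metis zero_neq_one)

lemma coord_zero:
  assumes "l < \<delta>" "p \<in> Q"
  shows "coord l p = 0"
proof -
  have "\<Lambda> l \<in> module.span cscale (\<Lambda> ` {..<\<delta>})"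
    using assms(1) by (intro Modules.module.span_base[OF module_cscale]) auto
  then have "\<Lambda> l \<in> dual_space \<xi> Q" unfolding pair_facts(5) .
  then show ?thesis using assms(2) by (simp add: dual_space_def coord_def)
qed

lemma coord_add: "coord l (p + q) = coord l p + coord l q"
  by (simp add: coord_def apply_dfunc_add)

lemma coord_const_mult: "coord l (const_poly c * p) = c * coord l p"
  by (simp add: coord_def apply_dfunc_const_mult)

lemma coord_sum: "coord l (sum F A) = (\<Sum>i\<in>A. coord l (F i))"
  by (simp add: coord_def apply_dfunc_sum)

lemma coord_cong:
  assumes "l < \<delta>" "p - q \<in> Q"
  shows "coord l p = coord l q"
  using coord_add[of l "p - q" q] coord_zero[OF assms] by simp

lemma coord_expansion: "p - (\<Sum>j<\<delta>. const_poly (coord j p) * mon (\<alpha> j)) \<in> Q"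
proof -
  from pair_facts(1) have "\<exists>c. p - (\<Sum>j<\<delta>. const_poly (c j) * mon (\<alpha> j)) \<in> Q"
    by (simp add: quotient_basis_def cscale_def shifted_monom_eq)
  then obtain c where c: "p - (\<Sum>j<\<delta>. const_poly (c j) * mon (\<alpha> j)) \<in> Q" ..
  have "coord l p = c l" if l: "l < \<delta>" for l
  proof -
    have "coord l p = (\<Sum>j<\<delta>. c j * coord l (mon (\<alpha> j)))"
      by (simp add: coord_cong[OF l c] coord_sum coord_const_mult)
    also have "\<dots> = (\<Sum>j<\<delta>. if l = j then c j else 0)"
      using l by (intro sum.cong) (auto simp: coord_dual)
    also have "\<dots> = c l" using l by simp
    finally show ?thesis .
  qed
  then have "(\<Sum>j<\<delta>. const_poly (coord j p) * mon (\<alpha> j)) = (\<Sum>j<\<delta>. const_poly (c j) * mon (\<alpha> j))"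
    by (intro sum.cong) auto
  then show ?thesis using c by simp
qed

lemma coord_outside:
  assumes l: "l < \<delta>" and \<beta>: "\<beta> \<notin> E"
  shows "coord l (mon \<beta>) = \<nu> (\<alpha> l) \<beta>"
proof -
  let ?B = "{\<beta>. expo_deg \<beta> \<le> expo_deg (\<alpha> l) \<and> \<beta> \<notin> E}"
  have fin: "finite ?B" by (rule finite_subset[OF _ finite_expo_deg_le[of "expo_deg (\<alpha> l)"]]) auto
  have "\<Lambda> l = Poly_Mapping.single (\<alpha> l) (1 / expo_fact (\<alpha> l)) +
      (\<Sum>\<beta>\<in>?B. Poly_Mapping.single \<beta> (\<nu> (\<alpha> l) \<beta> / expo_fact \<beta>))"
    using pair_facts(7) l by simp
  moreover have "\<alpha> l \<noteq> \<beta>" using l \<beta> by auto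
  ultimately have "Poly_Mapping.lookup (\<Lambda> l) \<beta> =
      (\<Sum>\<gamma>\<in>?B. if \<gamma> = \<beta> then \<nu> (\<alpha> l) \<beta> / expo_fact \<beta> else 0)"
    by (simp add: lookup_add lookup_sum lookup_single when_def) (intro sum.cong, auto)
  also have "\<dots> = (if \<beta> \<in> ?B then \<nu> (\<alpha> l) \<beta> / expo_fact \<beta> else 0)"
    using fin by simp
  also have "\<dots> = \<nu> (\<alpha> l) \<beta> / expo_fact \<beta>"
    using pair_facts(8) l \<beta> by (auto simp: not_le)
  finally show ?thesis by (simp add: coord_monom)
qed

lemma \<nu>_zero: "l < \<delta> \<Longrightarrow> \<beta> \<notin> E \<Longrightarrow> expo_deg (\<alpha> l) < expo_deg \<beta> \<Longrightarrow> \<nu> (\<alpha> l) \<beta> = 0"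
  using pair_facts(8) by simp

lemma dfunc_ord_eq:
  assumes l: "l < \<delta>"
  shows "dfunc_ord (\<Lambda> l) = expo_deg (\<alpha> l)"
  unfolding dfunc_ord_def
proof (rule Max_eqI)
  show "finite (expo_deg ` Poly_Mapping.keys (\<Lambda> l))" by simp
  have key: "\<beta> \<in> Poly_Mapping.keys (\<Lambda> l) \<longleftrightarrow> coord l (mon \<beta>) \<noteq> 0" for \<beta>
    by (simp add: coord_monom in_keys_iff)
  show "expo_deg (\<alpha> l) \<in> expo_deg ` Poly_Mapping.keys (\<Lambda> l)"
    using coord_dual[OF l l] by (intro imageI) (simp add: key)
  fix d assume "d \<in> expo_deg ` Poly_Mapping.keys (\<Lambda> l)"
  then obtain \<beta> where \<beta>: "d = expo_deg \<beta>" "coord l (mon \<beta>) \<noteq> 0" by (auto simp: key)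
  show "d \<le> expo_deg (\<alpha> l)"
  proof (cases "\<beta> \<in> E")
    case True
    then obtain j where "j < \<delta>" "\<beta> = \<alpha> j" by auto
    then show ?thesis using \<beta> coord_dual[OF l] by (auto split: if_splits)
  next
    case False
    then show ?thesis using \<beta> coord_outside[OF l False] \<nu>_zero[OF l False] by force
  qed
qed

lemma deg_mono: "i \<le> j \<Longrightarrow> j < \<delta> \<Longrightarrow> expo_deg (\<alpha> i) \<le> expo_deg (\<alpha> j)"
  using pair_facts(9) dfunc_ord_eq[of i] dfunc_ord_eq[of j] by (metis order_le_less_trans)

text \<open>
  The order of \<open>\<Lambda> l\<close> is the degree of \<open>\<alpha> l\<close>, so the degrees do not decrease along the basis. This is
  why the matrices may be taken strictly triangular.
\<close>

lemma index_less:
  assumes "k < \<delta>" "m < \<delta>" "\<alpha> m = \<alpha> k + unit_expo i"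
  shows "k < m"
proof (rule ccontr)
  assume "\<not> k < m"
  then have "expo_deg (\<alpha> m) \<le> expo_deg (\<alpha> k)" using assms by (intro deg_mono) auto
  then show False using assms by (simp add: expo_deg_add_unit)
qed

subsection \<open>Action of the matrices\<close>

definition M :: "'n \<Rightarrow> 'n mu_poly mat" where
  "M i = par_mult_mat \<delta> \<alpha> i"

lemma M_carrier [simp]: "M i \<in> carrier_mat \<delta> \<delta>"
  by (simp add: M_def par_mult_mat_def)

lemma M_dims [simp]: "dim_row (M i) = \<delta>" "dim_col (M i) = \<delta>"
  by (simp_all add: M_def par_mult_mat_def)

lemma M_pow_carrier [simp]: "M i ^\<^sub>m n \<in> carrier_mat \<delta> \<delta>"
  by (rule pow_carrier_mat) simp

lemma M_entry:
  assumes "r < \<delta>" "k < \<delta>"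
  shows "M i $$ (r, k) = (if r \<le> k then 0 else mu_entry E (\<alpha> r) (\<alpha> k + unit_expo i))"
  using assms by (simp add: M_def par_mult_mat_def)

text \<open>
  Matrices act on functions of the row index; only the arguments below \<open>\<delta>\<close> carry information.
\<close>

definition app :: "'n \<Rightarrow> (nat \<Rightarrow> 'n mu_poly) \<Rightarrow> nat \<Rightarrow> 'n mu_poly" where
  "app i v r = (\<Sum>k<\<delta>. M i $$ (r, k) * v k)"

definition e0 :: "nat \<Rightarrow> 'n mu_poly" where
  "e0 r = (if r = 0 then 1 else 0)"

text \<open>
  The vector \<open>M\<^sup>\<gamma>[1]\<close>, with the product taken over the variables in a list.
\<close>

definition pow_app :: "'n list \<Rightarrow> 'n expo \<Rightarrow> nat \<Rightarrow> 'n mu_poly" where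
  "pow_app xs \<gamma> = foldr (\<lambda>i. app i ^^ Poly_Mapping.lookup \<gamma> i) xs e0"

lemma M_mult_vec: "M i *\<^sub>v Matrix.vec \<delta> v = Matrix.vec \<delta> (app i v)"
  by (intro eq_vecI) (auto simp: app_def scalar_prod_def atLeast0LessThan)

lemma M_pow_mult_vec: "(M i ^\<^sub>m n) *\<^sub>v Matrix.vec \<delta> v = Matrix.vec \<delta> ((app i ^^ n) v)"
proof (induction n arbitrary: v)
  case 0
  then show ?case by simp
next
  case (Suc n)
  have "(M i ^\<^sub>m Suc n) *\<^sub>v Matrix.vec \<delta> v = (M i ^\<^sub>m n) *\<^sub>v (M i *\<^sub>v Matrix.vec \<delta> v)"
    by (simp add: assoc_mult_mat_vec[of _ \<delta> \<delta> _ \<delta>])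
  then show ?case by (simp add: M_mult_vec Suc funpow_swap1)
qed

lemma par_mult_mat_power_vec:
  "par_mult_mat_power \<delta> \<alpha> \<gamma> *\<^sub>v unit_vec \<delta> 0 = Matrix.vec \<delta> (pow_app (sorted_list_of_set UNIV) \<gamma>)"
proof -
  let ?F = "\<lambda>xs. foldr (\<lambda>i A. (M i ^\<^sub>m Poly_Mapping.lookup \<gamma> i) * A) xs (1\<^sub>m \<delta>)"
  have "?F xs \<in> carrier_mat \<delta> \<delta> \<and> ?F xs *\<^sub>v unit_vec \<delta> 0 = Matrix.vec \<delta> (pow_app xs \<gamma>)" for xs
  proof (induction xs)
    case Nil
    have "unit_vec \<delta> 0 = Matrix.vec \<delta> e0" by (intro eq_vecI) (auto simp: e0_def unit_vec_def)
    then show ?case by (simp add: pow_app_def)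
  next
    case (Cons x xs)
    then have "?F (x # xs) *\<^sub>v unit_vec \<delta> 0 = (M x ^\<^sub>m Poly_Mapping.lookup \<gamma> x) *\<^sub>v (?F xs *\<^sub>v unit_vec \<delta> 0)"
      by (simp add: assoc_mult_mat_vec[of _ \<delta> \<delta> _ \<delta>])
    moreover have "?F (x # xs) \<in> carrier_mat \<delta> \<delta>"
      using Cons mult_carrier_mat[OF M_pow_carrier, of _ \<delta>] by simp
    ultimately show ?case using Cons by (simp add: M_pow_mult_vec pow_app_def)
  qed
  then show ?thesis by (simp add: par_mult_mat_power_def M_def)
qed

abbreviation U :: "'n expo \<Rightarrow> nat \<Rightarrow> 'n mu_poly" where
  "U \<equiv> pow_app (sorted_list_of_set UNIV)"

text \<open>
  The normal form as a linear function of the Taylor polynomial at \<open>\<xi>\<close>.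
\<close>

definition nf :: "'n cpoly \<Rightarrow> nat \<Rightarrow> 'n mu_poly" where
  "nf p r = (\<Sum>\<gamma>\<in>Poly_Mapping.keys p. const_poly (Poly_Mapping.lookup p \<gamma>) * U \<gamma> r)"

lemma nf_add: "nf (p + q) r = nf p r + nf q r"
proof -
  show ?thesis unfolding nf_def
    by (rule setsum_keys_plus_distrib[of "\<lambda>\<gamma> c. const_poly c * U \<gamma> r"])
      (simp_all add: cp.hom_add distrib_right)
qed

lemma nf_single: "nf (Poly_Mapping.single \<gamma> c) r = const_poly c * U \<gamma> r"
  by (cases "c = 0") (simp_all add: nf_def const_poly_def)

lemma par_normal_form_index:
  assumes "r < \<delta>"
  shows "vec_index (par_normal_form \<delta> \<alpha> \<xi> p) r = nf (taylor \<xi> p) r"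
proof -
  have "vec_index (par_normal_form \<delta> \<alpha> \<xi> p) r =
      Sum_any (\<lambda>\<gamma>. const_poly (Poly_Mapping.lookup (taylor \<xi> p) \<gamma>) * U \<gamma> r)"
    using assms by (simp add: par_normal_form_def par_mult_mat_power_vec taylor_coefficient cscale_def)
  also have "\<dots> = nf (taylor \<xi> p) r"
    unfolding nf_def by (rule Sum_any.expand_superset) (auto simp: in_keys_iff const_poly_def)
  finally show ?thesis .
qed

lemma dim_par_normal_form: "dim_vec (par_normal_form \<delta> \<alpha> \<xi> p) = \<delta>"
  by (simp add: par_normal_form_def)

lemma commutator_entry:
  assumes "r < \<delta>" "k < \<delta>"
  shows "(M i * M j - M j * M i) $$ (r, k) = app i (\<lambda>s. M j $$ (s, k)) r - app j (\<lambda>s. M i $$ (s, k)) r"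
  using assms by (simp add: app_def scalar_prod_def atLeast0LessThan)

subsection \<open>The matrices at the coefficients of the dual basis\<close>

definition ev_nu :: "'n mu_poly \<Rightarrow> complex" where
  "ev_nu = poly_ev (\<lambda>c. c) (\<lambda>(a, b). \<nu> a b)"

lemma ev_nu_hom: "comm_ring_hom ev_nu"
  unfolding ev_nu_def by (rule poly_ev_hom) (rule id_hom)

sublocale nu: comm_ring_hom ev_nu by (rule ev_nu_hom)

lemma ev_nu_var [simp]: "ev_nu (var_poly (a, b)) = \<nu> a b"
  by (simp add: ev_nu_def id_hom)

lemma ev_nu_const [simp]: "ev_nu (const_poly c) = c"
  by (simp add: ev_nu_def id_hom)

text \<open>
  The specialized \<open>M i\<close> is the matrix of multiplication by \<open>x\<^sub>i - \<xi>\<^sub>i\<close> in the primal basis. Entries that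
  the triangular shape sets to zero agree as well: there the dual basis element has too small an
  order.
\<close>

lemma ev_nu_M:
  assumes r: "r < \<delta>" and k: "k < \<delta>"
  shows "ev_nu (M i $$ (r, k)) = coord r (shift \<xi> i * mon (\<alpha> k))"
proof -
  let ?b = "\<alpha> k + unit_expo i"
  have b: "shift \<xi> i * mon (\<alpha> k) = mon ?b" by (simp add: mono_ev_add mult.commute)
  show ?thesis
  proof (cases "?b \<in> E")
    case True
    from True obtain m where "?b = \<alpha> m" "m \<in> {..<\<delta>}" by (rule imageE)
    then have m: "m < \<delta>" "\<alpha> m = ?b" by simp_all
    have "k < m" using k m by (rule index_less)
    moreover have "coord r (mon ?b) = (if r = m then 1 else 0)" using coord_dual[OF r m(1)] m(2) by simp
    ultimately show ?thesis
      using True m \<alpha>_inj[OF r m(1)] unfolding b by (auto simp: M_entry[OF r k] mu_entry_def)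
  next
    case False
    have "\<nu> (\<alpha> r) ?b = 0" if "r \<le> k"
      using deg_mono[OF that k] by (intro \<nu>_zero[OF r False]) (simp add: expo_deg_add_unit)
    then show ?thesis
      using False unfolding b by (auto simp: M_entry[OF r k] mu_entry_def coord_outside[OF r False])
  qed
qed

lemma ev_nu_app:
  assumes v: "\<And>k. k < \<delta> \<Longrightarrow> ev_nu (v k) = coord k p" and r: "r < \<delta>"
  shows "ev_nu (app i v r) = coord r (shift \<xi> i * p)"
proof -
  have "ev_nu (app i v r) = (\<Sum>k<\<delta>. coord k p * coord r (shift \<xi> i * mon (\<alpha> k)))"
    unfolding app_def nu.hom_sum by (intro sum.cong) (auto simp: nu.hom_mult v ev_nu_M[OF r])
  also have "\<dots> = coord r (shift \<xi> i * (\<Sum>k<\<delta>. const_poly (coord k p) * mon (\<alpha> k)))"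
    by (simp add: coord_sum sum_distrib_left mult.left_commute[of "shift \<xi> i"] coord_const_mult)
  also have "\<dots> = coord r (shift \<xi> i * p)"
    using Q.mult_mem[OF coord_expansion[of p], of "shift \<xi> i"]
    by (intro coord_cong[OF r, symmetric]) (simp add: right_diff_distrib)
  finally show ?thesis .
qed

lemma ev_nu_commutator:
  assumes r: "r < \<delta>" and k: "k < \<delta>"
  shows "ev_nu ((M i * M j - M j * M i) $$ (r, k)) = 0"
proof -
  have "ev_nu (app i (\<lambda>s. M j $$ (s, k)) r) = coord r (shift \<xi> i * (shift \<xi> j * mon (\<alpha> k)))" for i j
  proof (rule ev_nu_app[OF _ r])
    fix s assume "s < \<delta>"
    then show "ev_nu (M j $$ (s, k)) = coord s (shift \<xi> j * mon (\<alpha> k))" using k by (rule ev_nu_M)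
  qed
  then show ?thesis
    by (simp add: commutator_entry[OF r k] nu.hom_minus mult.left_commute)
qed

lemma ev_nu_pow_app:
  assumes r: "r < \<delta>"
  shows "ev_nu (pow_app xs \<gamma> r) = coord r (\<Prod>i\<leftarrow>xs. shift \<xi> i ^ Poly_Mapping.lookup \<gamma> i)"
  using r
proof (induction xs arbitrary: r)
  case Nil
  then show ?case using coord_dual[OF Nil \<delta>_pos] by (simp add: pow_app_def e0_def \<alpha>0)
next
  case (Cons x xs)
  have "ev_nu ((app x ^^ n) (pow_app xs \<gamma>) r) =
      coord r (shift \<xi> x ^ n * (\<Prod>i\<leftarrow>xs. shift \<xi> i ^ Poly_Mapping.lookup \<gamma> i))" if "r < \<delta>" for n r
    using that
  proof (induction n arbitrary: r)
    case (Suc n)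
    show ?case
      unfolding funpow.simps comp_apply power_Suc mult.assoc
      by (rule ev_nu_app[OF _ Suc.prems]) (rule Suc.IH)
  qed (simp add: Cons.IH)
  from this[OF Cons.prems] show ?case by (simp add: pow_app_def)
qed

lemma ev_nu_U:
  assumes "r < \<delta>"
  shows "ev_nu (U \<gamma> r) = coord r (mon \<gamma>)"
proof -
  have "(\<Prod>i\<leftarrow>sorted_list_of_set UNIV. shift \<xi> i ^ Poly_Mapping.lookup \<gamma> i) = mon \<gamma>"
    by (simp add: mono_ev_superset[of UNIV] prod.distinct_set_conv_list[symmetric])
  then show ?thesis by (simp add: ev_nu_pow_app[OF assms])
qed

text \<open>
  At the coefficients of the dual basis, the normal form is the coordinate vector modulo \<open>Q\<close>.
\<close>

lemma ev_nu_nf: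
  assumes "r < \<delta>"
  shows "ev_nu (nf (taylor \<xi> p) r) = coord r p"
  by (subst (2) taylor_expansion[of p \<xi>])
    (simp add: nf_def nu.hom_sum nu.hom_mult ev_nu_U[OF assms] coord_sum coord_const_mult)

end

section \<open>Consequences of the polynomial system\<close>

context orthogonal_basis
begin

abbreviation V :: "('n expo \<times> 'n expo) set" where "V \<equiv> mu_vars \<delta> \<alpha>"

definition vars_in_vec :: "(nat \<Rightarrow> 'n mu_poly) \<Rightarrow> bool" where
  "vars_in_vec v \<longleftrightarrow> (\<forall>k<\<delta>. vars_in V (v k))"

lemma vars_in_M:
  assumes "r < \<delta>" "k < \<delta>"
  shows "vars_in V (M i $$ (r, k))"
proof (cases "r \<le> k \<or> \<alpha> k + unit_expo i \<in> E")
  case True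
  then show ?thesis
    by (auto simp: M_entry[OF assms] mu_entry_def vars_in_zero vars_in_one)
next
  case False
  then have "(\<alpha> r, \<alpha> k + unit_expo i) \<in> V"
    using assms(1) unfolding mu_vars_def by (intro CollectI exI[of _ k] exI[of _ r] exI[of _ i]) simp
  then show ?thesis using False by (simp add: M_entry[OF assms] mu_entry_def vars_in_var)
qed

lemma vars_in_vec_app: "vars_in_vec v \<Longrightarrow> vars_in_vec (app i v)"
  unfolding vars_in_vec_def app_def
  by (auto intro!: vars_in_sum vars_in_mult vars_in_M)

lemma vars_in_vec_funpow: "vars_in_vec v \<Longrightarrow> vars_in_vec ((app i ^^ n) v)"
  by (induction n) (simp_all add: vars_in_vec_app)

lemma vars_in_vec_pow_app: "vars_in_vec (pow_app xs \<gamma>)"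
proof (induction xs)
  case Nil
  show ?case by (simp add: pow_app_def e0_def vars_in_vec_def vars_in_zero vars_in_one)
qed (simp add: pow_app_def vars_in_vec_funpow)

lemma vars_in_vec_nf: "vars_in_vec (nf p)"
  using vars_in_vec_pow_app unfolding nf_def vars_in_vec_def
  by (auto intro!: vars_in_sum vars_in_mult vars_in_const)

lemma app_add: "app i (\<lambda>k. u k + v k) r = app i u r + app i v r"
  by (simp add: app_def distrib_left sum.distrib)

lemma app_mult: "app i (\<lambda>k. c * v k) r = c * app i v r"
  by (simp add: app_def sum_distrib_left mult.left_commute)

lemma app_app_diff:
  assumes "r < \<delta>"
  shows "app i (app j v) r - app j (app i v) r = (\<Sum>k<\<delta>. v k * (M i * M j - M j * M i) $$ (r, k))"
proof -
  have "app i (app j v) r = (\<Sum>k<\<delta>. v k * app i (\<lambda>s. M j $$ (s, k)) r)" for i j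
    unfolding app_def sum_distrib_left by (subst sum.swap) (simp add: ac_simps)
  moreover have "(\<Sum>k<\<delta>. v k * (M i * M j - M j * M i) $$ (r, k)) =
      (\<Sum>k<\<delta>. v k * (app i (\<lambda>s. M j $$ (s, k)) r - app j (\<lambda>s. M i $$ (s, k)) r))"
    by (intro sum.cong refl) (simp only: commutator_entry[OF assms] lessThan_iff)
  ultimately show ?thesis by (simp add: right_diff_distrib sum_subtractf)
qed

lemma pow_app_zero: "pow_app xs 0 = e0"
  by (induction xs) (simp_all add: pow_app_def)

lemma pow_app_unaffected:
  assumes "i \<notin> set xs"
  shows "pow_app xs (\<gamma> + unit_expo i) = pow_app xs \<gamma>"
  using assms by (induction xs) (simp_all add: pow_app_def lookup_add unit_expo_lookup)

lemma nf_const_mult: "nf (const_poly c * p) r = const_poly c * nf p r"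
proof (induction p rule: cpoly_induct_single)
  case (single \<gamma> d)
  have "const_poly c * Poly_Mapping.single \<gamma> d = Poly_Mapping.single \<gamma> (c * d)"
    by (simp add: const_poly_def mult_single)
  then show ?case by (simp add: nf_single cp.hom_mult mult.assoc)
qed (simp add: distrib_left nf_add)

lemma nf_single_one: "nf (Poly_Mapping.single \<gamma> 1) r = U \<gamma> r"
  by (simp add: nf_single)

lemma nf_zero: "nf 0 r = 0"
  by (simp add: nf_def)

lemma nf_minus: "nf (p - q) r = nf p r - nf q r"
  using nf_add[of "p - q" q r] by simp

lemma nf_sum: "nf (sum F A) r = (\<Sum>i\<in>A. nf (F i) r)"
  by (induction A rule: infinite_finite_induct) (simp_all add: nf_add nf_zero)

end

text \<open>
  Instead of a quotient ring, congruences modulo an ideal \<open>L\<close> of the parameter ring are used; the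
  entries of vectors have to be polynomials in the parameters that occur in the matrices.
\<close>

locale relation_ideal = orthogonal_basis +
  fixes L :: "'a mu_poly set"
  assumes L_zero: "0 \<in> L" and L_add: "a \<in> L \<Longrightarrow> b \<in> L \<Longrightarrow> a + b \<in> L"
    and L_mult: "vars_in V c \<Longrightarrow> a \<in> L \<Longrightarrow> c * a \<in> L"
    and L_commutator: "r < \<delta> \<Longrightarrow> k < \<delta> \<Longrightarrow> (M i * M j - M j * M i) $$ (r, k) \<in> L"
begin

lemma L_uminus: "a \<in> L \<Longrightarrow> - a \<in> L"
  using L_mult[OF vars_in_uminus[OF vars_in_one], of a] by simp

lemma L_minus: "a \<in> L \<Longrightarrow> b \<in> L \<Longrightarrow> a - b \<in> L"
  using L_add[of a "- b"] L_uminus by simp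

lemma L_sum: "(\<And>i. i \<in> A \<Longrightarrow> F i \<in> L) \<Longrightarrow> sum F A \<in> L"
  by (induction A rule: infinite_finite_induct) (auto simp: L_zero L_add)

definition eqv :: "(nat \<Rightarrow> 'a mu_poly) \<Rightarrow> (nat \<Rightarrow> 'a mu_poly) \<Rightarrow> bool" where
  "eqv u v \<longleftrightarrow> (\<forall>r<\<delta>. u r - v r \<in> L)"

lemma eqv_refl: "eqv u u"
  by (simp add: eqv_def L_zero)

lemma eqv_sym: "eqv u v \<Longrightarrow> eqv v u"
  unfolding eqv_def using L_uminus by fastforce

lemma eqv_trans:
  assumes "eqv u v" "eqv v w"
  shows "eqv u w"
  unfolding eqv_def
proof (intro allI impI)
  fix r assume "r < \<delta>"
  then have "(u r - v r) + (v r - w r) \<in> L" using assms by (intro L_add) (simp_all add: eqv_def)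
  then show "u r - w r \<in> L" by simp
qed

lemma app_mem: "(\<And>k. k < \<delta> \<Longrightarrow> v k \<in> L) \<Longrightarrow> r < \<delta> \<Longrightarrow> app i v r \<in> L"
  unfolding app_def by (intro L_sum L_mult vars_in_M) auto

lemma app_eqv:
  assumes "eqv u v"
  shows "eqv (app i u) (app i v)"
  unfolding eqv_def
proof (intro allI impI)
  fix r assume r: "r < \<delta>"
  have "app i (\<lambda>k. u k - v k) r \<in> L" using assms r by (intro app_mem) (simp_all add: eqv_def)
  then show "app i u r - app i v r \<in> L"
    by (simp add: app_def right_diff_distrib sum_subtractf)
qed

lemma funpow_eqv: "eqv u v \<Longrightarrow> eqv ((app i ^^ n) u) ((app i ^^ n) v)"
  by (induction n) (simp_all add: app_eqv)

lemma app_commute: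
  assumes "vars_in_vec v"
  shows "eqv (app i (app j v)) (app j (app i v))"
  unfolding eqv_def
proof (intro allI impI)
  fix r assume r: "r < \<delta>"
  show "app i (app j v) r - app j (app i v) r \<in> L"
    unfolding app_app_diff[OF r] using assms r
    by (intro L_sum L_mult L_commutator) (simp_all add: vars_in_vec_def)
qed

lemma app_funpow_commute:
  assumes "vars_in_vec v"
  shows "eqv (app i ((app j ^^ n) v)) ((app j ^^ n) (app i v))"
proof (induction n)
  case (Suc n)
  have "eqv (app i (app j ((app j ^^ n) v))) (app j (app i ((app j ^^ n) v)))"
    by (rule app_commute) (rule vars_in_vec_funpow[OF assms])
  from eqv_trans[OF this app_eqv[OF Suc]] show ?case by simp
qed (simp add: eqv_refl)

text \<open>
  The additional factor \<open>M i\<close> is moved to the front past the factors of the earlier variables.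
\<close>

lemma pow_app_step:
  assumes "distinct xs" "i \<in> set xs"
  shows "eqv (pow_app xs (\<gamma> + unit_expo i)) (app i (pow_app xs \<gamma>))"
  using assms
proof (induction xs)
  case (Cons x xs)
  let ?n = "Poly_Mapping.lookup \<gamma> x"
  have Cons_eq: "pow_app (x # xs) \<beta> = (app x ^^ Poly_Mapping.lookup \<beta> x) (pow_app xs \<beta>)" for \<beta>
    by (simp add: pow_app_def)
  show ?case
  proof (cases "x = i")
    case True
    then have "x \<notin> set xs" "i = x" using Cons.prems by simp_all
    then show ?thesis
      unfolding Cons_eq by (simp add: pow_app_unaffected lookup_add unit_expo_lookup eqv_refl)
  next
    case False
    then have "eqv (pow_app xs (\<gamma> + unit_expo i)) (app i (pow_app xs \<gamma>))" using Cons by simp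
    then have "eqv ((app x ^^ ?n) (pow_app xs (\<gamma> + unit_expo i))) ((app x ^^ ?n) (app i (pow_app xs \<gamma>)))"
      by (rule funpow_eqv)
    moreover have "eqv ((app x ^^ ?n) (app i (pow_app xs \<gamma>))) (app i ((app x ^^ ?n) (pow_app xs \<gamma>)))"
      by (rule eqv_sym, rule app_funpow_commute, rule vars_in_vec_pow_app)
    ultimately show ?thesis using False
      by (simp add: Cons_eq lookup_add unit_expo_lookup) (rule eqv_trans)
  qed
qed simp

lemma U_step: "eqv (U (\<gamma> + unit_expo i)) (app i (U \<gamma>))"
  by (rule pow_app_step) simp_all

lemma nf_var_mult: "eqv (nf (var_poly i * p)) (app i (nf p))"
  unfolding eqv_def
proof (intro allI impI)
  fix r assume r: "r < \<delta>"
  show "nf (var_poly i * p) r - app i (nf p) r \<in> L"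
  proof (induction p rule: cpoly_induct_single)
    case (single \<gamma> c)
    have "app i (nf (Poly_Mapping.single \<gamma> c)) r = const_poly c * app i (U \<gamma>) r"
      by (simp add: nf_single[abs_def] app_mult)
    then have "nf (var_poly i * Poly_Mapping.single \<gamma> c) r - app i (nf (Poly_Mapping.single \<gamma> c)) r =
        const_poly c * (U (\<gamma> + unit_expo i) r - app i (U \<gamma>) r)"
      by (simp add: nf_single right_diff_distrib flip: single_add_unit)
    also have "\<dots> \<in> L" using U_step r by (intro L_mult vars_in_const) (simp add: eqv_def)
    finally show ?case .
  next
    case (add p q)
    have "nf (var_poly i * (p + q)) r - app i (nf (p + q)) r =
        (nf (var_poly i * p) r - app i (nf p) r) + (nf (var_poly i * q) r - app i (nf q) r)"
      by (simp add: distrib_left nf_add[abs_def] app_add)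
    also have "\<dots> \<in> L" using add by (rule L_add)
    finally show ?case .
  qed
qed

lemma nf_var_mult_mem:
  assumes "app i (nf p) r \<in> L" "r < \<delta>"
  shows "nf (var_poly i * p) r \<in> L"
proof -
  have "(nf (var_poly i * p) r - app i (nf p) r) + app i (nf p) r \<in> L"
    using assms nf_var_mult[of i p] by (intro L_add) (simp_all add: eqv_def)
  then show ?thesis by simp
qed

lemma nf_mult_mem:
  assumes "\<And>r. r < \<delta> \<Longrightarrow> nf p r \<in> L" "r < \<delta>"
  shows "nf (g * p) r \<in> L"
  using assms(2)
proof (induction g arbitrary: r rule: cpoly_induct)
  case (const c)
  then show ?case using assms(1) by (simp add: nf_const_mult L_mult vars_in_const)
next
  case (add g g')
  then show ?case by (simp add: distrib_right nf_add L_add)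
next
  case (var i g)
  then show ?case using nf_var_mult_mem[OF app_mem[of "nf (g * p)"]] by (simp add: mult.assoc)
qed

text \<open>
  In Taylor coordinates, \<open>g\<close> acts as the constant \<open>g(0)\<close> plus products with strictly lower triangular
  matrices; the latter only see the components before \<open>s\<close>.
\<close>

lemma nf_triangular:
  assumes low: "\<And>r. r < s \<Longrightarrow> nf p r \<in> L" and s: "s < \<delta>"
  shows "(\<forall>r<s. nf (g * p) r \<in> L) \<and> nf (g * p) s - const_poly (eval_poly g 0) * nf p s \<in> L"
proof (induction g rule: cpoly_induct)
  case (const c)
  then show ?case using low by (simp add: nf_const_mult L_mult vars_in_const L_zero)
next
  case (add g g')
  have eq: "nf ((g + g') * p) s - const_poly (eval_poly (g + g') 0) * nf p s =
      (nf (g * p) s - const_poly (eval_poly g 0) * nf p s) + (nf (g' * p) s - const_poly (eval_poly g' 0) * nf p s)"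
    by (simp add: distrib_right nf_add evp.hom_add cp.hom_add)
  have "nf ((g + g') * p) s - const_poly (eval_poly (g + g') 0) * nf p s \<in> L"
    unfolding eq using add by (intro L_add) simp_all
  moreover have "\<forall>r<s. nf ((g + g') * p) r \<in> L" using add by (simp add: distrib_right nf_add L_add)
  ultimately show ?case by blast
next
  case (var i g)
  have "app i (nf (g * p)) r \<in> L" if r: "r \<le> s" for r
    unfolding app_def
  proof (rule L_sum)
    fix k assume k: "k \<in> {..<\<delta>}"
    show "M i $$ (r, k) * nf (g * p) k \<in> L"
    proof (cases "k < r")
      case True
      then show ?thesis using var r s k by (intro L_mult vars_in_M) auto
    next
      case False
      then have "M i $$ (r, k) = 0" using r s k by (subst M_entry) auto
      then show ?thesis by (simp add: L_zero)
    qed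
  qed
  then have "nf (var_poly i * g * p) r \<in> L" if "r \<le> s" for r
    using that s nf_var_mult_mem[of i "g * p" r] by (simp add: mult.assoc)
  then show ?case by (simp add: evp.hom_mult const_poly_def)
qed

text \<open>
  The components are treated one after the other, using \<open>nf_triangular\<close>.
\<close>

lemma nf_cancel:
  assumes g: "eval_poly g 0 \<noteq> 0" and gp: "\<And>r. r < \<delta> \<Longrightarrow> nf (g * p) r \<in> L" and "r < \<delta>"
  shows "nf p r \<in> L"
  using \<open>r < \<delta>\<close>
proof (induction r rule: less_induct)
  case (less s)
  have "nf (g * p) s - const_poly (eval_poly g 0) * nf p s \<in> L"
    using nf_triangular[of s p g] less by simp
  from L_minus[OF gp[OF less.prems] this] have "const_poly (eval_poly g 0) * nf p s \<in> L" by simp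
  from L_mult[OF vars_in_const[of _ "1 / eval_poly g 0"] this]
  have "(const_poly (1 / eval_poly g 0) * const_poly (eval_poly g 0)) * nf p s \<in> L"
    by (simp add: mult.assoc)
  then show ?case using g by (simp flip: cp.hom_mult)
qed

lemma app_basis:
  assumes "r < \<delta>" "k < \<delta>"
  shows "app i (\<lambda>s. if s = k then 1 else 0) r = M i $$ (r, k)"
proof -
  have "app i (\<lambda>s. if s = k then 1 else 0) r = (\<Sum>s<\<delta>. if s = k then M i $$ (r, s) else 0)"
    unfolding app_def by (intro sum.cong) auto
  then show ?thesis using assms by simp
qed

text \<open>
  Since the basis is connected to \<open>1\<close>, the vector \<open>M\<^sup>\<gamma>[1]\<close> for \<open>\<gamma> = \<alpha> k\<close> arises from an earlier one by a
  matrix whose relevant column is a unit vector.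
\<close>

lemma U_basis: "k < \<delta> \<Longrightarrow> eqv (U (\<alpha> k)) (\<lambda>r. if r = k then 1 else 0)"
proof (induction k rule: less_induct)
  case (less k)
  show ?case
  proof (cases "\<alpha> k = 0")
    case True
    then have "k = 0" using \<alpha>_inj[OF less.prems \<delta>_pos] \<alpha>0 by simp
    have "U (\<alpha> k) = e0" unfolding True by (rule pow_app_zero)
    then show ?thesis using \<open>k = 0\<close> by (simp add: eqv_def e0_def L_zero)
  next
    case False
    from connected[unfolded connected_to_one_def, rule_format, OF less.prems False]
    obtain j where j': "j < \<delta> \<and> (\<exists>i. \<alpha> k = \<alpha> j + unit_expo i)" ..
    then have j: "j < \<delta>" ..
    from conjunct2[OF j'] obtain i where step: "\<alpha> k = \<alpha> j + unit_expo i" ..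
    have jk: "j < k" using j less.prems step by (rule index_less)
    let ?e = "\<lambda>k r. if r = k then 1 else 0 :: 'a mu_poly"
    have "eqv (U (\<alpha> k)) (app i (U (\<alpha> j)))" unfolding step by (rule U_step)
    moreover have "eqv (app i (U (\<alpha> j))) (app i (?e j))" using less.IH[OF jk j] by (rule app_eqv)
    moreover have "eqv (app i (?e j)) (?e k)"
      unfolding eqv_def
    proof (intro allI impI)
      fix r assume r: "r < \<delta>"
      have "\<alpha> k \<in> E" using less.prems by blast
      then have "M i $$ (r, j) = ?e k r"
        using \<alpha>_inj[OF r less.prems] jk by (auto simp: M_entry[OF r j] mu_entry_def step[symmetric])
      then show "app i (?e j) r - ?e k r \<in> L" by (simp add: app_basis[OF r j] L_zero)
    qed
    ultimately show ?thesis using eqv_trans by blast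
  qed
qed

text \<open>
  Modulo \<open>L\<close>, the normal form of \<open>(x - \<xi>)\<^sup>\<beta>\<close> for \<open>\<beta> = \<alpha> k + e\<^sub>i\<close> is computed in two ways: as the
  \<open>k\<close>-th column of \<open>M i\<close>, which contains the parameter, and from the expansion of \<open>(x - \<xi>)\<^sup>\<beta>\<close> modulo \<open>Q\<close>
  in the primal basis, which contains the coefficient of the dual basis.
\<close>

theorem variable_determined:
  assumes Q_nf: "\<And>q r. q \<in> Q \<Longrightarrow> r < \<delta> \<Longrightarrow> nf (taylor \<xi> q) r \<in> L"
    and kl: "k < l" "l < \<delta>" and b: "\<alpha> k + unit_expo i \<notin> E"
  shows "var_poly (\<alpha> l, \<alpha> k + unit_expo i) - const_poly (\<nu> (\<alpha> l) (\<alpha> k + unit_expo i)) \<in> L"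
proof -
  let ?b = "\<alpha> k + unit_expo i"
  let ?c = "\<lambda>j. const_poly (coord j (mon ?b)) :: 'a mu_poly"
  have k: "k < \<delta>" using kl by simp
  have "taylor \<xi> (mon ?b - (\<Sum>j<\<delta>. const_poly (coord j (mon ?b)) * mon (\<alpha> j))) =
      Poly_Mapping.single ?b 1 - (\<Sum>j<\<delta>. const_poly (coord j (mon ?b)) * Poly_Mapping.single (\<alpha> j) 1)"
    by (simp only: taylor.hom_minus taylor.hom_sum taylor.hom_mult taylor_monom taylor_const)
  then have "nf (taylor \<xi> (mon ?b - (\<Sum>j<\<delta>. const_poly (coord j (mon ?b)) * mon (\<alpha> j)))) l =
      U ?b l - (\<Sum>j<\<delta>. ?c j * U (\<alpha> j) l)"
    by (simp add: nf_minus nf_sum nf_const_mult nf_single_one)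
  then have "U ?b l - (\<Sum>j<\<delta>. ?c j * U (\<alpha> j) l) \<in> L"
    using Q_nf[OF coord_expansion[of "mon ?b"] kl(2)] by simp
  moreover have "(\<Sum>j<\<delta>. ?c j * (U (\<alpha> j) l - (if l = j then 1 else 0))) \<in> L"
    using U_basis kl(2) by (intro L_sum L_mult vars_in_const) (simp add: eqv_def)
  ultimately have "(U ?b l - (\<Sum>j<\<delta>. ?c j * U (\<alpha> j) l)) + (\<Sum>j<\<delta>. ?c j * (U (\<alpha> j) l - (if l = j then 1 else 0))) \<in> L"
    by (rule L_add)
  moreover have "(\<Sum>j<\<delta>. ?c j * (if l = j then 1 else 0)) = ?c l"
  proof -
    have "(\<Sum>j<\<delta>. ?c j * (if l = j then 1 else 0)) = (\<Sum>j<\<delta>. if l = j then ?c j else 0)"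
      by (intro sum.cong) auto
    then show ?thesis using kl(2) by simp
  qed
  ultimately have "U ?b l - ?c l \<in> L"
    by (simp add: right_diff_distrib sum_subtractf)
  moreover have "U ?b l - var_poly (\<alpha> l, ?b) \<in> L"
  proof -
    have "eqv (U ?b) (app i (\<lambda>s. if s = k then 1 else 0))"
      using U_step app_eqv[OF U_basis[OF k]] by (rule eqv_trans)
    then have "U ?b l - app i (\<lambda>s. if s = k then 1 else 0) l \<in> L"
      using kl(2) unfolding eqv_def by blast
    then have "U ?b l - M i $$ (l, k) \<in> L" unfolding app_basis[OF kl(2) k] .
    then show ?thesis using kl(1) b by (simp add: M_entry[OF kl(2) k] mu_entry_def)
  qed
  ultimately have "(U ?b l - ?c l) - (U ?b l - var_poly (\<alpha> l, ?b)) \<in> L" by (rule L_minus)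
  then show ?thesis by (simp add: coord_outside[OF kl(2) b])
qed

end

section \<open>The ring of parameters\<close>

lemma carrier_mu_ring: "carrier (mu_ring \<delta> \<alpha>) = {p. vars_in (mu_vars \<delta> \<alpha>) p}"
  by (simp add: mu_ring_def vars_in_def)

lemma mu_ring_simps [simp]:
  "p \<otimes>\<^bsub>mu_ring \<delta> \<alpha>\<^esub> q = p * q" "p \<oplus>\<^bsub>mu_ring \<delta> \<alpha>\<^esub> q = p + q"
  "\<zero>\<^bsub>mu_ring \<delta> \<alpha>\<^esub> = 0" "\<one>\<^bsub>mu_ring \<delta> \<alpha>\<^esub> = 1"
  by (simp_all add: mu_ring_def ring_of_type_algebra_def)

lemma cring_mu_ring: "cring (mu_ring \<delta> \<alpha>)"
proof (rule cringI)
  show "abelian_group (mu_ring \<delta> \<alpha>)"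
  proof (rule abelian_groupI)
    fix p assume "p \<in> carrier (mu_ring \<delta> \<alpha>)"
    then show "\<exists>q\<in>carrier (mu_ring \<delta> \<alpha>). q \<oplus>\<^bsub>mu_ring \<delta> \<alpha>\<^esub> p = \<zero>\<^bsub>mu_ring \<delta> \<alpha>\<^esub>"
      by (intro bexI[of _ "- p"]) (simp_all add: carrier_mu_ring vars_in_uminus)
  qed (simp_all add: carrier_mu_ring vars_in_add vars_in_zero ac_simps)
  show "comm_monoid (mu_ring \<delta> \<alpha>)"
    by (rule comm_monoidI) (simp_all add: carrier_mu_ring vars_in_mult vars_in_one ac_simps)
qed (simp add: distrib_right)

lemma ideal_mu_ringD:
  assumes "ideal J (mu_ring \<delta> \<alpha>)"
  shows "0 \<in> J" "a \<in> J \<Longrightarrow> b \<in> J \<Longrightarrow> a + b \<in> J"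
    "vars_in (mu_vars \<delta> \<alpha>) c \<Longrightarrow> a \<in> J \<Longrightarrow> c * a \<in> J" "a \<in> J \<Longrightarrow> vars_in (mu_vars \<delta> \<alpha>) a"
  using additive_subgroup.zero_closed[OF ideal.axioms(1)[OF assms]]
    additive_subgroup.a_closed[OF ideal.axioms(1)[OF assms], of a b] ideal.I_l_closed[OF assms, of a c]
    ideal.Icarr[OF assms, of a]
  by (simp_all add: carrier_mu_ring)

lemma ideal_mu_ringI:
  assumes "J \<subseteq> {p. vars_in (mu_vars \<delta> \<alpha>) p}" "0 \<in> J" and add: "\<And>a b. a \<in> J \<Longrightarrow> b \<in> J \<Longrightarrow> a + b \<in> J"
    and mult: "\<And>a c. vars_in (mu_vars \<delta> \<alpha>) c \<Longrightarrow> a \<in> J \<Longrightarrow> c * a \<in> J"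
  shows "ideal J (mu_ring \<delta> \<alpha>)"
proof -
  interpret R: cring "mu_ring \<delta> \<alpha>" by (rule cring_mu_ring)
  have inv: "\<ominus>\<^bsub>mu_ring \<delta> \<alpha>\<^esub> a = - a" if "a \<in> J" for a
    using that assms(1) by (intro R.minus_equality) (auto simp: carrier_mu_ring vars_in_uminus)
  have "- a \<in> J" if "a \<in> J" for a
    using mult[OF vars_in_uminus[OF vars_in_one] that] by simp
  then have "subgroup J (add_monoid (mu_ring \<delta> \<alpha>))"
    using assms inv by (intro R.add.subgroupI) (auto simp: carrier_mu_ring a_inv_def)
  moreover have "a * c \<in> J" if "vars_in (mu_vars \<delta> \<alpha>) c" "a \<in> J" for a c
    using mult[OF that] by (simp add: mult.commute)
  ultimately show ?thesis
    by (intro idealI R.ring_axioms) (auto simp: carrier_mu_ring mult)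
qed

context orthogonal_basis
begin

definition nu_kernel :: "'n mu_poly set" where
  "nu_kernel = {p. vars_in V p \<and> ev_nu p = 0}"

lemma ideal_nu_kernel: "ideal nu_kernel (mu_ring \<delta> \<alpha>)"
  by (rule ideal_mu_ringI)
    (auto simp: nu_kernel_def vars_in_zero vars_in_add vars_in_mult nu.hom_add nu.hom_mult)

text \<open>
  Every parameter that occurs in the matrices is indexed by a pair in \<open>E \<times> border E\<close>.
\<close>

lemma nu_generators:
  "{var_poly (a, b) - const_poly (\<nu> a b) | a b. (a, b) \<in> E \<times> border E \<and> (a, b) \<in> V}
    = (\<lambda>(a, b). var_poly (a, b) - const_poly (\<nu> a b)) ` V" (is "?G = _")
proof -
  have "(a, b) \<in> E \<times> border E" if "(a, b) \<in> V" for a b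
    using that by (fastforce simp: mu_vars_def border_def)
  then have "?G = {var_poly (a, b) - const_poly (\<nu> a b) | a b. (a, b) \<in> V}" by blast
  also have "\<dots> = (\<lambda>(a, b). var_poly (a, b) - const_poly (\<nu> a b)) ` V" by force
  finally show ?thesis .
qed

text \<open>
  Modulo the generators, every polynomial is congruent to its value at the coefficients \<open>\<nu>\<close>.
\<close>

lemma nu_ideal_eq_kernel: "nu_ideal \<delta> \<alpha> \<nu> = nu_kernel"
proof
  interpret R: cring "mu_ring \<delta> \<alpha>" by (rule cring_mu_ring)
  let ?G = "(\<lambda>(a, b). var_poly (a, b) - const_poly (\<nu> a b)) ` V"
  have nu: "nu_ideal \<delta> \<alpha> \<nu> = genideal (mu_ring \<delta> \<alpha>) ?G"
    unfolding nu_ideal_def nu_generators ..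
  have G: "?G \<subseteq> nu_kernel"
    by (auto simp: nu_kernel_def nu.hom_minus intro!: vars_in_minus vars_in_var vars_in_const)
  show "nu_ideal \<delta> \<alpha> \<nu> \<subseteq> nu_kernel"
    unfolding nu by (rule R.genideal_minimal[OF ideal_nu_kernel G])
  have GC: "?G \<subseteq> carrier (mu_ring \<delta> \<alpha>)" using G by (auto simp: carrier_mu_ring nu_kernel_def)
  have id: "ideal (nu_ideal \<delta> \<alpha> \<nu>) (mu_ring \<delta> \<alpha>)"
    unfolding nu by (rule R.genideal_ideal[OF GC])
  note J = ideal_mu_ringD[OF id]
  have gen: "var_poly v - const_poly (ev_nu (var_poly v)) \<in> nu_ideal \<delta> \<alpha> \<nu>" if "v \<in> V" for v
    using R.genideal_self[OF GC] that unfolding nu by (cases v) force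
  have mono: "Poly_Mapping.single \<gamma> c - const_poly (ev_nu (Poly_Mapping.single \<gamma> c)) \<in> nu_ideal \<delta> \<alpha> \<nu>"
    if "Poly_Mapping.keys \<gamma> \<subseteq> V" for \<gamma> c
    using that
  proof (induction \<gamma> rule: expo_induct)
    case zero
    show ?case using J(1) ev_nu_const[of c] by (simp add: const_poly_def)
  next
    case (step \<gamma> i)
    have keys: "Poly_Mapping.keys \<gamma> \<subseteq> V" "i \<in> V"
      using step.prems by (auto simp: in_keys_iff lookup_add unit_expo_lookup)
    let ?s = "Poly_Mapping.single \<gamma> c"
    have "Poly_Mapping.single (\<gamma> + unit_expo i) c - const_poly (ev_nu (Poly_Mapping.single (\<gamma> + unit_expo i) c)) =
        var_poly i * (?s - const_poly (ev_nu ?s)) +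
        const_poly (ev_nu ?s) * (var_poly i - const_poly (ev_nu (var_poly i)))"
      by (simp add: single_add_unit nu.hom_mult cp.hom_mult algebra_simps)
    also have "\<dots> \<in> nu_ideal \<delta> \<alpha> \<nu>"
      by (intro J(2) J(3) vars_in_var vars_in_const step.IH gen keys)
    finally show ?case .
  qed
  show "nu_kernel \<subseteq> nu_ideal \<delta> \<alpha> \<nu>"
  proof
    fix p assume p: "p \<in> nu_kernel"
    have J_sum: "finite A \<Longrightarrow> (\<And>i. i \<in> A \<Longrightarrow> F i \<in> nu_ideal \<delta> \<alpha> \<nu>) \<Longrightarrow> sum F A \<in> nu_ideal \<delta> \<alpha> \<nu>"
      for F and A :: "('n expo \<times> 'n expo) expo set"
      by (induction A rule: finite_induct) (auto simp: J(1) J(2))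
    let ?s = "\<lambda>\<gamma>. Poly_Mapping.single \<gamma> (Poly_Mapping.lookup p \<gamma>)"
    have "(\<Sum>\<gamma>\<in>Poly_Mapping.keys p. ?s \<gamma> - const_poly (ev_nu (?s \<gamma>))) \<in> nu_ideal \<delta> \<alpha> \<nu>"
      using p by (intro J_sum mono) (auto simp: nu_kernel_def vars_in_def)
    also have "(\<Sum>\<gamma>\<in>Poly_Mapping.keys p. ?s \<gamma> - const_poly (ev_nu (?s \<gamma>))) = p - const_poly (ev_nu p)"
      by (simp add: sum_subtractf flip: cp.hom_sum nu.hom_sum cpoly_as_sum)
    also have "p - const_poly (ev_nu p) = p" using p by (simp add: nu_kernel_def)
    finally show "p \<in> nu_ideal \<delta> \<alpha> \<nu>" .
  qed
qed

lemma maximalideal_nu_kernel: "maximalideal nu_kernel (mu_ring \<delta> \<alpha>)"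
proof (rule maximalidealI[OF ideal_nu_kernel])
  have "(1 :: 'n mu_poly) \<in> carrier (mu_ring \<delta> \<alpha>)" "1 \<notin> nu_kernel"
    by (simp_all add: carrier_mu_ring vars_in_one nu_kernel_def)
  then show "carrier (mu_ring \<delta> \<alpha>) \<noteq> nu_kernel" by blast
  fix J assume J: "ideal J (mu_ring \<delta> \<alpha>)" "nu_kernel \<subseteq> J" "J \<subseteq> carrier (mu_ring \<delta> \<alpha>)"
  note JD = ideal_mu_ringD[OF J(1)]
  show "J = nu_kernel \<or> J = carrier (mu_ring \<delta> \<alpha>)"
  proof (rule disjCI)
    assume "J \<noteq> carrier (mu_ring \<delta> \<alpha>)"
    show "J = nu_kernel"
    proof (rule ccontr)
      assume "J \<noteq> nu_kernel"
      then obtain p where p: "p \<in> J" "p \<notin> nu_kernel" using J(2) by blast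
      then have c: "ev_nu p \<noteq> 0" using JD(4) by (simp add: nu_kernel_def)
      have "const_poly (ev_nu p) - p \<in> nu_kernel"
        using JD(4)[OF p(1)] by (simp add: nu_kernel_def nu.hom_minus vars_in_minus vars_in_const)
      then have "(const_poly (ev_nu p) - p) + p \<in> J" using J(2) p(1) by (intro JD(2)) auto
      then have "const_poly (ev_nu p) \<in> J" by simp
      from JD(3)[OF vars_in_const[of _ "1 / ev_nu p"] this] have one: "1 \<in> J"
        using c by (simp flip: cp.hom_mult)
      have "a \<in> J" if "vars_in V a" for a using JD(3)[OF that one] by simp
      then have "carrier (mu_ring \<delta> \<alpha>) \<subseteq> J" by (auto simp: carrier_mu_ring)
      then show False using J(3) \<open>J \<noteq> carrier (mu_ring \<delta> \<alpha>)\<close> by blast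
    qed
  qed
qed

end

theorem theorem4p8:
  fixes K :: "complex set"
    and N :: nat
    and f :: "nat \<Rightarrow> 'n::{finite,linorder} cpoly"
    and \<xi> :: "complex^('n::{finite,linorder})"
    and Q :: "'n cpoly set"
    and \<delta> :: nat
    and \<alpha> :: "nat \<Rightarrow> 'n expo"
    and \<Lambda> :: "nat \<Rightarrow> 'n dfunc"
    and \<nu> :: "'n expo \<Rightarrow> 'n expo \<Rightarrow> complex"
  assumes "subfield K (ring_of_type_algebra :: complex ring)"
    and "\<forall>k<N. \<forall>m. Poly_Mapping.lookup (f k) m \<in> K"
    and "\<xi> isolated_in {z. \<forall>k<N. eval_poly (f k) z = 0}"
    and "primary_component_at \<xi> (genideal ring_of_type_algebra (f ` {..<N})) Q"
    and "orthogonal_pair \<xi> Q \<delta> \<alpha> \<Lambda> \<nu>"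
  shows "system_ideal \<delta> \<alpha> \<xi> N f = nu_ideal \<delta> \<alpha> \<nu> \<and>
         maximalideal (nu_ideal \<delta> \<alpha> \<nu>) (mu_ring \<delta> \<alpha>)"
proof -
  note local = primary_component_local[OF assms(3,4)]
  interpret orthogonal_basis \<xi> Q \<delta> \<alpha> \<Lambda> \<nu>
    by (rule orthogonal_basis.intro[OF assms(5) local(1)])
  interpret R: cring "mu_ring \<delta> \<alpha>" by (rule cring_mu_ring)
  let ?NF = "\<Union>k<N. vec_set (par_normal_form \<delta> \<alpha> \<xi> (f k))"
  let ?CM = "\<Union>i. \<Union>j. elements_mat (M i * M j - M j * M i)"
  let ?L = "system_ideal \<delta> \<alpha> \<xi> N f"
  have L: "?L = genideal (mu_ring \<delta> \<alpha>) (?NF \<union> ?CM)"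
    by (simp add: system_ideal_def M_def)
  have "nf (taylor \<xi> (f k)) r \<in> nu_kernel" if "k < N" "r < \<delta>" for k r
    using vars_in_vec_nf[of "taylor \<xi> (f k)"] coord_zero[OF that(2) local(2)[OF that(1)]] that(2)
    by (simp add: nu_kernel_def vars_in_vec_def ev_nu_nf)
  moreover have "(M i * M j - M j * M i) $$ (r, k) \<in> nu_kernel" if "r < \<delta>" "k < \<delta>" for i j r k
  proof -
    have "vars_in_vec (app i (\<lambda>s. M j $$ (s, k)))" for i j
      using that(2) by (intro vars_in_vec_app) (simp add: vars_in_vec_def vars_in_M)
    then have "vars_in V ((M i * M j - M j * M i) $$ (r, k))"
      unfolding commutator_entry[OF that] using that
      by (intro vars_in_minus) (simp_all add: vars_in_vec_def)
    then show ?thesis using ev_nu_commutator[OF that] by (simp add: nu_kernel_def)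
  qed
  ultimately have gens: "?NF \<union> ?CM \<subseteq> nu_kernel"
    by (auto simp: vec_set_def elements_mat_def dim_par_normal_form par_normal_form_index)
  have gensC: "?NF \<union> ?CM \<subseteq> carrier (mu_ring \<delta> \<alpha>)"
    using gens additive_subgroup.a_subset[OF ideal.axioms(1)[OF ideal_nu_kernel]] by (rule subset_trans)
  have idL: "ideal ?L (mu_ring \<delta> \<alpha>)" unfolding L by (rule R.genideal_ideal[OF gensC])
  have self: "?NF \<union> ?CM \<subseteq> ?L" unfolding L by (rule R.genideal_self[OF gensC])
  have sub: "?L \<subseteq> nu_ideal \<delta> \<alpha> \<nu>"
    unfolding nu_ideal_eq_kernel L by (rule R.genideal_minimal[OF ideal_nu_kernel gens])
  interpret relation_ideal \<xi> Q \<delta> \<alpha> \<Lambda> \<nu> ?L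
  proof
    show "(M i * M j - M j * M i) $$ (r, k) \<in> ?L" if "r < \<delta>" "k < \<delta>" for i j r k
      using self that by (force simp: elements_mat_def)
  qed (use ideal_mu_ringD[OF idL] in auto)
  have f_L: "nf (taylor \<xi> (f k)) r \<in> ?L" if "k < N" "r < \<delta>" for k r
  proof -
    have "vec_index (par_normal_form \<delta> \<alpha> \<xi> (f k)) r \<in> vec_set (par_normal_form \<delta> \<alpha> \<xi> (f k))"
      using that by (auto simp: vec_set_def dim_par_normal_form)
    then show ?thesis using self that by (auto simp: par_normal_form_index)
  qed
  \<comment> \<open>The polynomials with normal form zero modulo the system form an ideal.\<close>
  define I where "I = {p. \<forall>r<\<delta>. nf (taylor \<xi> p) r \<in> ?L}"
  have "ring_ideal I"
    by unfold_locales
      (auto simp: I_def taylor.hom_add taylor.hom_mult nf_add nf_zero L_zero L_add intro!: nf_mult_mem)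
  then have I: "genideal ring_of_type_algebra (f ` {..<N}) \<subseteq> I"
    by (rule genideal_type_minimal) (auto simp: I_def f_L)
  have Q_L: "nf (taylor \<xi> q) r \<in> ?L" if q: "q \<in> Q" and r: "r < \<delta>" for q r
  proof -
    obtain g where g: "eval_poly g \<xi> \<noteq> 0" "g * q \<in> genideal ring_of_type_algebra (f ` {..<N})"
      using local(3)[OF q] by blast
    then have gq: "g * q \<in> I" using I by blast
    show ?thesis
    proof (rule nf_cancel[OF _ _ r])
      show "eval_poly (taylor \<xi> g) 0 \<noteq> 0" using g(1) by (simp add: eval_taylor)
      show "nf (taylor \<xi> g * taylor \<xi> q) s \<in> ?L" if "s < \<delta>" for s
        using gq that by (simp add: I_def taylor.hom_mult)
    qed
  qed
  have "(\<lambda>(a, b). var_poly (a, b) - const_poly (\<nu> a b)) ` V \<subseteq> ?L"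
    using variable_determined[OF Q_L] by (auto simp: mu_vars_def)
  then have "nu_ideal \<delta> \<alpha> \<nu> \<subseteq> ?L"
    unfolding nu_ideal_def nu_generators by (rule R.genideal_minimal[OF idL])
  with sub have "?L = nu_ideal \<delta> \<alpha> \<nu>" by blast
  then show ?thesis using maximalideal_nu_kernel by (simp add: nu_ideal_eq_kernel)
qed

end
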